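(* Let $k$ be a perfect field with $\operatorname{char} k\neq 2$, and let $C_1/k$, $C_2/k$ be curves of genus 2 with $A_i=\operatorname{Aut}(C_i)\simeq D_8$ ($i=1,2$). Suppose that $C_1$ and $C_2$ are $\overline k$-isomorphic and that $A_1$ and $A_2$ are isomorphic as $G_k$-groups. Write $A_1=\langle U,V\mid U^2=V^4=1,\ VU=UV^3\rangle$ (so $V$ generates the unique cyclic subgroup of order 4 of $A_1$), and let $K_2=k(\sqrt v)$, $v\in k^*$, be the field of definition of the $G_k$-action on $\langle V\rangle$. Define $\Xi:G_k\to A_1$ by $\Xi_\sigma=1$ if ${}^\sigma\sqrt v=\sqrt v$ and $\Xi_\sigma=V$ if ${}^\sigma\sqrt v=-\sqrt v$. Then there is a 1-cocycle $\xi:G_k\to\{1,\iota\}$ (with $\iota$ the hyperelliptic involution of $C_1$) such that $C_2$ is $k$-isomorphic to the twist of $C_1$ by $\xi$ or to the twist of $C_1$ by the cocycle $\sigma\mapsto\xi_\sigma\Xi_\sigma$.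
   Context: $\overline k$ is an algebraic closure of $k$ and $G_k=\operatorname{Gal}(\overline k/k)$. A $G_k$-group is a finite group with an action of $G_k$ by group automorphisms factoring through a finite quotient; $\operatorname{Aut}(C)$ (automorphisms over $\overline k$) is a $G_k$-group via $\phi\mapsto{}^\sigma\phi$. For a $G_k$-group $A$ with action $\rho:G_k\to\operatorname{Aut}(A)$, its field of definition is the fixed field of $\ker\rho$; the field of definition of the induced action on a characteristic subgroup is defined likewise. A 1-cocycle $\eta:G_k\to\operatorname{Aut}(C)$ satisfies $\eta_{\sigma\tau}=\eta_\sigma\,{}^\sigma\eta_\tau$; the twist of $C$ by $\eta$ is a curve $C'/k$ together with a $\overline k$-isomorphism $\phi:C'\to C$ with ${}^\sigma\phi\circ\phi^{-1}=\eta_\sigma$ for all $\sigma\in G_k$ (unique up to $k$-isomorphism). Twisting a curve $Y^2=F(X)$ by the cocycle with values in $\{1,\iota\}$ whose kernel cuts out $k(\sqrt d)$ gives the curve $Y^2=dF(X)$ (a hyperelliptic twist). *)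

theory Defs
  imports "HOL-Algebra.Generated_Groups" "HOL-Algebra.Algebraic_Closure_Type"
    "HOL-Library.Function_Algebras"
begin

section \<open>Fields\<close>

definition is_subfield :: "'a::field set \<Rightarrow> bool" where
  "is_subfield F \<longleftrightarrow> 1 \<in> F \<and> (\<forall>x\<in>F. \<forall>y\<in>F. x - y \<in> F \<and> x * y \<in> F \<and> inverse x \<in> F)"

definition field_adjoin :: "'a::field set \<Rightarrow> 'a set \<Rightarrow> 'a set" where
  "field_adjoin K S = \<Inter>{F. is_subfield F \<and> K \<subseteq> F \<and> S \<subseteq> F}"

definition is_field_hom :: "('a::field \<Rightarrow> 'b::field) \<Rightarrow> bool" where
  "is_field_hom h \<longleftrightarrow>
     h 1 = 1 \<and> (\<forall>x y. h (x + y) = h x + h y) \<and> (\<forall>x y. h (x * y) = h x * h y)"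

definition perfect :: "'k::field itself \<Rightarrow> bool" where
  "perfect _ \<longleftrightarrow> (\<forall>p :: 'k poly. Factorial_Ring.irreducible p \<longrightarrow> coprime p (pderiv p))"

definition Gal :: "('k::field alg_closure \<Rightarrow> 'k alg_closure) set" where
  "Gal = {\<sigma>. is_field_hom \<sigma> \<and> bij \<sigma> \<and> (\<forall>c. \<sigma> (to_ac c) = to_ac c)}"

text \<open>Continuity for the Krull topology on \<open>Gal\<close> and the discrete topology on \<open>'x\<close>: the
  values depend only on the action on finitely many elements of the algebraic closure
  (\<open>Gal\<close> is profinite, so locally constant maps are uniformly so).\<close>

definition krull_continuous ::
    "(('k::field alg_closure \<Rightarrow> 'k alg_closure) \<Rightarrow> 'x) \<Rightarrow> bool" where
  "krull_continuous \<eta> \<longleftrightarrow>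
     (\<exists>S. finite S \<and> (\<forall>\<sigma>\<in>Gal. \<forall>\<tau>\<in>Gal. (\<forall>s\<in>S. \<sigma> s = \<tau> s) \<longrightarrow> \<eta> \<sigma> = \<eta> \<tau>))"


section \<open>Curves\<close>

text \<open>
  A curve over \<open>k\<close> is smooth, projective and geometrically integral. It is represented by its
  function field, through the anti-equivalence of categories between such curves (with
  nonconstant morphisms) and their function fields. Write \<open>kbar\<close> for the algebraic closure of
  \<open>k\<close>. The type \<open>'f\<close> is the field \<open>kbar(C)\<close>, the map \<open>emb C\<close> embeds \<open>kbar\<close> in it as the
  constants, and \<open>kfun C\<close> is the subfield \<open>k(C)\<close>.
\<close>

record (overloaded) ('k::field, 'f) curve =
  emb :: "'k alg_closure \<Rightarrow> 'f"
  kfun :: "'f set"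

definition emb_k :: "('k::field, 'f::field) curve \<Rightarrow> 'k \<Rightarrow> 'f" where
  "emb_k C c = emb C (to_ac c)"

text \<open>\<open>k(C)\<close> is finitely generated over \<open>k\<close> of transcendence degree one.\<close>

definition function_field_1 :: "('k::field, 'f::field) curve \<Rightarrow> bool" where
  "function_field_1 C \<longleftrightarrow>
     (\<exists>x\<in>kfun C.
        (\<forall>p. poly (map_poly (emb_k C) p) x = 0 \<longrightarrow> p = 0) \<and>
        (\<exists>B\<subseteq>kfun C. finite B \<and>
           (\<forall>z\<in>kfun C. \<exists>c. (\<forall>b\<in>B. c b \<in> field_adjoin (range (emb_k C)) {x}) \<and>
              z = (\<Sum>b\<in>B. c b * b))))"

text \<open>The last two conditions say that the multiplication map from \<open>k(C) \<otimes>\<^sub>k kbar\<close> to \<open>kbar(C)\<close>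
  is bijective, that is, the curve is geometrically integral and \<open>'f\<close> is the function field
  of its base change to \<open>kbar\<close>.\<close>

definition is_curve :: "('k::field, 'f::field) curve \<Rightarrow> bool" where
  "is_curve C \<longleftrightarrow>
     is_field_hom (emb C) \<and> is_subfield (kfun C) \<and> range (emb_k C) \<subseteq> kfun C \<and>
     function_field_1 C \<and>
     (\<forall>S\<subseteq>kfun C. \<not> module.dependent (\<lambda>c f. emb_k C c * f) S \<longrightarrow>
                  \<not> module.dependent (\<lambda>a f. emb C a * f) S) \<and>
     module.span (\<lambda>a f. emb C a * f) (kfun C) = UNIV"


subsection \<open>Genus\<close>

text \<open>The genus is the dimension over \<open>kbar\<close> of the space of regular differentials on the base
  change of the curve to \<open>kbar\<close>. Differentials of \<open>kbar(C)\<close> over \<open>kbar\<close> form a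
  one-dimensional \<open>kbar(C)\<close>-vector space, which is identified with the dual of the space of
  derivations; \<open>df\<close> is then evaluation at \<open>f\<close>.\<close>

definition derivations :: "('k::field, 'f::field) curve \<Rightarrow> ('f \<Rightarrow> 'f) set" where
  "derivations C = {D. (\<forall>f g. D (f + g) = D f + D g) \<and>
                       (\<forall>f g. D (f * g) = D f * g + f * D g) \<and> (\<forall>a. D (emb C a) = 0)}"

definition differentials :: "('k::field, 'f::field) curve \<Rightarrow> (('f \<Rightarrow> 'f) \<Rightarrow> 'f) set" where
  "differentials C = {\<omega>.
     (\<forall>D\<in>derivations C. \<forall>E\<in>derivations C. \<omega> (\<lambda>f. D f + E f) = \<omega> D + \<omega> E) \<and>
     (\<forall>h. \<forall>D\<in>derivations C. \<omega> (\<lambda>f. h * D f) = h * \<omega> D) \<and>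
     (\<forall>D. D \<notin> derivations C \<longrightarrow> \<omega> D = 0)}"

definition exterior_d :: "('k::field, 'f::field) curve \<Rightarrow> 'f \<Rightarrow> ('f \<Rightarrow> 'f) \<Rightarrow> 'f" where
  "exterior_d C f = (\<lambda>D. if D \<in> derivations C then D f else 0)"

text \<open>The closed points of the base change of \<open>C\<close> to \<open>kbar\<close>, given by their local rings: the
  nontrivial valuation rings of \<open>kbar(C)\<close> containing \<open>kbar\<close>.\<close>

definition places :: "('k::field, 'f::field) curve \<Rightarrow> 'f set set" where
  "places C = {R. range (emb C) \<subseteq> R \<and> (\<forall>f\<in>R. \<forall>g\<in>R. f - g \<in> R \<and> f * g \<in> R) \<and>
                  R \<noteq> UNIV \<and> (\<forall>f. f \<in> R \<or> inverse f \<in> R)}"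

definition max_ideal :: "'f::field set \<Rightarrow> 'f set" where
  "max_ideal R = {f\<in>R. f = 0 \<or> inverse f \<notin> R}"

definition uniformizer :: "'f::field set \<Rightarrow> 'f \<Rightarrow> bool" where
  "uniformizer R t \<longleftrightarrow> max_ideal R = (\<lambda>g. t * g) ` R"

definition regular_differentials ::
    "('k::field, 'f::field) curve \<Rightarrow> (('f \<Rightarrow> 'f) \<Rightarrow> 'f) set" where
  "regular_differentials C = {\<omega>\<in>differentials C.
     \<forall>R\<in>places C. \<exists>t g. uniformizer R t \<and> g \<in> R \<and> \<omega> = (\<lambda>D. g * exterior_d C t D)}"

definition genus :: "('k::field, 'f::field) curve \<Rightarrow> nat" where
  "genus C = vector_space.dim (\<lambda>a \<omega> D. emb C a * \<omega> D) (regular_differentials C)"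


subsection \<open>Isomorphisms over the algebraic closure and the Galois action\<close>

text \<open>
  A \<open>kbar\<close>-isomorphism from \<open>C\<close> to \<open>C'\<close> is represented by its comorphism, a \<open>kbar\<close>-linear field
  isomorphism from \<open>kbar(C')\<close> to \<open>kbar(C)\<close>. Hence composition is reversed: the comorphism of
  \<open>\<phi> \<circ> \<psi>\<close> is the comorphism of \<open>\<psi>\<close> after that of \<open>\<phi>\<close>.
\<close>

definition isoms ::
    "('k::field, 'f::field) curve \<Rightarrow> ('k, 'g::field) curve \<Rightarrow> ('g \<Rightarrow> 'f) set" where
  "isoms C C' = {\<phi>. is_field_hom \<phi> \<and> bij \<phi> \<and> (\<forall>a. \<phi> (emb C' a) = emb C a)}"

definition mor_comp :: "('a \<Rightarrow> 'b) \<Rightarrow> ('b \<Rightarrow> 'c) \<Rightarrow> 'a \<Rightarrow> 'c" where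
  "mor_comp \<phi> \<psi> = \<psi> \<circ> \<phi>"

definition Aut :: "('k::field, 'f::field) curve \<Rightarrow> ('f \<Rightarrow> 'f) monoid" where
  "Aut C = \<lparr>carrier = isoms C C, monoid.mult = mor_comp, one = id\<rparr>"

text \<open>A \<open>kbar\<close>-isomorphism is defined over \<open>k\<close> iff its comorphism maps \<open>k(C')\<close> onto \<open>k(C)\<close>.\<close>

definition k_isomorphic ::
    "('k::field, 'f::field) curve \<Rightarrow> ('k, 'g::field) curve \<Rightarrow> bool" where
  "k_isomorphic C C' \<longleftrightarrow> (\<exists>\<phi>\<in>isoms C C'. \<phi> ` kfun C' = kfun C)"

text \<open>\<open>\<sigma>\<close> acts on \<open>kbar(C) = k(C) \<otimes>\<^sub>k kbar\<close> through the second factor.\<close>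

definition gal_fun :: "('k::field, 'f::field) curve \<Rightarrow> ('k alg_closure \<Rightarrow> 'k alg_closure)
    \<Rightarrow> 'f \<Rightarrow> 'f" where
  "gal_fun C \<sigma> = (THE s. is_field_hom s \<and> bij s \<and> (\<forall>a. s (emb C a) = emb C (\<sigma> a)) \<and>
                         (\<forall>f\<in>kfun C. s f = f))"

text \<open>The conjugate of \<open>\<phi>\<close> by \<open>\<sigma>\<close>, for \<open>\<phi>\<close> an isomorphism from \<open>C\<close> to \<open>C'\<close>.\<close>

definition gal_mor ::
    "('k::field, 'f::field) curve \<Rightarrow> ('k, 'g::field) curve \<Rightarrow>
     ('k alg_closure \<Rightarrow> 'k alg_closure) \<Rightarrow> ('g \<Rightarrow> 'f) \<Rightarrow> 'g \<Rightarrow> 'f" where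
  "gal_mor C C' \<sigma> \<phi> = gal_fun C \<sigma> \<circ> \<phi> \<circ> inv_into UNIV (gal_fun C' \<sigma>)"

abbreviation gal_aut ::
    "('k::field, 'f::field) curve \<Rightarrow> ('k alg_closure \<Rightarrow> 'k alg_closure) \<Rightarrow> ('f \<Rightarrow> 'f) \<Rightarrow> 'f \<Rightarrow> 'f"
  where "gal_aut C \<equiv> gal_mor C C"

text \<open>The involution whose quotient has genus zero, that is, whose fixed field is the rational
  function field \<open>kbar(x)\<close> (\<open>x\<close> is transcendental as soon as it is not constant).\<close>

definition hyperelliptic_involution ::
    "('k::field, 'f::field) curve \<Rightarrow> ('f \<Rightarrow> 'f) \<Rightarrow> bool" where
  "hyperelliptic_involution C \<iota> \<longleftrightarrow>
     \<iota> \<in> carrier (Aut C) \<and> \<iota> \<noteq> \<one>\<^bsub>Aut C\<^esub> \<and> \<iota> \<otimes>\<^bsub>Aut C\<^esub> \<iota> = \<one>\<^bsub>Aut C\<^esub> \<and>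
     (\<exists>x. x \<notin> range (emb C) \<and> {f. \<iota> f = f} = field_adjoin (range (emb C)) {x})"


section \<open>Groups with Galois action\<close>

definition Gk_isomorphic ::
    "('a, 'm) monoid_scheme \<Rightarrow> (('k::field alg_closure \<Rightarrow> 'k alg_closure) \<Rightarrow> 'a \<Rightarrow> 'a) \<Rightarrow>
     ('b, 'n) monoid_scheme \<Rightarrow> (('k alg_closure \<Rightarrow> 'k alg_closure) \<Rightarrow> 'b \<Rightarrow> 'b) \<Rightarrow> bool" where
  "Gk_isomorphic A \<alpha> B \<beta> \<longleftrightarrow>
     (\<exists>f\<in>iso A B. \<forall>\<sigma>\<in>Gal. \<forall>a\<in>carrier A. f (\<alpha> \<sigma> a) = \<beta> \<sigma> (f a))"

text \<open>The fixed field of the kernel of the action \<open>\<alpha>\<close> on the set \<open>S\<close>.\<close>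

definition field_of_definition ::
    "(('k::field alg_closure \<Rightarrow> 'k alg_closure) \<Rightarrow> 'a \<Rightarrow> 'a) \<Rightarrow> 'a set \<Rightarrow> 'k alg_closure set" where
  "field_of_definition \<alpha> S = {c. \<forall>\<sigma>\<in>Gal. (\<forall>a\<in>S. \<alpha> \<sigma> a = a) \<longrightarrow> \<sigma> c = c}"

text \<open>The dihedral group of order 8; \<open>(i, j)\<close> stands for \<open>U\<^sup>i V\<^sup>j\<close> with \<open>U\<^sup>2 = V\<^sup>4 = 1\<close> and
  \<open>V U = U V\<^sup>3\<close>.\<close>

definition D8 :: "(nat \<times> nat) monoid" where
  "D8 = \<lparr>carrier = {..<2} \<times> {..<4},
         monoid.mult = (\<lambda>(i, j) (i', j'). ((i + i') mod 2, (3 ^ i' * j + j') mod 4)),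
         one = (0, 0)\<rparr>"

text \<open>For a group of order 8, generators satisfying the relations
  \<open>U\<^sup>2 = V\<^sup>4 = 1\<close>, \<open>V U = U V\<^sup>3\<close> give a presentation.\<close>

definition D8_presentation :: "('a, 'm) monoid_scheme \<Rightarrow> 'a \<Rightarrow> 'a \<Rightarrow> bool" where
  "D8_presentation A U V \<longleftrightarrow>
     card (carrier A) = 8 \<and> U \<in> carrier A \<and> V \<in> carrier A \<and> generate A {U, V} = carrier A \<and>
     U [^]\<^bsub>A\<^esub> (2::nat) = \<one>\<^bsub>A\<^esub> \<and> V [^]\<^bsub>A\<^esub> (4::nat) = \<one>\<^bsub>A\<^esub> \<and>
     V \<otimes>\<^bsub>A\<^esub> U = U \<otimes>\<^bsub>A\<^esub> V [^]\<^bsub>A\<^esub> (3::nat)"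


section \<open>Cocycles and twists\<close>

definition cocycle :: "('k::field, 'f::field) curve \<Rightarrow>
    (('k alg_closure \<Rightarrow> 'k alg_closure) \<Rightarrow> 'f \<Rightarrow> 'f) \<Rightarrow> bool" where
  "cocycle C \<eta> \<longleftrightarrow>
     (\<forall>\<sigma>\<in>Gal. \<eta> \<sigma> \<in> carrier (Aut C)) \<and>
     (\<forall>\<sigma>\<in>Gal. \<forall>\<tau>\<in>Gal. \<eta> (\<sigma> \<circ> \<tau>) = \<eta> \<sigma> \<otimes>\<^bsub>Aut C\<^esub> gal_aut C \<sigma> (\<eta> \<tau>)) \<and>
     krull_continuous \<eta>"

text \<open>\<open>(C', \<phi>)\<close> is the twist of \<open>C\<close> by \<open>\<eta>\<close>, with \<open>\<phi>\<close> from \<open>C'\<close> to \<open>C\<close>. The equation says that the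
  conjugate of \<open>\<phi>\<close> by \<open>\<sigma>\<close>, composed with the inverse of \<open>\<phi>\<close>, is \<open>\<eta> \<sigma>\<close>.\<close>

definition is_twist :: "('k::field, 'f::field) curve \<Rightarrow>
    (('k alg_closure \<Rightarrow> 'k alg_closure) \<Rightarrow> 'f \<Rightarrow> 'f) \<Rightarrow>
    ('k, 'g::field) curve \<Rightarrow> ('f \<Rightarrow> 'g) \<Rightarrow> bool" where
  "is_twist C \<eta> C' \<phi> \<longleftrightarrow>
     cocycle C \<eta> \<and> is_curve C' \<and> \<phi> \<in> isoms C' C \<and>
     (\<forall>\<sigma>\<in>Gal. mor_comp (gal_mor C' C \<sigma> \<phi>) (inv_into UNIV \<phi>) = \<eta> \<sigma>)"

end

theory Submission
  imports Defs
begin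

text \<open>
  Choose an isomorphism \<open>\<psi>\<close> from \<open>C2\<close> to \<open>C1\<close>. Transporting the given isomorphism of \<open>G\<^sub>k\<close>-groups
  by \<open>\<psi>\<close> yields an automorphism \<open>h\<close> of the dihedral group \<open>Aut C1\<close>. Changing \<open>\<psi>\<close> by an
  automorphism of \<open>C1\<close> changes \<open>h\<close> by an inner automorphism, so one may assume that \<open>h\<close> fixes \<open>V\<close>
  and that \<open>h U\<close> is \<open>U\<close> or \<open>U V\<close>. The twisting map \<open>c\<close> of \<open>\<psi>\<close> measures the failure of \<open>h\<close> to be
  equivariant: if \<open>h = 1\<close> then \<open>c\<^sub>\<sigma>\<close> is central, and otherwise \<open>c\<^sub>\<sigma>\<close> is central or of order four
  according to whether \<open>\<sigma>\<close> fixes \<open>V\<close> or not, which is the same as fixing \<open>sqrt_v\<close> or not. So \<open>c\<close> is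
  \<open>\<xi>\<close> or \<open>\<xi> \<Xi>\<close> for a map \<open>\<xi>\<close> into the centre.

  It remains to see that the centre \<open>{1, V\<^sup>2}\<close> is \<open>{1, \<iota>}\<close>. If \<open>\<iota>\<close> were not central, take \<open>x\<close> with
  fixed field of \<open>\<iota>\<close> equal to \<open>kbar(x)\<close> and \<open>V\<^sup>2 x = - x\<close>, and put \<open>x' = V x\<close>. Both \<open>x\<^sup>2\<close> and \<open>x'\<^sup>2\<close>
  generate the fixed field of \<open>\<iota>\<close> and \<open>V\<^sup>2\<close>, and \<open>V\<close> exchanges them, so they are related by a Moebius
  involution. This is an Edwards curve \<open>c x\<^sup>2 x'\<^sup>2 = x\<^sup>2 + x'\<^sup>2 + b\<close>, whose genus is at most one.
\<close>

section \<open>Subfields and embedded constants\<close>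

text \<open>Genus 2 enters through the centrality of \<open>\<iota>\<close>, and it has to be
  contradicted from the definition of \<open>genus\<close> by regular differentials. On the Edwards
  curve put y = x' (c x^2 - 1), so that y^2 = (x^2 + b) (c x^2 - 1), and let D be the derivation
  with D x = y. In each smooth affine chart D preserves the coordinate ring and hence every local
  ring. A regular differential evaluated at D thus lies in all valuation rings of
  \<open>kbar(C)\<close> over \<open>kbar\<close>, and Zorn's lemma shows that only constants do. So
  every regular differential is a constant multiple of dx / y.

  The two possible twists mirror the outer automorphism group of the dihedral group, which has order
  two. If h U = U V^d, if the Galois element sends V to V^j, and if its twisting value is V^k, then
  equivariance reads 2 k = d (j - 1) modulo 4. So k is odd exactly for d = 1 and j = 3, and
  \<open>\<Xi>\<close> takes the value V exactly for j = 3.\<close>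

lemma subfield_one: "is_subfield F \<Longrightarrow> 1 \<in> F"
  and subfield_diff: "is_subfield F \<Longrightarrow> x \<in> F \<Longrightarrow> y \<in> F \<Longrightarrow> x - y \<in> F"
  and subfield_mult: "is_subfield F \<Longrightarrow> x \<in> F \<Longrightarrow> y \<in> F \<Longrightarrow> x * y \<in> F"
  and subfield_inverse: "is_subfield F \<Longrightarrow> x \<in> F \<Longrightarrow> inverse x \<in> F"
  by (auto simp: is_subfield_def)

lemma subfield_zero: "is_subfield F \<Longrightarrow> 0 \<in> F"
  using subfield_diff[of F 1 1] subfield_one by force

lemma subfield_uminus: "is_subfield F \<Longrightarrow> x \<in> F \<Longrightarrow> - x \<in> F"
  using subfield_diff[of F 0 x] subfield_zero by force

lemma subfield_add: "is_subfield F \<Longrightarrow> x \<in> F \<Longrightarrow> y \<in> F \<Longrightarrow> x + y \<in> F"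
  using subfield_diff[of F x "- y"] subfield_uminus by force

lemma subfield_divide: "is_subfield F \<Longrightarrow> x \<in> F \<Longrightarrow> y \<in> F \<Longrightarrow> x / y \<in> F"
  by (simp add: divide_inverse subfield_mult subfield_inverse)

lemma subfield_power: "is_subfield F \<Longrightarrow> x \<in> F \<Longrightarrow> x ^ n \<in> F"
  by (induction n) (auto intro: subfield_one subfield_mult)

lemmas subfield_intros = subfield_one subfield_zero subfield_diff subfield_mult subfield_inverse
  subfield_uminus subfield_add subfield_divide subfield_power

lemma subfield_field_adjoin: "is_subfield (field_adjoin K S)"
  unfolding field_adjoin_def is_subfield_def by blast

lemma field_adjoin_contains: "K \<subseteq> field_adjoin K S" "S \<subseteq> field_adjoin K S"
  unfolding field_adjoin_def by blast+

lemma field_adjoin_minimal: "is_subfield F \<Longrightarrow> K \<subseteq> F \<Longrightarrow> S \<subseteq> F \<Longrightarrow> field_adjoin K S \<subseteq> F"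
  unfolding field_adjoin_def by blast

context
  fixes h :: "'a::field \<Rightarrow> 'b::field"
  assumes h: "is_field_hom h"
begin

lemma field_hom_one: "h 1 = 1"
  and field_hom_add: "h (x + y) = h x + h y"
  and field_hom_mult: "h (x * y) = h x * h y"
  using h by (auto simp: is_field_hom_def)

lemma field_hom_zero: "h 0 = 0"
  by (metis add_cancel_right_right add_0 field_hom_add)

lemma field_hom_uminus: "h (- x) = - h x"
  using field_hom_add[of x "- x"] field_hom_zero by (simp add: eq_neg_iff_add_eq_0 add.commute)

lemma field_hom_diff: "h (x - y) = h x - h y"
  using field_hom_add[of x "- y"] field_hom_uminus by simp

lemma field_hom_eq_0_iff: "h x = 0 \<longleftrightarrow> x = 0"
  using field_hom_mult[of x "inverse x"] field_hom_one field_hom_zero by (cases "x = 0") auto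

lemma field_hom_eq_iff: "h x = h y \<longleftrightarrow> x = y"
  using field_hom_eq_0_iff[of "x - y"] by (simp add: field_hom_diff)

lemma field_hom_inverse: "h (inverse x) = inverse (h x)"
proof (cases "x = 0")
  case False
  then have "h x * h (inverse x) = 1" by (simp flip: field_hom_mult add: field_hom_one)
  then show ?thesis by (simp add: inverse_unique)
qed (simp add: field_hom_zero)

lemma field_hom_divide: "h (x / y) = h x / h y"
  by (simp add: divide_inverse field_hom_mult field_hom_inverse)

lemma field_hom_power: "h (x ^ n) = h x ^ n"
  by (induction n) (auto simp: field_hom_one field_hom_mult)

lemma field_hom_two: "h 2 = 2"
  using field_hom_add[of 1 1] by (simp add: field_hom_one)

lemmas field_hom_simps = field_hom_one field_hom_zero field_hom_add field_hom_mult
  field_hom_uminus field_hom_diff field_hom_eq_0_iff field_hom_eq_iff field_hom_inverse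
  field_hom_divide field_hom_power field_hom_two

lemma subfield_range: "is_subfield (range h)"
  unfolding is_subfield_def
  by (auto simp flip: field_hom_simps)

end

lemma field_hom_comp: "is_field_hom g \<Longrightarrow> is_field_hom h \<Longrightarrow> is_field_hom (g \<circ> h)"
  by (simp add: is_field_hom_def)

lemma field_hom_id: "is_field_hom id"
  by (simp add: is_field_hom_def)

lemma field_hom_inv:
  assumes "is_field_hom h" "bij h"
  shows "is_field_hom (inv_into UNIV h)"
proof -
  have hi: "h (inv_into UNIV h x) = x" and ih: "inv_into UNIV h (h y) = y" for x y
    using assms(2) by (auto simp: bij_is_surj surj_f_inv_f bij_is_inj)
  show ?thesis
    unfolding is_field_hom_def
  proof (intro conjI allI)
    show "inv_into UNIV h 1 = 1" using ih[of 1] by (simp add: field_hom_one[OF assms(1)])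
    show "inv_into UNIV h (x + y) = inv_into UNIV h x + inv_into UNIV h y" for x y
      using ih[of "inv_into UNIV h x + inv_into UNIV h y"] by (simp add: field_hom_add[OF assms(1)] hi)
    show "inv_into UNIV h (x * y) = inv_into UNIV h x * inv_into UNIV h y" for x y
      using ih[of "inv_into UNIV h x * inv_into UNIV h y"] by (simp add: field_hom_mult[OF assms(1)] hi)
  qed
qed

section \<open>Polynomials and rational functions over an algebraically closed field of
  constants\<close>

locale const_field =
  fixes e :: "'k::field alg_closure \<Rightarrow> 'f::field"
  assumes hom: "is_field_hom e"
begin

lemmas e_simps = field_hom_simps[OF hom]

declare e_simps [simp]

definition ev :: "'k alg_closure poly \<Rightarrow> 'f \<Rightarrow> 'f" where
  "ev p x = poly (map_poly e p) x"

lemma ev_0 [simp]: "ev 0 x = 0"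
  by (simp add: ev_def)

lemma ev_pCons [simp]: "ev (pCons a p) x = e a + x * ev p x"
  by (simp add: ev_def map_poly_pCons)

lemma ev_1 [simp]: "ev 1 x = 1"
  by (simp add: one_pCons)

lemma ev_add [simp]: "ev (p + q) x = ev p x + ev q x"
  by (induction p q rule: poly_induct2) (auto simp: algebra_simps)

lemma ev_smult [simp]: "ev (smult a p) x = e a * ev p x"
  by (induction p) (auto simp: algebra_simps)

lemma ev_mult [simp]: "ev (p * q) x = ev p x * ev q x"
  by (induction p) (auto simp: algebra_simps)

lemma ev_uminus [simp]: "ev (- p) x = - ev p x"
  using ev_smult[of "-1" p x] by simp

lemma ev_diff [simp]: "ev (p - q) x = ev p x - ev q x"
  using ev_add[of p "- q" x] by simp

lemma ev_power [simp]: "ev (p ^ n) x = ev p x ^ n"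
  by (induction n) auto

text \<open>Linear factors split off one at a time because \<open>kbar\<close> is algebraically
  closed. Hence an element outside \<open>range e\<close> is transcendental, and polynomial
  identities can be read off from their values at it.\<close>

lemma root_in_constants:
  assumes "p \<noteq> 0" "ev p x = 0"
  shows "x \<in> range e"
  using assms
proof (induction "degree p" arbitrary: p rule: less_induct)
  case less
  show ?case
  proof (cases "degree p = 0")
    case True
    then obtain a where "p = [:a:]" by (metis degree_eq_zeroE)
    with less.prems show ?thesis by simp
  next
    case False
    then obtain a where "poly p a = 0"
      using alg_closed_imp_poly_has_root by blast
    then obtain q where q: "p = [:-a, 1:] * q"
      using poly_eq_0_iff_dvd by blast
    with less.prems have "x = e a \<or> ev q x = 0" by auto
    moreover have "q \<noteq> 0" using q less.prems by auto
    moreover have "degree q < degree p"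
      using q \<open>q \<noteq> 0\<close> by (subst q, subst degree_mult_eq) auto
    ultimately show ?thesis using less.hyps by blast
  qed
qed

lemma ev_eq_0_iff: "x \<notin> range e \<Longrightarrow> ev p x = 0 \<longleftrightarrow> p = 0"
  using root_in_constants by auto

abbreviation ratfun :: "'f \<Rightarrow> 'f set" where
  "ratfun x \<equiv> field_adjoin (range e) {x}"

lemma const_in_ratfun [simp]: "e a \<in> ratfun x"
  using field_adjoin_contains(1)[of "range e" "{x}"] by auto

lemma gen_in_ratfun [simp]: "x \<in> ratfun x"
  using field_adjoin_contains(2)[of "{x}" "range e"] by auto

lemma ev_in_subfield:
  "is_subfield F \<Longrightarrow> range e \<subseteq> F \<Longrightarrow> x \<in> F \<Longrightarrow> ev p x \<in> F"
  by (induction p) (auto intro!: subfield_intros)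

lemma ratfun_quotient:
  assumes "z \<in> ratfun x"
  obtains p q where "ev q x \<noteq> 0" "z = ev p x / ev q x"
proof -
  define F where "F = {ev p x / ev q x | p q. ev q x \<noteq> 0}"
  have "is_subfield F"
    unfolding is_subfield_def
  proof (intro conjI ballI)
    show "1 \<in> F" unfolding F_def by (auto intro!: exI[of _ 1])
    fix y z assume "y \<in> F" "z \<in> F"
    then obtain p q r s where y: "y = ev p x / ev q x" "ev q x \<noteq> 0"
      and z: "z = ev r x / ev s x" "ev s x \<noteq> 0" unfolding F_def by blast
    have "y - z = ev (p * s - r * q) x / ev (q * s) x" "ev (q * s) x \<noteq> 0"
      "y * z = ev (p * r) x / ev (q * s) x"
      using y(2) z(2) unfolding y(1) z(1) by (auto simp: field_simps)
    then show "y - z \<in> F" "y * z \<in> F" unfolding F_def by blast+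
    show "inverse y \<in> F"
    proof (cases "ev p x = 0")
      case True
      then have "inverse y = ev 0 x / ev 1 x" "ev 1 x \<noteq> 0" using y by auto
      then show ?thesis unfolding F_def by blast
    next
      case False
      then have "inverse y = ev q x / ev p x" using y by auto
      then show ?thesis using False unfolding F_def by blast
    qed
  qed
  moreover have "e a = ev [:a:] x / ev 1 x" "ev 1 x \<noteq> 0" for a by auto
  then have "range e \<subseteq> F" unfolding F_def by blast
  moreover have "x = ev [:0, 1:] x / ev 1 x" by auto
  then have "x \<in> F" unfolding F_def by (metis (mono_tags, lifting) ev_1 mem_Collect_eq one_neq_zero)
  ultimately have "ratfun x \<subseteq> F" by (simp add: field_adjoin_minimal)
  then show thesis using assms that unfolding F_def by blast
qed

lemma ratfun_subset:
  "y \<in> ratfun x \<Longrightarrow> ratfun y \<subseteq> ratfun x"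
  by (rule field_adjoin_minimal[OF subfield_field_adjoin field_adjoin_contains(1)]) simp

section \<open>Places\<close>

definition place :: "'f set \<Rightarrow> bool" where
  "place R \<longleftrightarrow> range e \<subseteq> R \<and> (\<forall>f\<in>R. \<forall>g\<in>R. f - g \<in> R \<and> f * g \<in> R) \<and>
     R \<noteq> UNIV \<and> (\<forall>f. f \<in> R \<or> inverse f \<in> R)"

definition const_subring :: "'f set \<Rightarrow> bool" where
  "const_subring A \<longleftrightarrow> range e \<subseteq> A \<and> (\<forall>f\<in>A. \<forall>g\<in>A. f - g \<in> A \<and> f * g \<in> A)"

lemma subring_const [simp]: "const_subring A \<Longrightarrow> e a \<in> A"
  and subring_diff: "const_subring A \<Longrightarrow> x \<in> A \<Longrightarrow> y \<in> A \<Longrightarrow> x - y \<in> A"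
  and subring_mult: "const_subring A \<Longrightarrow> x \<in> A \<Longrightarrow> y \<in> A \<Longrightarrow> x * y \<in> A"
  by (auto simp: const_subring_def)

lemma subring_zero [simp]: "const_subring A \<Longrightarrow> 0 \<in> A" and subring_one [simp]: "const_subring A \<Longrightarrow> 1 \<in> A"
  using subring_const[of A 0] subring_const[of A 1] by (simp_all del: subring_const)

lemma subring_uminus: "const_subring A \<Longrightarrow> x \<in> A \<Longrightarrow> - x \<in> A"
  using subring_diff[of A 0 x] by simp

lemma subring_add: "const_subring A \<Longrightarrow> x \<in> A \<Longrightarrow> y \<in> A \<Longrightarrow> x + y \<in> A"
  using subring_diff[of A x "- y"] subring_uminus by simp

lemma subring_power: "const_subring A \<Longrightarrow> x \<in> A \<Longrightarrow> x ^ n \<in> A"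
  by (induction n) (auto intro: subring_mult)

lemma subring_ev: "const_subring A \<Longrightarrow> x \<in> A \<Longrightarrow> ev p x \<in> A"
  by (induction p) (auto intro!: subring_add subring_mult)

lemmas subring_intros = subring_const subring_zero subring_one subring_diff subring_mult
  subring_uminus subring_add subring_power subring_ev

text \<open>The key step in the existence of valuation rings: if \<open>g\<close> is polynomial over \<open>A \<ni> 1 / g\<close>
  both in \<open>f\<close> and in \<open>1 / f\<close>, then the larger of the two degrees can be lowered.\<close>

definition poly_values :: "'f set \<Rightarrow> 'f \<Rightarrow> nat \<Rightarrow> 'f set" where
  "poly_values A f n = {poly p f | p. degree p \<le> n \<and> (\<forall>i. coeff p i \<in> A)}"

lemma poly_values_lower:
  assumes A: "const_subring A" "inverse g \<in> A" and f: "f \<noteq> 0" "g \<noteq> 0"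
    and g: "g \<in> poly_values A f n" "g \<in> poly_values A (inverse f) m" and mn: "m \<le> n" "0 < n"
  shows "g \<in> poly_values A f (n - 1)"
proof -
  from g obtain p q where p: "g = poly p f" "degree p \<le> n" "\<And>i. coeff p i \<in> A"
    and q: "g = poly q (inverse f)" "degree q \<le> m" "\<And>i. coeff q i \<in> A"
    unfolding poly_values_def by blast
  define u where "u = inverse g"
  define a where "a = coeff p n"
  define b where "b = coeff q 0"
  define p' where "p' = p - monom a n"
  have p': "poly p f = poly p' f + a * f ^ n" by (simp add: p'_def poly_monom)
  have dp': "degree p' \<le> n - 1"
  proof (rule degree_le, intro allI impI)
    fix i assume "n - 1 < i"
    then have "i = n \<or> degree p < i" using p(2) mn by linarith
    then show "coeff p' i = 0" by (auto simp: p'_def a_def coeff_eq_0)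
  qed
  \<comment> \<open>This will be (g - b) f^n: as m \<le> n, multiplying by f^n turns every term of
    q(1/f) except the constant one into a power of f below the n-th.\<close>
  define r where "r = (\<Sum>j\<in>{1..m}. monom (coeff q j) (n - j))"
  have dr: "degree r \<le> n - 1"
    unfolding r_def
    by (rule degree_sum_le) (auto intro!: order.trans[OF degree_monom_le])
  have "poly q (inverse f) = (\<Sum>j\<le>m. coeff q j * inverse f ^ j)"
    unfolding poly_altdef using q(2) by (intro sum.mono_neutral_left) (auto simp: coeff_eq_0)
  also have "{..m} = insert 0 {1..m}" by auto
  finally have "g = b + (\<Sum>j\<in>{1..m}. coeff q j * inverse f ^ j)" by (simp add: q b_def)
  then have "(g - b) * f ^ n = (\<Sum>j\<in>{1..m}. coeff q j * (inverse f ^ j * f ^ n))"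
    by (simp add: sum_distrib_right mult.assoc)
  also have "\<dots> = (\<Sum>j\<in>{1..m}. coeff q j * f ^ (n - j))"
    using f mn by (intro sum.cong) (auto simp: power_diff power_inverse field_simps)
  finally have r: "(g - b) * f ^ n = poly r f" by (simp add: r_def poly_sum poly_monom)
  \<comment> \<open>Since u g = 1, one has g = b + (1 - u b) g. When the last g is expanded by p,
    the leading term a f^n is multiplied by 1 - u b = u (g - b) and becomes u a r(f), of degree
    below n.\<close>
  define h where "h = [:b:] + smult (1 - u * b) p' + smult (u * a) r"
  have ug: "u * g = 1" using f by (simp add: u_def)
  have "poly h f = b + (1 - u * b) * poly p' f + u * a * ((g - b) * f ^ n)"
    by (simp add: h_def r)
  also have "\<dots> = b + (1 - u * b) * (poly p' f + a * f ^ n) + (u * g - 1) * a * f ^ n"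
    by (simp add: algebra_simps)
  also have "\<dots> = b + (1 - u * b) * g" using ug p(1) p' by simp
  also have "\<dots> = b + g - u * g * b" by (simp add: algebra_simps)
  also have "\<dots> = g" using ug by simp
  finally have "g = poly h f" by simp
  moreover have "degree h \<le> n - 1"
    unfolding h_def using dp' dr
    by (intro degree_add_le) (auto intro: order.trans[OF degree_smult_le])
  moreover have "coeff h i \<in> A" for i
  proof -
    have 1: "u \<in> A" "a \<in> A" "b \<in> A" using A p q by (auto simp: u_def a_def b_def)
    have 2: "coeff p' i \<in> A" unfolding p'_def using A(1) p 1 by (auto intro!: subring_intros)
    have "(if n - j = i then coeff q j else 0) \<in> A" for j
      using q(3) A(1) by auto
    then have "(\<Sum>j\<in>J. if n - j = i then coeff q j else 0) \<in> A" for J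
      using A(1) by (induction J rule: infinite_finite_induct)
        (simp_all add: subring_add del: if_split)
    then have 3: "coeff r i \<in> A" by (simp add: r_def coeff_sum)
    show ?thesis unfolding h_def using A(1) 1 2 3
      by (cases i) (auto intro!: subring_intros)
  qed
  ultimately show ?thesis unfolding poly_values_def by blast
qed

text \<open>Descent on n + m: the larger degree can always be lowered, but a value of degree 0 is an
  element of \<open>A\<close>, whereas \<open>g\<close> is not.\<close>

lemma poly_values_exclusive:
  assumes A: "const_subring A" "inverse g \<in> A" "g \<notin> A" and f: "f \<noteq> 0"
    and "g \<in> poly_values A f n" "g \<in> poly_values A (inverse f) m"
  shows False
  using assms(4-)
proof (induction "n + m" arbitrary: n m f rule: less_induct)
  case less
  have g0: "g \<noteq> 0" using A by auto
  have const: "n \<noteq> 0" if "g \<in> poly_values A f' n" for f' n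
  proof
    assume "n = 0"
    with that obtain p where "g = poly p f'" "degree p = 0" "coeff p 0 \<in> A"
      unfolding poly_values_def by auto
    then show False using A(3) by (auto elim!: degree_eq_zeroE)
  qed
  show ?case
  proof (cases "m \<le> n")
    case True
    then have "g \<in> poly_values A f (n - 1)"
      using less.prems A g0 const by (intro poly_values_lower[where m = m]) auto
    then show False using less.hyps[of "n - 1" m f] less.prems const[of f n] by force
  next
    case False
    then have "g \<in> poly_values A (inverse f) (m - 1)"
      using less.prems A g0 by (intro poly_values_lower[where m = n]) auto
    then show False using less.hyps[of n "m - 1" f] less.prems const[of "inverse f" m] by force
  qed
qed

text \<open>By Zorn there is a maximal \<open>R\<close> among the subrings that contain
  \<open>kbar\<close> and 1/g but not g. If f is outside \<open>R\<close>, then R[f] contains g by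
  maximality; so if neither f nor 1/f were in \<open>R\<close>, then g would be a polynomial over
  \<open>R\<close> in both.\<close>

lemma place_avoiding:
  assumes "g \<notin> range e"
  obtains R where "place R" "g \<notin> R"
proof -
  have g0: "g \<noteq> 0" using assms by (metis e_simps(2) rangeI)
  define \<A> where "\<A> = {A. const_subring A \<and> inverse g \<in> A \<and> g \<notin> A}"
  \<comment> \<open>The starting ring is kbar[1/g]. It omits g, since g = p(1/g) makes 1/g a root of
    1 - X p(X), a polynomial with constant term 1, and so a constant.\<close>
  have "range (\<lambda>p. ev p (inverse g)) \<in> \<A>"
    unfolding \<A>_def const_subring_def
  proof (intro CollectI conjI ballI)
    show "range e \<subseteq> range (\<lambda>p. ev p (inverse g))"
      by (auto intro!: image_eqI[of _ _ "[:_:]"])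
    show "inverse g \<in> range (\<lambda>p. ev p (inverse g))"
      by (auto intro!: image_eqI[of _ _ "[:0, 1:]"])
    show "g \<notin> range (\<lambda>p. ev p (inverse g))"
    proof
      assume "g \<in> range (\<lambda>p. ev p (inverse g))"
      then obtain p where "g = ev p (inverse g)" by blast
      then have "ev (1 - [:0, 1:] * p) (inverse g) = 0" using g0 by simp
      moreover have "coeff (1 - [:0, 1:] * p) 0 \<noteq> 0" by simp
      then have "1 - [:0, 1:] * p \<noteq> 0" by (metis coeff_0)
      ultimately have "inverse g \<in> range e" using root_in_constants by blast
      then obtain a where "inverse g = e a" by blast
      then have "g = e (inverse a)" by (metis inverse_inverse_eq e_simps(9))
      then show False using assms by blast
    qed
  qed (auto simp flip: ev_diff ev_mult)
  then have "\<A> \<noteq> {}" by blast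
  moreover have "\<Union>\<C> \<in> \<A>" if \<C>: "\<C> \<noteq> {}" "subset.chain \<A> \<C>" for \<C>
  proof -
    have mem: "A \<in> \<A>" if "A \<in> \<C>" for A using \<C> that by (auto simp: subset.chain_def)
    have "x - y \<in> \<Union>\<C> \<and> x * y \<in> \<Union>\<C>" if xy: "x \<in> \<Union>\<C>" "y \<in> \<Union>\<C>" for x y
    proof -
      from xy obtain A B where AB: "A \<in> \<C>" "B \<in> \<C>" "x \<in> A" "y \<in> B" by blast
      then have "A \<subseteq> B \<or> B \<subseteq> A" using \<C> by (auto simp: subset.chain_def)
      then obtain D where "D \<in> \<C>" "x \<in> D" "y \<in> D" using AB by blast
      then show ?thesis using mem[of D] by (auto simp: \<A>_def const_subring_def)
    qed
    moreover obtain A where "A \<in> \<C>" using \<C>(1) by blast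
    then have "range e \<subseteq> \<Union>\<C>" "inverse g \<in> \<Union>\<C>"
      using mem[of A] by (auto simp: \<A>_def const_subring_def)
    moreover have "g \<notin> \<Union>\<C>" using mem by (auto simp: \<A>_def)
    ultimately show ?thesis unfolding \<A>_def const_subring_def by blast
  qed
  ultimately obtain R where R: "R \<in> \<A>" and max: "\<And>Z. Z \<in> \<A> \<Longrightarrow> R \<subseteq> Z \<Longrightarrow> Z = R"
    using subset_Zorn_nonempty[of \<A>] by metis
  have sub: "const_subring R" "inverse g \<in> R" "g \<notin> R" using R by (auto simp: \<A>_def)
  have adjoin: "\<exists>n. g \<in> poly_values R f n" if "f \<notin> R" for f
  proof (rule ccontr)
    assume no: "\<nexists>n. g \<in> poly_values R f n"
    define Z where "Z = {poly p f | p. \<forall>i. coeff p i \<in> R}"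
    have ZI: "poly p f \<in> Z" if "\<And>i. coeff p i \<in> R" for p
      using that unfolding Z_def by blast
    have "const_subring Z"
      unfolding const_subring_def
    proof (intro conjI ballI)
      have "e a \<in> Z" for a
        using ZI[of "[:e a:]"] sub(1) by (simp add: coeff_pCons split: nat.split)
      then show "range e \<subseteq> Z" by blast
      fix y z assume "y \<in> Z" "z \<in> Z"
      then obtain p q where y: "y = poly p f" "\<forall>i. coeff p i \<in> R"
        and z: "z = poly q f" "\<forall>i. coeff q i \<in> R" unfolding Z_def by blast
      have "coeff (p - q) i \<in> R" for i using sub(1) y z by (auto intro!: subring_diff)
      then show "y - z \<in> Z" using ZI[of "p - q"] y z by simp
      have sum: "(\<Sum>j\<in>J. coeff p j * coeff q (i - j)) \<in> R" for J i
        using sub(1) y z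
        by (induction J rule: infinite_finite_induct) (auto intro!: subring_add subring_mult)
      have "coeff (p * q) i \<in> R" for i unfolding coeff_mult by (rule sum)
      then show "y * z \<in> Z" using ZI[of "p * q"] y z by simp
    qed
    moreover have "y \<in> Z" if "y \<in> R" for y
      using ZI[of "[:y:]"] sub(1) that by (simp add: coeff_pCons split: nat.split)
    then have "R \<subseteq> Z" by blast
    moreover have "f \<in> Z"
      using ZI[of "[:0, 1:]"] sub(1) by (simp add: coeff_pCons split: nat.split)
    moreover have "g \<notin> Z" using no unfolding Z_def poly_values_def by blast
    ultimately have "Z = R" using sub by (intro max) (auto simp: \<A>_def)
    then show False using \<open>f \<in> Z\<close> that by blast
  qed
  have "f \<in> R \<or> inverse f \<in> R" for f
  proof (rule ccontr)
    assume "\<not> (f \<in> R \<or> inverse f \<in> R)"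
    then obtain n m where "g \<in> poly_values R f n" "g \<in> poly_values R (inverse f) m" "f \<noteq> 0"
      using adjoin sub(1) by (metis subring_zero)
    then show False using poly_values_exclusive sub by blast
  qed
  then have "place R" unfolding place_def using sub by (auto simp: const_subring_def)
  then show thesis using that sub by blast
qed

end

context const_field
begin

lemma place_subring: "place R \<Longrightarrow> const_subring R"
  by (auto simp: place_def const_subring_def)

lemma place_inverse: "place R \<Longrightarrow> x \<in> R \<or> inverse x \<in> R"
  by (auto simp: place_def)

lemma max_ideal_iff: "x \<in> max_ideal R \<longleftrightarrow> x \<in> R \<and> (x = 0 \<or> inverse x \<notin> R)"
  by (auto simp: max_ideal_def)

lemma not_max_ideal: "x \<in> R \<Longrightarrow> x \<notin> max_ideal R \<Longrightarrow> x \<noteq> 0 \<and> inverse x \<in> R"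
  by (auto simp: max_ideal_def)

lemma max_ideal_mult:
  assumes R: "place R" and "x \<in> max_ideal R" "y \<in> R"
  shows "x * y \<in> max_ideal R"
proof -
  have "inverse x = y * inverse (x * y)" if "x * y \<noteq> 0" using that by (simp add: field_simps)
  then show ?thesis
    using assms subring_mult[OF place_subring[OF R]] unfolding max_ideal_iff
    by (metis mult_eq_0_iff)
qed

lemma max_ideal_add:
  assumes R: "place R" and "x \<in> max_ideal R" "y \<in> max_ideal R"
  shows "x + y \<in> max_ideal R"
proof -
  note S = place_subring[OF R]
  have *: "x + y \<in> max_ideal R" if xy: "x \<in> max_ideal R" "y \<in> max_ideal R" "x / y \<in> R" "y \<noteq> 0" for x y
  proof (rule ccontr)
    assume "x + y \<notin> max_ideal R"
    moreover have "x + y \<in> R" using xy S by (auto simp: max_ideal_iff intro: subring_add)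
    ultimately have u: "x + y \<noteq> 0" "inverse (x + y) \<in> R" using not_max_ideal by blast+
    have "(x / y + 1) * inverse (x + y) \<in> R" using xy u S by (intro subring_intros) auto
    also have "(x / y + 1) * inverse (x + y) = inverse y" using u xy by (simp add: field_simps)
    finally show False using xy by (simp add: max_ideal_iff)
  qed
  show ?thesis
  proof (cases "x = 0 \<or> y = 0")
    case False
    have "x / y \<in> R \<or> y / x \<in> R"
      using place_inverse[OF R, of "x / y"] by simp
    then show ?thesis using *[of x y] *[of y x] assms False by (auto simp: add.commute)
  qed (use assms in auto)
qed

lemma max_ideal_prime:
  assumes R: "place R" and "x \<in> R" "y \<in> R" "x * y \<in> max_ideal R"
  shows "x \<in> max_ideal R \<or> y \<in> max_ideal R"
  using assms subring_mult[OF place_subring[OF R], of "inverse x" "inverse y"]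
  by (auto simp: max_ideal_iff mult.commute)

lemma max_ideal_uminus: "place R \<Longrightarrow> x \<in> max_ideal R \<Longrightarrow> - x \<in> max_ideal R"
  using max_ideal_mult[of R x "- 1"] subring_uminus[OF place_subring, of R 1] place_subring by force

lemma max_ideal_diff: "place R \<Longrightarrow> x \<in> max_ideal R \<Longrightarrow> y \<in> max_ideal R \<Longrightarrow> x - y \<in> max_ideal R"
  using max_ideal_add[of R x "- y"] max_ideal_uminus by force

lemma max_ideal_const: "place R \<Longrightarrow> e a \<in> max_ideal R \<longleftrightarrow> a = 0"
  using subring_const[OF place_subring, of R] by (auto simp: max_ideal_iff simp flip: e_simps(9))

text \<open>Used for contradiction: if x were congruent to no constant modulo the maximal ideal,
  every nonzero polynomial in x would be invertible in the valuation ring.\<close>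

lemma inverse_ev_in_place:
  assumes R: "place R" and u: "\<And>a. inverse (x - e a) \<in> R" and "p \<noteq> 0"
  shows "inverse (ev p x) \<in> R"
  using \<open>p \<noteq> 0\<close>
proof (induction "degree p" arbitrary: p rule: less_induct)
  case less
  show ?case
  proof (cases "degree p = 0")
    case True
    then obtain a where "p = [:a:]" by (metis degree_eq_zeroE)
    then show ?thesis
      using subring_const[OF place_subring[OF R], of "inverse a"] by simp
  next
    case False
    then obtain a where "poly p a = 0"
      using alg_closed_imp_poly_has_root by blast
    then obtain q where q: "p = [:-a, 1:] * q"
      using poly_eq_0_iff_dvd by blast
    moreover have "q \<noteq> 0" using q less.prems by auto
    moreover have "degree q < degree p"
      using q \<open>q \<noteq> 0\<close> by (subst q, subst degree_mult_eq) auto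
    ultimately have "inverse (ev q x) \<in> R" using less.hyps by blast
    moreover have "inverse (ev p x) = inverse (x - e a) * inverse (ev q x)"
      by (simp add: q algebra_simps flip: inverse_mult_distrib)
    ultimately show ?thesis using u subring_mult[OF place_subring[OF R]] by simp
  qed
qed

section \<open>Derivations at smooth points\<close>

text \<open>For \<open>E \<subseteq> R\<close> this is the localisation of \<open>E\<close> at the
  prime \<open>E \<inter> max_ideal R\<close>, the centre of the place.\<close>

definition localisation :: "'f set \<Rightarrow> 'f set \<Rightarrow> 'f set" where
  "localisation E R = {a / s | a s. a \<in> E \<and> s \<in> E \<and> s \<noteq> 0 \<and> inverse s \<in> R}"

lemma localisationI:
  "a \<in> E \<Longrightarrow> s \<in> E \<Longrightarrow> s \<noteq> 0 \<Longrightarrow> inverse s \<in> R \<Longrightarrow> a / s \<in> localisation E R"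
  unfolding localisation_def by blast

context
  fixes E R :: "'f set"
  assumes R: "place R" and E: "const_subring E" "E \<subseteq> R"
begin

lemma localisation_superset: "E \<subseteq> localisation E R"
proof
  fix a assume "a \<in> E"
  then have "a / 1 \<in> localisation E R"
    using E place_subring[OF R] by (intro localisationI) auto
  then show "a \<in> localisation E R" by simp
qed

lemma localisation_subring: "const_subring (localisation E R)"
  unfolding const_subring_def
proof (intro conjI ballI)
  show "range e \<subseteq> localisation E R"
    using localisation_superset E(1) by (auto simp: const_subring_def)
  fix y z assume "y \<in> localisation E R" "z \<in> localisation E R"
  then obtain a s b r where y: "y = a / s" "a \<in> E" "s \<in> E" "s \<noteq> 0" "inverse s \<in> R"
    and z: "z = b / r" "b \<in> E" "r \<in> E" "r \<noteq> 0" "inverse r \<in> R"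
    unfolding localisation_def by blast
  have "inverse (s * r) \<in> R" using y z subring_mult[OF place_subring[OF R]] by simp
  moreover have "y - z = (a * r - b * s) / (s * r)" "y * z = a * b / (s * r)"
    using y z by (auto simp: field_simps)
  ultimately show "y - z \<in> localisation E R" "y * z \<in> localisation E R"
    using y z E(1) by (auto intro!: localisationI subring_diff subring_mult simp del: inverse_mult_distrib)
qed

lemma localisation_subset: "localisation E R \<subseteq> R"
  using E R unfolding localisation_def divide_inverse
  by (auto intro!: subring_mult[OF place_subring])

lemma localisation_inverse:
  assumes "z \<in> localisation E R" "z \<noteq> 0" "inverse z \<in> R"
  shows "inverse z \<in> localisation E R"
proof -
  obtain a s where z: "z = a / s" "a \<in> E" "s \<in> E" "s \<noteq> 0" "inverse s \<in> R"
    using assms(1) unfolding localisation_def by blast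
  have "inverse a = inverse z * inverse s" using z assms by (simp add: field_simps)
  moreover have "inverse z * inverse s \<in> R"
    using subring_mult[OF place_subring[OF R] assms(3) z(5)] .
  ultimately have "inverse a \<in> R" by metis
  then have "s / a \<in> localisation E R" using z assms by (intro localisationI) auto
  then show ?thesis using z by simp
qed

text \<open>The denominator is cancelled one factor at a time: if \<open>l / t ^ Suc m\<close> lies
  in \<open>R\<close>, the numerator of \<open>l\<close> lies in the maximal ideal and is therefore
  divisible by \<open>t\<close> in the localisation.\<close>

lemma localisation_eq_place:
  assumes t: "t \<in> max_ideal R" "t \<noteq> 0"
    and max: "\<And>a. a \<in> E \<Longrightarrow> a \<in> max_ideal R \<Longrightarrow> \<exists>b\<in>localisation E R. a = t * b"
    and all: "\<exists>l\<in>localisation E R. \<exists>m. z = l / t ^ m" and z: "z \<in> R"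
  shows "z \<in> localisation E R"
proof -
  have "l / t ^ m \<in> R \<Longrightarrow> l \<in> localisation E R \<Longrightarrow> l / t ^ m \<in> localisation E R" for l m
  proof (induction m arbitrary: l)
    case (Suc m)
    obtain a s where l: "l = a / s" "a \<in> E" "s \<in> E" "s \<noteq> 0" "inverse s \<in> R"
      using Suc.prems unfolding localisation_def by blast
    have "t * (t ^ m * (l / t ^ Suc m) * s) \<in> max_ideal R"
      using R Suc.prems t l E
      by (intro max_ideal_mult subring_mult subring_power place_subring) (auto simp: max_ideal_iff)
    also have "t * (t ^ m * (l / t ^ Suc m) * s) = a" using l t by simp
    finally obtain b where b: "b \<in> localisation E R" "a = t * b" using max l by blast
    have "inverse s \<in> localisation E R"
      using localisation_inverse[of s] localisation_superset l by auto
    then have "b * inverse s \<in> localisation E R" using b localisation_subring subring_mult by blast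
    moreover have "l / t ^ Suc m = b * inverse s / t ^ m" using b l t by (simp add: field_simps)
    ultimately show ?case using Suc by metis
  qed simp
  then show ?thesis using all z by blast
qed

end

definition derivation :: "('f \<Rightarrow> 'f) \<Rightarrow> bool" where
  "derivation D \<longleftrightarrow> (\<forall>f g. D (f + g) = D f + D g) \<and> (\<forall>f g. D (f * g) = D f * g + f * D g) \<and>
     (\<forall>a. D (e a) = 0)"

context
  fixes D assumes D: "derivation D"
begin

lemma derivation_add: "D (f + g) = D f + D g"
  and derivation_mult: "D (f * g) = D f * g + f * D g"
  and derivation_const: "D (e a) = 0"
  using D by (auto simp: derivation_def)

lemma derivation_one: "D 1 = 0"
  using derivation_const[of 1] by simp

lemma derivation_ev: "D (ev p x) = ev (pderiv p) x * D x"
proof (induction p)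
  case 0
  show ?case using derivation_const[of 0] by simp
next
  case (pCons a p)
  then show ?case
    by (simp add: derivation_add derivation_mult derivation_const pderiv_pCons algebra_simps)
qed

lemma derivation_inverse:
  assumes "s \<noteq> 0" shows "D (inverse s) = - D s / s ^ 2"
proof -
  have "D s * inverse s + s * D (inverse s) = 0"
    using derivation_mult[of s "inverse s"] derivation_one assms by simp
  then have "s * D (inverse s) = - (D s * inverse s)"
    by (simp add: eq_neg_iff_add_eq_0 add.commute)
  then have "inverse s * (s * D (inverse s)) = inverse s * - (D s * inverse s)" by simp
  then show ?thesis using assms by (simp add: power2_eq_square divide_inverse mult.assoc mult.left_commute flip: mult.assoc)
qed

lemma derivation_divide: "s \<noteq> 0 \<Longrightarrow> D (a / s) = (D a * s - a * D s) / s ^ 2"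
  by (simp add: divide_inverse derivation_mult derivation_inverse left_diff_distrib power2_eq_square)

end


text \<open>At a place where \<open>x\<close> is finite, \<open>R\<close> is the localisation of \<open>kbar[x, y]\<close> at the centre
  \<open>(a, b)\<close> of the place; as \<open>f\<close> has no double root, \<open>x - a\<close> (if \<open>b \<noteq> 0\<close>) or \<open>y\<close> (if \<open>b = 0\<close>)
  generates its maximal ideal. The derivation preserves \<open>kbar[x, y]\<close>, hence \<open>R\<close>.\<close>

lemma derivation_stable_place:
  fixes x y :: 'f
  assumes R: "place R" and xR: "x \<in> R" and x: "x \<notin> range e"
    and y: "y ^ 2 = ev f x" and simple: "\<And>a. poly f a = 0 \<Longrightarrow> poly (pderiv f) a \<noteq> 0"
    and gen: "\<And>z. \<exists>p\<in>ratfun x. \<exists>q\<in>ratfun x. z = p + q * y"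
    and two: "(2 :: 'f) \<noteq> 0"
    and D: "derivation D" and Dx: "D x = ev h x * y" and z: "z \<in> R"
  shows "D z \<in> R"
proof -
  note S = place_subring[OF R]
  define E where "E = {ev p x + ev q x * y | p q. True}"
  have EI: "ev p x + ev q x * y \<in> E" for p q unfolding E_def by blast
  have f0: "f \<noteq> 0" using simple[of 0] by auto
  have fx: "ev f x \<noteq> 0" using f0 ev_eq_0_iff x by blast
  then have y0: "y \<noteq> 0" using y by auto
  \<comment> \<open>y is integral over kbar[x]: if 1/y is in \<open>R\<close>, then so is y = f(x) /
    y.\<close>
  have yR: "y \<in> R"
  proof (rule ccontr)
    assume "y \<notin> R"
    then have "inverse y \<in> R" using place_inverse R by blast
    then have "ev f x * inverse y \<in> R" using S xR by (intro subring_intros)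
    also have "ev f x * inverse y = y" unfolding y[symmetric] using y0 by (simp add: power2_eq_square)
    finally show False using \<open>y \<notin> R\<close> by blast
  qed
  have E: "const_subring E"
    unfolding const_subring_def
  proof (intro conjI ballI)
    have "e a = ev [:a:] x + ev 0 x * y" for a by simp
    then show "range e \<subseteq> E" using EI by (metis (no_types, lifting) image_subsetI)
    fix u v assume "u \<in> E" "v \<in> E"
    then obtain p q r s where u: "u = ev p x + ev q x * y" and v: "v = ev r x + ev s x * y"
      unfolding E_def by blast
    have "u - v = ev (p - r) x + ev (q - s) x * y" by (simp add: u v algebra_simps)
    then show "u - v \<in> E" using EI by metis
    have "u * v = ev p x * ev r x + ev q x * ev s x * y ^ 2 + (ev p x * ev s x + ev q x * ev r x) * y"
      by (simp add: u v algebra_simps power2_eq_square)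
    also have "\<dots> = ev (p * r + q * s * f) x + ev (p * s + q * r) x * y" by (simp add: y)
    finally show "u * v \<in> E" using EI by metis
  qed
  have ER: "E \<subseteq> R" unfolding E_def using S xR yR by (auto intro!: subring_intros)
  have evE: "ev p x \<in> E" for p using EI[of p 0] by simp
  have yE: "y \<in> E" using EI[of 0 1] by simp
  have xE: "x \<in> E" using evE[of "[:0, 1:]"] by simp
  define L where "L = localisation E R"
  have LR: "L \<subseteq> R" unfolding L_def using localisation_subset R E ER by blast
  have LE: "E \<subseteq> L" unfolding L_def using localisation_superset R E ER by blast
  have L: "const_subring L" unfolding L_def using localisation_subring R E ER by blast
  have Linv: "inverse z \<in> L" if "z \<in> L" "z \<notin> max_ideal R" for z
    using that localisation_inverse[OF R E ER, of z] not_max_ideal[of z R] LR unfolding L_def by blast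

  \<comment> \<open>The value of x at the place. If there were none, \<open>R\<close> would contain
    kbar(x) and y, hence the whole field.\<close>
  obtain a where a: "x - e a \<in> max_ideal R"
  proof -
    have "\<exists>a. inverse (x - e a) \<notin> R"
    proof (rule ccontr)
      assume "\<nexists>a. inverse (x - e a) \<notin> R"
      then have inv: "inverse (ev p x) \<in> R" if "p \<noteq> 0" for p
        using inverse_ev_in_place[OF R] that by blast
      have "w \<in> R" if "w \<in> ratfun x" for w
      proof -
        obtain p q where pq: "ev q x \<noteq> 0" "w = ev p x / ev q x" using ratfun_quotient \<open>w \<in> ratfun x\<close> .
        then have "inverse (ev q x) \<in> R" by (intro inv) auto
        then show ?thesis unfolding pq(2) divide_inverse using S xR by (intro subring_intros)
      qed
      then have "w \<in> R" for w using gen[of w] S yR by (auto intro!: subring_intros)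
      then show False using R unfolding place_def by blast
    qed
    then show thesis using that S xR unfolding max_ideal_iff by (auto intro: subring_intros)
  qed
  have cen: "ev p x - e (poly p a) \<in> max_ideal R" and cenE: "\<exists>r. ev p x - e (poly p a) = (x - e a) * ev r x" for p
  proof -
    obtain r where "p - [:poly p a:] = [:- a, 1:] * r"
      using poly_eq_0_iff_dvd[of "p - [:poly p a:]" a] by auto
    then have "ev (p - [:poly p a:]) x = ev ([:- a, 1:] * r) x" by simp
    then have r: "ev p x - e (poly p a) = (x - e a) * ev r x" by (simp add: algebra_simps)
    then show "\<exists>r. ev p x - e (poly p a) = (x - e a) * ev r x" by blast
    show "ev p x - e (poly p a) \<in> max_ideal R"
      unfolding r using a R S xR by (intro max_ideal_mult subring_ev)
  qed
  have evM: "ev p x \<in> max_ideal R \<longleftrightarrow> poly p a = 0" for p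
  proof
    assume "ev p x \<in> max_ideal R"
    then have "ev p x - (ev p x - e (poly p a)) \<in> max_ideal R" using max_ideal_diff[OF R] cen by blast
    then show "poly p a = 0" by (simp add: max_ideal_const[OF R])
  next
    assume "poly p a = 0"
    then show "ev p x \<in> max_ideal R" using cen[of p] by simp
  qed
  \<comment> \<open>The value of y: the product (y - b) (y + b) = f(x) - f(a) vanishes at the place,
    so one factor does, and the sign of the square root is chosen accordingly.\<close>
  obtain b where b: "b ^ 2 = poly f a" "y - e b \<in> max_ideal R"
  proof -
    obtain b where b: "b ^ 2 = poly f a" using nth_root_exists[of 2 "poly f a"] by auto
    have "(y - e b) * (y + e b) = ev f x - e (poly f a)"
      unfolding y[symmetric] b[symmetric] by (simp add: algebra_simps power2_eq_square)
    then have "y - e b \<in> max_ideal R \<or> y + e b \<in> max_ideal R"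
      using cen[of f] S yR by (intro max_ideal_prime[OF R]) (auto intro!: subring_intros)
    then show thesis using that[of b] that[of "- b"] b by auto
  qed
  obtain f' where f': "f - [:poly f a:] = [:- a, 1:] * f'"
    using poly_eq_0_iff_dvd[of "f - [:poly f a:]" a] by auto
  then have "ev (f - [:poly f a:]) x = ev ([:- a, 1:] * f') x" by simp
  then have f'x: "ev f x - e (b ^ 2) = (x - e a) * ev f' x" by (simp add: b algebra_simps)
  \<comment> \<open>The order of x - a in terms of \<open>t\<close> is \<open>j\<close>: 1 if
    \<open>b \<noteq> 0\<close>, but 2 at a branch point. Writing 1/(x - a) as
    \<open>w / t ^ j\<close> is what lets powers of \<open>t\<close> clear all denominators from
    kbar(x).\<close>
  obtain t j w where t: "t \<in> max_ideal R" "t \<in> L" "t \<noteq> 0" and w: "w \<in> L" "inverse (x - e a) = w / t ^ j"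
    and xt: "\<exists>l\<in>L. x - e a = t * l" and yt: "\<exists>l\<in>L. y - e b = t * l"
  proof (cases "b = 0")
    case False
    have xa0: "x - e a \<noteq> 0" using x by auto
    have yb: "y + e b \<notin> max_ideal R"
    proof
      assume "y + e b \<in> max_ideal R"
      then have "(y + e b) - (y - e b) \<in> max_ideal R" using b max_ideal_diff[OF R] by blast
      then have "e (2 * b) \<in> max_ideal R" by simp
      then show False using False two unfolding max_ideal_const[OF R]
        by (metis e_simps(2) e_simps(12) mult_eq_0_iff)
    qed
    then have inv: "inverse (y + e b) \<in> L" using Linv[of "y + e b"] yE LE L by (auto intro: subring_intros)
    have "y + e b \<noteq> 0" using yb S by (auto simp: max_ideal_iff)
    have "(y - e b) * (y + e b) = (x - e a) * ev f' x"
      unfolding f'x[symmetric] y[symmetric] by (simp add: algebra_simps power2_eq_square)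
    then have "y - e b = (x - e a) * (ev f' x * inverse (y + e b))"
      using \<open>y + e b \<noteq> 0\<close> by (simp add: field_simps)
    moreover have "ev f' x * inverse (y + e b) \<in> L" using inv L evE LE by (auto intro!: subring_mult)
    ultimately have "\<exists>l\<in>L. y - e b = (x - e a) * l" by blast
    then show thesis
      using a xa0 L xE LE
      by (intro that[of "x - e a" 1 1]) (auto intro!: subring_intros bexI[of _ 1] simp: divide_inverse)
  next
    case True
    then have "poly f a = 0" using b by simp
    then have "f = [:- a, 1:] * f'" using f' by simp
    then have "pderiv f = [:- a, 1:] * pderiv f' + f' * pderiv [:- a, 1:]"
      by (simp only: pderiv_mult)
    then have "poly (pderiv f) a = poly f' a" by (simp add: pderiv_pCons)
    then have "poly f' a \<noteq> 0" using simple[OF \<open>poly f a = 0\<close>] by simp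
    then have f'M: "ev f' x \<notin> max_ideal R" using evM by blast
    then have inv: "inverse (ev f' x) \<in> L" using Linv evE LE by blast
    have n0: "ev f' x \<noteq> 0" using f'M S by (auto simp: max_ideal_iff)
    have yy: "y ^ 2 = (x - e a) * ev f' x" using f'x True y by simp
    show thesis
    proof (rule that)
      show "y \<in> max_ideal R" using b True by simp
      show "y \<in> L" "y \<noteq> 0" "ev f' x \<in> L" using yE evE LE y0 by auto
      show "inverse (x - e a) = ev f' x / y ^ 2" unfolding yy using n0 by (simp add: divide_inverse)
      have "y * (y * inverse (ev f' x)) = y ^ 2 * inverse (ev f' x)"
        by (simp add: power2_eq_square)
      also have "\<dots> = x - e a" unfolding yy using n0 by simp
      finally show "\<exists>l\<in>L. x - e a = y * l"
        using inv L yE LE by (intro bexI[of _ "y * inverse (ev f' x)"]) (auto intro!: subring_mult)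
      show "\<exists>l\<in>L. y - e b = y * l" using True L by (intro bexI[of _ 1]) auto
    qed
  qed
  \<comment> \<open>Expand around (a, b): u is its value \<open>c\<close> at the point plus
    multiples of x - a and y - b, both divisible by \<open>t\<close>. The value vanishes because u
    is in the maximal ideal.\<close>
  have tL: "\<exists>l\<in>L. u = t * l" if u: "u \<in> E" "u \<in> max_ideal R" for u
  proof -
    obtain p q where pq: "u = ev p x + ev q x * y" using u(1) unfolding E_def by blast
    define c where "c = poly (p + [:b:] * q) a"
    obtain r where r: "ev (p + [:b:] * q) x - e c = (x - e a) * ev r x"
      using cenE unfolding c_def by blast
    have ue: "u = (ev (p + [:b:] * q) x - e c) + ev q x * (y - e b) + e c"
      by (simp add: pq algebra_simps)
    obtain l1 l2 where l: "l1 \<in> L" "l2 \<in> L" "x - e a = t * l1" "y - e b = t * l2" using xt yt by blast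
    define v where "v = l1 * ev r x + ev q x * l2"
    have vL: "v \<in> L" unfolding v_def using l L xE LE by (auto intro!: subring_intros)
    have uv: "u = t * v + e c"
      unfolding ue r l v_def by (simp add: algebra_simps)
    have "t * v \<in> max_ideal R" using t vL LR R by (intro max_ideal_mult) auto
    then have "u - t * v \<in> max_ideal R" using u max_ideal_diff[OF R] by blast
    then have "c = 0" using max_ideal_const[OF R] by (simp add: uv)
    then show ?thesis using uv vL by auto
  qed
  \<comment> \<open>\<open>T\<close> is the ring L[1/t]. It contains y and, by inverting linear
    factors, kbar(x), so it is the whole field.\<close>
  define T where "T = {l / t ^ m | l m. l \<in> L}"
  have TI: "l / t ^ m \<in> T" if "l \<in> L" for l m unfolding T_def using that by blast
  have LT: "l \<in> T" if "l \<in> L" for l using TI[of l 0] that by simp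
  have Tmult: "u * v \<in> T" if uv: "u \<in> T" "v \<in> T" for u v
  proof -
    obtain l m l' m' where "u = l / t ^ m" "v = l' / t ^ m'" "l \<in> L" "l' \<in> L"
      using uv unfolding T_def by blast
    then have "u * v = l * l' / t ^ (m + m')" "l * l' \<in> L"
      using t L by (auto simp: power_add intro: subring_mult)
    then show ?thesis using TI by metis
  qed
  have Tadd: "u + v \<in> T" if uv: "u \<in> T" "v \<in> T" for u v
  proof -
    obtain l m l' m' where "u = l / t ^ m" "v = l' / t ^ m'" "l \<in> L" "l' \<in> L"
      using uv unfolding T_def by blast
    then have "u + v = (l * t ^ m' + l' * t ^ m) / t ^ (m + m')" "l * t ^ m' + l' * t ^ m \<in> L"
      using t L by (auto simp: power_add field_simps intro!: subring_intros)
    then show ?thesis using TI by metis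
  qed
  have Tinv: "inverse (ev p x) \<in> T" if "p \<noteq> 0" for p
    using that
  proof (induction "degree p" arbitrary: p rule: less_induct)
    case less
    show ?case
    proof (cases "degree p = 0")
      case True
      then obtain c where "p = [:c:]" by (metis degree_eq_zeroE)
      then show ?thesis using subring_const[OF L, of "inverse c"] LT by simp
    next
      case False
      then obtain c where "poly p c = 0" using alg_closed_imp_poly_has_root by blast
      then obtain q where q: "p = [:-c, 1:] * q" using poly_eq_0_iff_dvd by blast
      moreover have "q \<noteq> 0" using q less.prems by auto
      moreover have "degree q < degree p"
        using q \<open>q \<noteq> 0\<close> by (subst q, subst degree_mult_eq) auto
      ultimately have "inverse (ev q x) \<in> T" using less.hyps by blast
      moreover have "inverse (x - e c) \<in> T"
      proof (cases "c = a")
        case True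
        then show ?thesis using w TI by metis
      next
        case False
        then have "ev [:- c, 1:] x \<notin> max_ideal R" unfolding evM by simp
        then have "x - e c \<notin> max_ideal R" by simp
        moreover have "x - e c \<in> L" using xE LE L by (auto intro: subring_intros)
        ultimately show ?thesis using Linv LT by blast
      qed
      moreover have "inverse (ev p x) = inverse (x - e c) * inverse (ev q x)"
        by (simp add: q algebra_simps flip: inverse_mult_distrib)
      ultimately show ?thesis using Tmult by simp
    qed
  qed
  have Trat: "u \<in> T" if u: "u \<in> ratfun x" for u
  proof -
    obtain p q where pq: "ev q x \<noteq> 0" "u = ev p x / ev q x" using ratfun_quotient[OF u] .
    then have "inverse (ev q x) \<in> T" by (intro Tinv) auto
    then show ?thesis unfolding pq(2) divide_inverse using Tmult LT evE LE by blast
  qed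
  have "u \<in> T" for u
  proof -
    obtain p q where "p \<in> ratfun x" "q \<in> ratfun x" "u = p + q * y" using gen[of u] by blast
    moreover have "y \<in> T" using LT yE LE by blast
    ultimately show ?thesis using Trat Tadd Tmult by simp
  qed
  then have "z \<in> L"
    unfolding L_def
  proof (intro localisation_eq_place[OF R E ER t(1,3)])
    show "\<exists>l\<in>localisation E R. \<exists>m. z = l / t ^ m"
      using \<open>\<And>u. u \<in> T\<close>[of z] unfolding T_def L_def by blast
  qed (use tL z in \<open>auto simp: L_def\<close>)
  \<comment> \<open>Differentiating y^2 = f(x) and cancelling y makes D y a polynomial in x. The
    cancellation is the reason for requiring D x to be a multiple of y.\<close>
  have "2 * (y * D y) = ev (pderiv f) x * (ev h x * y)"
    using derivation_ev[OF D, of f x] derivation_mult[OF D, of y y]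
    by (simp add: Dx power2_eq_square flip: y)
  then have "y * (2 * D y) = y * ev (pderiv f * h) x" by (simp add: algebra_simps)
  then have "2 * D y = ev (pderiv f * h) x" using y0 by simp
  moreover have "inverse 2 * (2 * D y) = D y" using two by simp
  ultimately have Dy: "D y = e (inverse 2) * ev (pderiv f * h) x" by simp
  have DxE: "D x \<in> E" unfolding Dx using E evE yE by (intro subring_mult)
  have DyE: "D y \<in> E" unfolding Dy using E evE by (intro subring_mult subring_const)
  have DE: "D u \<in> E" if u: "u \<in> E" for u
  proof -
    obtain p q where "u = ev p x + ev q x * y" using u unfolding E_def by blast
    then show ?thesis
      using E evE yE DyE DxE xE
      by (simp add: derivation_add[OF D] derivation_mult[OF D] derivation_ev[OF D] subring_add subring_mult)
  qed
  obtain u s where us: "z = u / s" "u \<in> E" "s \<in> E" "s \<noteq> 0" "inverse s \<in> R"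
    using \<open>z \<in> L\<close> unfolding L_def localisation_def by blast
  have "D z = (D u * s - u * D s) * inverse s ^ 2"
    unfolding us(1) derivation_divide[OF D us(4)] by (simp add: divide_inverse power_inverse)
  also have "\<dots> \<in> R" using us DE ER S by (intro subring_intros) auto
  finally show ?thesis .
qed

end

context const_field
begin

section \<open>Curves of genus at most one\<close>

lemma const_if_in_all_places: "(\<And>R. place R \<Longrightarrow> w \<in> R) \<Longrightarrow> w \<in> range e"
  using place_avoiding by blast

lemma inverse_not_const: "x \<notin> range e \<Longrightarrow> inverse x \<notin> range e"
proof
  assume "x \<notin> range e" "inverse x \<in> range e"
  then obtain a where "inverse x = e a" by blast
  then have "x = e (inverse a)" by (metis inverse_inverse_eq e_simps(9))
  then show False using \<open>x \<notin> range e\<close> by blast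
qed

text \<open>D is the vector field dual to dx / y. The conditions on b and c keep the roots of the
  right hand side simple in each chart: \<open>1 + b * c = 0\<close> is the coincidence of x^2 = -b
  with c x^2 = 1, and \<open>b = 0\<close> would give a double root at 0.\<close>

lemma derivation_stable_biquadratic:
  fixes x y :: 'f
  assumes x: "x \<notin> range e" and y: "y ^ 2 = ev ([:b, 0, 1:] * [:- 1, 0, c:]) x"
    and b: "b \<noteq> 0" and bc: "1 + b * c \<noteq> 0"
    and gen: "\<And>z. \<exists>p\<in>ratfun x. \<exists>q\<in>ratfun x. z = p + q * y"
    and two: "(2 :: 'f) \<noteq> 0"
    and D: "derivation D" and Dx: "D x = y" and R: "place R" and z: "z \<in> R"
  shows "D z \<in> R"
proof -
  have two': "(2 :: 'k alg_closure) \<noteq> 0" using two by (metis e_simps(2) e_simps(12))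
  have x0: "x \<noteq> 0" using x by (metis e_simps(2) rangeI)
  define u where "u = inverse x"
  have u: "u \<notin> range e" unfolding u_def using x by (rule inverse_not_const)
  have xu: "x \<in> ratfun u"
    using subfield_inverse[OF subfield_field_adjoin gen_in_ratfun[of u]] by (simp add: u_def)
  have genu: "\<exists>p\<in>ratfun u. \<exists>q\<in>ratfun u. z = p + q * (y / x ^ n)" for z n
  proof -
    obtain p q where pq: "p \<in> ratfun x" "q \<in> ratfun x" "z = p + q * y" using gen by blast
    then have "p \<in> ratfun u" "q * x ^ n \<in> ratfun u"
      using ratfun_subset[OF xu] xu by (auto intro!: subfield_mult subfield_power subfield_field_adjoin)
    moreover have "z = p + (q * x ^ n) * (y / x ^ n)" using pq x0 by simp
    ultimately show ?thesis by blast
  qed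
  have Du: "D u = - y / x ^ 2" unfolding u_def using derivation_inverse[OF D x0] Dx by simp
  \<comment> \<open>Near infinity the coordinates are u = 1/x and y/x^2. For c = 0 the right hand
    side is only quadratic and this chart is singular at u = 0, so y/x replaces y/x^2; then D u = -u
    (y/x) is still of the required form.\<close>
  consider "x \<in> R" | "u \<in> R" "c \<noteq> 0" | "u \<in> R" "c = 0"
    using place_inverse[OF R] u_def by blast
  then show ?thesis
  proof cases
    case 1
    show ?thesis
    proof (rule derivation_stable_place[OF R 1 x y _ gen two D _ z])
      fix a assume 0: "poly ([:b, 0, 1:] * [:- 1, 0, c:]) a = 0"
      show "poly (pderiv ([:b, 0, 1:] * [:- 1, 0, c:])) a \<noteq> 0"
      proof
        assume "poly (pderiv ([:b, 0, 1:] * [:- 1, 0, c:])) a = 0"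
        then have d: "2 * (a * (c * a ^ 2 - 1) + (a ^ 2 + b) * (c * a)) = 0"
          unfolding pderiv_mult by (simp add: pderiv_pCons algebra_simps power2_eq_square)
        have "(a ^ 2 + b) * (c * a ^ 2 - 1) = 0"
          using 0 by (simp add: algebra_simps power2_eq_square)
        then consider "a ^ 2 = - b" | "c * a ^ 2 = 1"
          by (auto simp: eq_neg_iff_add_eq_0)
        then show False
        proof cases
          case 1
          have "a * (c * a ^ 2 - 1) + (a ^ 2 + b) * (c * a) = 0" using d two' mult_eq_0_iff by blast
          then have "- (a * (1 + b * c)) = 0" unfolding 1 by (simp add: algebra_simps)
          then show False using bc b 1 by auto
        next
          case 2
          have "a * (c * a ^ 2 - 1) + (a ^ 2 + b) * (c * a) = 0" using d two' mult_eq_0_iff by blast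
          then have "(a ^ 2 + b) * (c * a) = 0" "c * a \<noteq> 0" using 2 by auto
          then have "a ^ 2 = - b" by (simp add: eq_neg_iff_add_eq_0)
          then have "- (b * c) = 1" using 2 by (simp add: algebra_simps)
          then show False using bc by (metis add.right_inverse add.commute)
        qed
      qed
    next
      show "D x = ev 1 x * y" using Dx by simp
    qed
  next
    case 2
    have "(y / x ^ 2) ^ 2 = (y ^ 2) * u ^ 4"
      by (simp add: u_def divide_inverse power_mult_distrib power_inverse flip: power_mult)
    also have "\<dots> = ((1 + e b * u ^ 2) * (e c - u ^ 2)) * (x * u) ^ 4"
      unfolding y using x0 by (simp add: u_def field_simps power2_eq_square power4_eq_xxxx)
    finally have y1: "(y / x ^ 2) ^ 2 = ev ([:1, 0, b:] * [:c, 0, - 1:]) u"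
      using x0 by (simp add: u_def power2_eq_square algebra_simps)
    show ?thesis
    proof (rule derivation_stable_place[OF R 2(1) u y1 _ genu two D _ z])
      fix a assume 0: "poly ([:1, 0, b:] * [:c, 0, - 1:]) a = 0"
      show "poly (pderiv ([:1, 0, b:] * [:c, 0, - 1:])) a \<noteq> 0"
      proof
        assume "poly (pderiv ([:1, 0, b:] * [:c, 0, - 1:])) a = 0"
        then have d: "2 * (b * a * (c - a ^ 2) - (1 + b * a ^ 2) * a) = 0"
          unfolding pderiv_mult by (simp add: pderiv_pCons algebra_simps power2_eq_square)
        have "(b * a ^ 2 + 1) * (c - a ^ 2) = 0"
          using 0 by (simp add: algebra_simps power2_eq_square)
        then consider "a ^ 2 = c" | "b * a ^ 2 = - 1"
          by (auto simp: eq_neg_iff_add_eq_0)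
        then show False
        proof cases
          case 1
          have "b * a * (c - a ^ 2) - (1 + b * a ^ 2) * a = 0" using d two' mult_eq_0_iff by blast
          then have "- ((1 + b * c) * a) = 0" unfolding 1 by simp
          then show False using bc 1 2(2) by auto
        next
          case 2
          then have ba: "b * a \<noteq> 0" by auto
          have "b * a * (c - a ^ 2) - (1 + b * a ^ 2) * a = 0" using d two' mult_eq_0_iff by blast
          then have "c = a ^ 2" using ba unfolding 2 by simp
          then show False using 2 bc by simp
        qed
      qed
    next
      show "D u = ev [:- 1:] u * (y / x ^ 2)" using Du by simp
    qed
  next
    case 3
    have "(y / x ^ 1) ^ 2 = (y ^ 2) * u ^ 2"
      by (simp add: u_def divide_inverse power_mult_distrib)
    also have "\<dots> = - (1 + e b * u ^ 2) * (x * u) ^ 2"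
      unfolding y using x0 3 by (simp add: u_def field_simps power2_eq_square)
    finally have y1: "(y / x ^ 1) ^ 2 = ev (- [:1, 0, b:]) u"
      using x0 by (simp add: u_def power2_eq_square algebra_simps)
    show ?thesis
    proof (rule derivation_stable_place[OF R 3(1) u y1 _ genu two D _ z])
      fix a assume 0: "poly (- [:1, 0, b:]) a = 0"
      then have "a \<noteq> 0" by auto
      then show "poly (pderiv (- [:1, 0, b:])) a \<noteq> 0"
        using b two' by (simp add: pderiv_pCons pderiv_minus flip: mult_2)
    next
      show "D u = ev [:0, - 1:] u * (y / x ^ 1)" using Du by (simp add: u_def divide_inverse power2_eq_square)
    qed
  qed
qed

lemma derivation_ratfun_zero:
  assumes D: "derivation D" and "D x = 0" "z \<in> ratfun x"
  shows "D z = 0"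
proof -
  obtain p q where "ev q x \<noteq> 0" "z = ev p x / ev q x" using ratfun_quotient assms(3) .
  then show ?thesis by (simp add: derivation_divide[OF D] derivation_ev[OF D] assms(2))
qed

end

text \<open>A derivation is determined by its value at x, so a differential is determined by its
  value at one derivation D0 with D0 x = y, if that exists. For a regular differential this value
  has no poles and is constant.\<close>

lemma genus_le_one_biquadratic:
  fixes C :: "('k::field, 'f::field) curve"
  assumes emb: "is_field_hom (emb C)" and x: "x \<notin> range (emb C)"
    and y: "y ^ 2 = const_field.ev (emb C) ([:b, 0, 1:] * [:- 1, 0, c:]) x"
    and b: "b \<noteq> 0" and bc: "1 + b * c \<noteq> 0"
    and gen: "\<And>z. \<exists>p\<in>field_adjoin (range (emb C)) {x}. \<exists>q\<in>field_adjoin (range (emb C)) {x}. z = p + q * y"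
    and two: "(2 :: 'f) \<noteq> 0"
  shows "genus C \<le> 1"
proof -
  interpret const_field "emb C" by standard (rule emb)
  interpret vector_space "\<lambda>a (\<omega> :: ('f \<Rightarrow> 'f) \<Rightarrow> 'f) D. emb C a * \<omega> D"
    by standard (auto simp: algebra_simps)
  have der: "derivations C = {D. derivation D}" unfolding derivations_def derivation_def by blast
  have pl: "places C = {R. place R}" unfolding places_def place_def by blast
  have y0: "y \<noteq> 0"
  proof
    assume "y = 0"
    then have "ev ([:b, 0, 1:] * [:- 1, 0, c:]) x = 0" using y by simp
    then have "[:b, 0, 1:] * [:- 1, 0, c:] = 0" using ev_eq_0_iff[OF x] by blast
    then show False by (metis mult_eq_0_iff pCons_eq_0_iff zero_neq_one neg_equal_0_iff_equal)
  qed
  have unique: "D z = D x / y * D' z" if D: "derivation D" "derivation D'" "D' x = y" for D D' z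
  proof -
    define d where "d = D x / y"
    define \<delta> where "\<delta> z = D z - d * D' z" for z
    have \<delta>: "derivation \<delta>"
      using D(1,2) unfolding derivation_def \<delta>_def by (auto simp: algebra_simps)
    have \<delta>x: "\<delta> x = 0" using y0 D by (simp add: \<delta>_def d_def)
    have "\<delta> (y * y) = 0"
      unfolding power2_eq_square[symmetric] y derivation_ev[OF \<delta>] \<delta>x by simp
    then have "2 * (y * \<delta> y) = 0" by (simp add: derivation_mult[OF \<delta>] mult.commute)
    then have "\<delta> y = 0" using two y0 by simp
    moreover obtain p q where "p \<in> ratfun x" "q \<in> ratfun x" "z = p + q * y" using gen by blast
    ultimately have "\<delta> z = 0"
      using derivation_ratfun_zero[OF \<delta> \<delta>x] by (simp add: derivation_add[OF \<delta>] derivation_mult[OF \<delta>])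
    then show ?thesis by (simp add: \<delta>_def d_def)
  qed
  \<comment> \<open>The differential dx / y, whose value at a derivation D0 with D0 x = y is
    1.\<close>
  define \<omega>0 where "\<omega>0 = (\<lambda>D. if D \<in> derivations C then D x / y else 0)"
  have "regular_differentials C \<subseteq> span {\<omega>0}"
  proof
    fix \<omega> assume \<omega>: "\<omega> \<in> regular_differentials C"
    have scale: "\<omega> (\<lambda>f. h * D f) = h * \<omega> D" if "derivation D" for h D
      using \<omega> that unfolding regular_differentials_def differentials_def der by blast
    have out: "\<omega> D = 0" if "\<not> derivation D" for D
      using \<omega> that unfolding regular_differentials_def differentials_def der by blast
    have "\<exists>a. \<omega> = (\<lambda>D. emb C a * \<omega>0 D)"
    proof (cases "\<exists>D1. derivation D1 \<and> D1 x \<noteq> 0")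
      case True
      then obtain D1 where D1: "derivation D1" "D1 x \<noteq> 0" by blast
      define D0 where "D0 z = y / D1 x * D1 z" for z
      have D0: "derivation D0" "D0 x = y"
        using D1 unfolding D0_def derivation_def by (auto simp: algebra_simps)
      \<comment> \<open>At each place \<omega> = g dt with g and t in \<open>R\<close>, and D0
        preserves \<open>R\<close>, so g D0(t) lies in \<open>R\<close>.\<close>
      have "\<omega> D0 \<in> range (emb C)"
      proof (rule const_if_in_all_places)
        fix R assume R: "place R"
        then obtain t g where t: "uniformizer R t" "g \<in> R" "\<omega> = (\<lambda>D. g * exterior_d C t D)"
          using \<omega> unfolding regular_differentials_def pl by blast
        have "t * 1 \<in> max_ideal R"
          using t(1) subring_one[OF place_subring[OF R]] unfolding uniformizer_def by blast
        then have "D0 t \<in> R"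
          using derivation_stable_biquadratic[OF x y b bc gen two D0 R] by (simp add: max_ideal_iff)
        then show "\<omega> D0 \<in> R"
          using t D0 subring_mult[OF place_subring[OF R]] by (simp add: exterior_d_def der)
      qed
      then obtain a where a: "\<omega> D0 = emb C a" by blast
      have "\<omega> D = emb C a * \<omega>0 D" for D
      proof (cases "derivation D")
        case True
        have "D = (\<lambda>z. D x / y * D0 z)" using unique[OF True D0] by blast
        then have "\<omega> D = D x / y * \<omega> D0" using scale[OF D0(1), of "D x / y"] by argo
        then show ?thesis using True a by (simp add: \<omega>0_def der)
      qed (simp add: out \<omega>0_def der)
      then show ?thesis by blast
    next
      \<comment> \<open>A derivation that kills x kills y, as 2 y D y = 0, and then everything. So
        all derivations vanish here, and with them \<omega>.\<close>
      case False
      have "\<omega> D = emb C 0 * \<omega>0 D" for D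
      proof (cases "derivation D")
        case True
        then have "D x = 0" using False by blast
        have "D (y * y) = 0"
          unfolding power2_eq_square[symmetric] y derivation_ev[OF True] \<open>D x = 0\<close> by simp
        then have "2 * (y * D y) = 0" by (simp add: derivation_mult[OF True] mult.commute)
        then have "D y = 0" using two y0 by simp
        have "D z = 0" for z
        proof -
          obtain p q where "p \<in> ratfun x" "q \<in> ratfun x" "z = p + q * y" using gen by blast
          then show ?thesis
            using derivation_ratfun_zero[OF True \<open>D x = 0\<close>] \<open>D y = 0\<close>
            by (simp add: derivation_add[OF True] derivation_mult[OF True])
        qed
        then have "D = (\<lambda>z. 0 * D z)" by auto
        then show ?thesis using scale[OF True, of 0] by simp
      qed (simp add: out)
      then show ?thesis by blast
    qed
    then show "\<omega> \<in> span {\<omega>0}" by (auto intro: span_scale span_base)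
  qed
  then have "dim (regular_differentials C) \<le> card {\<omega>0}" by (intro dim_le_card) auto
  then show ?thesis unfolding genus_def by simp
qed

section \<open>Rational function fields\<close>

text \<open>If \<open>w = P(x) / Q(x)\<close> in lowest terms and \<open>x = A(w) / B(w)\<close>, then clearing denominators in
  \<open>A(w) = x B(w)\<close> gives a sum \<open>\<Sum> c\<^sub>i P\<^sup>i Q\<^sup>n\<^sup>-\<^sup>i = 0\<close> with \<open>c\<^sub>i\<close> of degree at most one; its extreme
  terms force \<open>Q\<close> and \<open>P\<close> to divide some nonzero \<open>c\<^sub>i\<close>.\<close>

lemma coprime_homogeneous_relation:
  fixes P Q :: "'a::ring_gcd" and c :: "nat \<Rightarrow> 'a"
  assumes "coprime P Q" and PQ: "P \<noteq> 0" "Q \<noteq> 0" and sum: "(\<Sum>i\<le>n. c i * P ^ i * Q ^ (n - i)) = 0"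
    and c: "i \<le> n" "c i \<noteq> 0"
  shows "\<exists>j. c j \<noteq> 0 \<and> Q dvd c j" "\<exists>j. c j \<noteq> 0 \<and> P dvd c j"
proof -
  define J where "J = {i. i \<le> n \<and> c i \<noteq> 0}"
  have J: "finite J" "J \<noteq> {}" using c unfolding J_def by auto
  have split: "c j * P ^ j * Q ^ (n - j) = - (\<Sum>i\<in>J - {j}. c i * P ^ i * Q ^ (n - i))" if "j \<in> J" for j
  proof -
    have "(\<Sum>i\<in>J. c i * P ^ i * Q ^ (n - i)) = (\<Sum>i\<le>n. c i * P ^ i * Q ^ (n - i))"
      by (rule sum.mono_neutral_left) (auto simp: J_def)
    also note sum
    finally show ?thesis using J that by (simp add: sum.remove eq_neg_iff_add_eq_0)
  qed
  define h where "h = Max J"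
  have h: "h \<in> J" "\<And>i. i \<in> J \<Longrightarrow> i \<le> h" using J by (auto simp: h_def)
  have "Q * Q ^ (n - h) dvd (\<Sum>i\<in>J - {h}. c i * P ^ i * Q ^ (n - i))"
  proof (rule dvd_sum)
    fix i assume "i \<in> J - {h}"
    then have "i < h" "h \<le> n" using h by (auto simp: J_def le_less)
    then have "Suc (n - h) \<le> n - i" by simp
    then show "Q * Q ^ (n - h) dvd c i * P ^ i * Q ^ (n - i)"
      by (metis dvd_mult le_imp_power_dvd power_Suc)
  qed
  then have "Q * Q ^ (n - h) dvd c h * P ^ h * Q ^ (n - h)" using split[OF h(1)] by simp
  then have "Q dvd c h * P ^ h"
    using dvd_times_right_cancel_iff[of "Q ^ (n - h)" Q "c h * P ^ h"] PQ by simp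
  moreover have "coprime Q (P ^ h)" using assms(1) by (simp add: coprime_commute)
  ultimately have "Q dvd c h" by (simp add: coprime_dvd_mult_left_iff)
  then show "\<exists>j. c j \<noteq> 0 \<and> Q dvd c j" using h(1) J_def by blast
  define l where "l = Min J"
  have l: "l \<in> J" "\<And>i. i \<in> J \<Longrightarrow> l \<le> i" using J by (auto simp: l_def)
  have "P * P ^ l dvd (\<Sum>i\<in>J - {l}. c i * P ^ i * Q ^ (n - i))"
  proof (rule dvd_sum)
    fix i assume "i \<in> J - {l}"
    then have "Suc l \<le> i" using l by (fastforce simp: le_less)
    then show "P * P ^ l dvd c i * P ^ i * Q ^ (n - i)"
      by (metis dvd_mult dvd_mult2 le_imp_power_dvd power_Suc)
  qed
  then have "P * P ^ l dvd c l * P ^ l * Q ^ (n - l)" using split[OF l(1)] by simp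
  then have "P ^ l * P dvd P ^ l * (c l * Q ^ (n - l))" by (simp add: ac_simps)
  then have "P dvd c l * Q ^ (n - l)" using PQ by simp
  moreover have "coprime P (Q ^ (n - l))" using assms(1) by simp
  ultimately have "P dvd c l" by (simp add: coprime_dvd_mult_left_iff)
  then show "\<exists>j. c j \<noteq> 0 \<and> P dvd c j" using l(1) J_def by blast
qed

context const_field
begin

lemma ev_sum: "ev (\<Sum>i\<in>A. f i) x = (\<Sum>i\<in>A. ev (f i) x)"
  by (induction A rule: infinite_finite_induct) auto

lemma ev_altdef: "degree p \<le> n \<Longrightarrow> ev p x = (\<Sum>i\<le>n. e (coeff p i) * x ^ i)"
proof -
  assume "degree p \<le> n"
  then have "(\<Sum>i\<le>n. e (coeff p i) * x ^ i) = (\<Sum>i\<le>degree p. e (coeff p i) * x ^ i)"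
    by (intro sum.mono_neutral_right) (auto simp: coeff_eq_0)
  then show ?thesis unfolding ev_def poly_altdef
    by (simp add: coeff_map_poly degree_map_poly)
qed

lemma ratfun_const: "ratfun (e a) = range e"
  using field_adjoin_minimal[OF subfield_range[OF hom], of "range e" "{e a}"]
    field_adjoin_contains(1)[of "range e"] by blast

lemma ev_linear: "degree p \<le> 1 \<Longrightarrow> \<exists>a b. ev p x = e a * x + e b"
  using ev_altdef[of p 1 x] by (auto simp: algebra_simps)

text \<open>The coefficients of the relation A(w) - x B(w) = 0 are linear in x. Numerator and
  denominator of w each divide a nonzero one of them, hence have degree at most one.\<close>

lemma moebius_of_mutual_generators:
  assumes x: "x \<notin> range e" and w: "w \<in> ratfun x" and xw: "x \<in> ratfun w"
  shows "\<exists>a b c d. w * (e c * x + e d) = e a * x + e b \<and> e c * x + e d \<noteq> 0"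
proof -
  obtain P0 Q0 where PQ0: "ev Q0 x \<noteq> 0" "w = ev P0 x / ev Q0 x" using ratfun_quotient[OF w] .
  obtain A B where AB: "ev B w \<noteq> 0" "x = ev A w / ev B w" using ratfun_quotient[OF xw] .
  define g where "g = gcd P0 Q0"
  have "g \<noteq> 0" using PQ0 by (auto simp: g_def)
  then obtain P Q where PQ: "P0 = P * g" "Q0 = Q * g" "coprime P Q"
    using gcd_coprime_exists[of P0 Q0] unfolding g_def by blast
  have gx: "ev g x \<noteq> 0" using \<open>g \<noteq> 0\<close> ev_eq_0_iff x by blast
  have Qx: "ev Q x \<noteq> 0" using PQ0 PQ by auto
  have w': "w = ev P x / ev Q x" using PQ0 PQ gx by simp
  have wc: "w \<notin> range e" using xw x ratfun_const by auto
  have "Q \<noteq> 0" using Qx by auto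
  have "P \<noteq> 0"
  proof
    assume "P = 0"
    then have "w = e 0" using w' by simp
    then show False using wc by blast
  qed
  define n where "n = max (degree A) (degree B)"
  \<comment> \<open>The coefficient of w^i in A(w) - x B(w), as a polynomial in x. Since
    \<open>B\<close> is nonzero, not all of them vanish.\<close>
  define c where "c i = [:coeff A i, - coeff B i:]" for i
  have cx: "ev (c i) x = e (coeff A i) - x * e (coeff B i)" for i by (simp add: c_def)
  have "(\<Sum>i\<le>n. ev (c i) x * w ^ i) = ev A w - x * ev B w"
    by (simp add: cx ev_altdef[of A n] ev_altdef[of B n] n_def left_diff_distrib
        sum_subtractf sum_distrib_left mult.assoc)
  also have "\<dots> = 0" using AB by simp
  finally have "0 = (\<Sum>i\<le>n. ev (c i) x * w ^ i) * ev Q x ^ n" by simp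
  also have "\<dots> = (\<Sum>i\<le>n. ev (c i) x * ev P x ^ i * ev Q x ^ (n - i))"
    unfolding sum_distrib_right
    by (intro sum.cong) (auto simp: w' Qx power_divide power_diff)
  also have "\<dots> = ev (\<Sum>i\<le>n. c i * P ^ i * Q ^ (n - i)) x" by (simp add: ev_sum)
  finally have sum: "(\<Sum>i\<le>n. c i * P ^ i * Q ^ (n - i)) = 0" using ev_eq_0_iff[OF x] by metis
  have "B \<noteq> 0" using AB by auto
  then have "c (degree B) \<noteq> 0" by (simp add: c_def)
  then obtain j k where jk: "c j \<noteq> 0" "Q dvd c j" "c k \<noteq> 0" "P dvd c k"
    using coprime_homogeneous_relation[OF PQ(3) \<open>P \<noteq> 0\<close> \<open>Q \<noteq> 0\<close> sum, of "degree B"]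
    unfolding n_def by auto
  have "degree (c i) \<le> 1" for i unfolding c_def by simp
  then have "degree P \<le> 1" "degree Q \<le> 1"
    using jk dvd_imp_degree_le by (meson order.trans)+
  then obtain a b c d where "ev P x = e a * x + e b" "ev Q x = e c * x + e d"
    using ev_linear by metis
  moreover have "w * ev Q x = ev P x" using w' Qx by simp
  ultimately show ?thesis using Qx by metis
qed

lemma hom_ev: "is_field_hom s \<Longrightarrow> (\<And>a. s (e a) = e a) \<Longrightarrow> s (ev p x) = ev p (s x)"
  by (induction p) (auto simp: field_hom_simps)

lemma hom_ratfun:
  assumes s: "is_field_hom s" "\<And>a. s (e a) = e a" and "z \<in> ratfun x"
  shows "s z \<in> ratfun (s x)"
proof -
  obtain p q where "ev q x \<noteq> 0" "z = ev p x / ev q x" using ratfun_quotient assms(3) .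
  then have "s z = ev p (s x) / ev q (s x)" by (simp add: field_hom_divide[OF s(1)] hom_ev[OF s])
  then show ?thesis
    by (auto intro!: subfield_divide ev_in_subfield subfield_field_adjoin)
qed

lemma linear_eq_0: "x \<notin> range e \<Longrightarrow> e a * x + e b = 0 \<Longrightarrow> a = 0 \<and> b = 0"
  using ev_eq_0_iff[of x "[:b, a:]"] by (simp add: algebra_simps)

text \<open>A Moebius involution has two fixed points when 2 is invertible; a coordinate that moves
  them to 0 and infinity turns it into negation.\<close>

lemma diagonal_generator:
  assumes s: "is_field_hom s" "\<And>a. s (e a) = e a" and x: "x \<notin> range e"
    and sx: "s x \<in> ratfun x" "s (s x) = x" "s x \<noteq> x" and two: "(2 :: 'f) \<noteq> 0"
  obtains x' where "ratfun x' = ratfun x" "s x' = - x'"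
proof -
  note hs = field_hom_simps[OF s(1)] s(2)
  have two': "(2 :: 'k alg_closure) \<noteq> 0" using two by (metis e_simps(2) e_simps(12))
  note sub = subfield_field_adjoin[of "range e"]
  define w where "w = s x"
  have sw: "s w = x" using sx w_def by simp
  have "x \<in> ratfun w" using hom_ratfun[OF s sx(1)] by (simp add: w_def sx(2))
  then obtain a b c d where m: "w * (e c * x + e d) = e a * x + e b" "e c * x + e d \<noteq> 0"
    using moebius_of_mutual_generators[OF x, of w] sx(1) w_def by blast
  show thesis
  proof (cases "c = 0")
    \<comment> \<open>Infinity is fixed, so the involution is x \<mapsto> -x + \<beta>, whose other
      fixed point \<beta>/2 is moved to 0.\<close>
    case True
    then have d: "d \<noteq> 0" using m by auto
    define \<alpha> \<beta> where "\<alpha> = a / d" and "\<beta> = b / d"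
    have w: "w = e \<alpha> * x + e \<beta>" using m True d unfolding \<alpha>_def \<beta>_def by (simp add: field_simps)
    have "x = e \<alpha> * w + e \<beta>" using arg_cong[OF w, of s] by (simp add: hs sw flip: w_def)
    then have "e (\<alpha> * \<alpha> - 1) * x + e (\<alpha> * \<beta> + \<beta>) = 0" unfolding w by (simp add: algebra_simps)
    then have ab: "\<alpha> * \<alpha> = 1" "\<alpha> * \<beta> + \<beta> = 0" using linear_eq_0[OF x] by fastforce+
    have "\<alpha> \<noteq> 1"
    proof
      assume "\<alpha> = 1"
      then have "2 * \<beta> = 0" using ab by simp
      then have "\<beta> = 0" using two' by simp
      then show False using w \<open>\<alpha> = 1\<close> sx(3) by (simp add: w_def)
    qed
    then have "\<alpha> = - 1" using ab by (metis square_eq_1_iff)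
    define x' where "x' = x - e (\<beta> / 2)"
    have "x' \<in> ratfun x" unfolding x'_def by (intro subfield_diff[OF sub] const_in_ratfun gen_in_ratfun)
    moreover have "x = x' + e (\<beta> / 2)" by (simp add: x'_def)
    then have "x \<in> ratfun x'" by (metis const_in_ratfun gen_in_ratfun subfield_add[OF sub])
    ultimately have "ratfun x' = ratfun x" using ratfun_subset by blast
    moreover have "s x' = - x + (e \<beta> - e (\<beta> / 2))"
      unfolding x'_def using w \<open>\<alpha> = - 1\<close> by (simp add: hs del: e_simps(10) flip: w_def)
    then have "s x' = - x'"
      using two unfolding x'_def by (simp add: field_simps)
    ultimately show ?thesis using that by blast
  next
    case c: False
    define A B d' where "A = a / c" and "B = b / c" and "d' = d / c"
    have "e (inverse c) * (w * (e c * x + e d)) = e (inverse c) * (e a * x + e b)" using m by simp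
    then have w: "w * (x + e d') = e A * x + e B"
      using c unfolding A_def B_def d'_def by (simp add: field_simps)
    have xw: "x * (w + e d') = e A * w + e B" using arg_cong[OF w, of s] by (simp add: hs sw flip: w_def)
    \<comment> \<open>Subtracting from the relation its image under \<open>s\<close> shows that the
      matrix of the Moebius transformation has trace zero.\<close>
    have "(w - x) * (e d' + e A) = (w * (x + e d') - (e A * x + e B)) - (x * (w + e d') - (e A * w + e B))"
      by (simp add: algebra_simps)
    also have "\<dots> = 0" using w xw by simp
    finally have "(w - x) * (e d' + e A) = 0" .
    then have "e d' = - e A" using sx(3) by (simp add: w_def eq_neg_iff_add_eq_0)
    then have g: "(w - e A) * (x - e A) = e (B + A ^ 2)"
      using w by (simp add: algebra_simps power2_eq_square)
    define u where "u = x - e A"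
    have su: "s u = w - e A" by (simp add: u_def hs w_def)
    have u0: "u \<noteq> 0" using x by (auto simp: u_def)
    \<comment> \<open>In the coordinate u the involution is u \<mapsto> r^2 / u with fixed points r
      and -r, so (u - r) / (u + r) is negated.\<close>
    obtain r where r: "r ^ 2 = B + A ^ 2" using nth_root_exists[of 2] by (metis zero_less_numeral)
    have su': "s u * u = e r ^ 2" unfolding su using g by (simp add: u_def r flip: e_simps(11))
    have ur: "u + e k \<noteq> 0" for k
    proof
      assume "u + e k = 0"
      then have "x = e (A - k)" by (simp add: u_def algebra_simps)
      then show False using x by blast
    qed
    have r0: "r \<noteq> 0"
    proof
      assume "r = 0"
      then have "s u = 0" using su' u0 by simp
      then show False using u0 field_hom_eq_0_iff[OF s(1)] by blast
    qed
    define x' where "x' = (u - e r) / (u + e r)"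
    have "s x' = (s u - e r) / (s u + e r)" by (simp add: x'_def hs)
    also have "\<dots> = (s u - e r) * u / ((s u + e r) * u)" using u0 by simp
    also have "\<dots> = e r * (e r - u) / (e r * (e r + u))"
      using su' by (simp add: left_diff_distrib distrib_right right_diff_distrib distrib_left power2_eq_square)
    also have "\<dots> = (e r - u) / (e r + u)" using r0 by simp
    finally have "s x' = - x'" by (simp add: x'_def add.commute minus_divide_left)
    moreover have "u \<in> ratfun x" unfolding u_def by (intro subfield_diff[OF sub]) auto
    then have "x' \<in> ratfun x"
      unfolding x'_def by (intro subfield_divide[OF sub] subfield_diff[OF sub] subfield_add[OF sub]) auto
    moreover have "x \<in> ratfun x'"
    proof -
      have 1: "1 - x' = 2 * e r / (u + e r)" using ur[of r] unfolding x'_def by (simp add: field_simps)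
      have 2: "1 + x' = 2 * u / (u + e r)" using ur[of r] unfolding x'_def by (simp add: field_simps)
      have "u = e r * (1 + x') / (1 - x')" unfolding 1 2 using ur[of r] r0 two by simp
      also have "\<dots> \<in> ratfun x'"
        by (intro subfield_divide[OF sub] subfield_mult[OF sub] subfield_diff[OF sub] subfield_add[OF sub] subfield_one[OF sub]) auto
      finally have "u \<in> ratfun x'" .
      moreover have "x = u + e A" by (simp add: u_def)
      ultimately show ?thesis using subfield_add[OF sub] by (metis const_in_ratfun)
    qed
    ultimately show ?thesis using that ratfun_subset by blast
  qed
qed

lemma ev_even_odd: "\<exists>q r. ev p x = ev q (x ^ 2) + x * ev r (x ^ 2)"
proof (induction p)
  case 0
  show ?case by (auto intro!: exI[of _ 0])
next
  case (pCons a p)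
  then obtain q r where "ev p x = ev q (x ^ 2) + x * ev r (x ^ 2)" by blast
  then have "ev (pCons a p) x = ev (pCons a r) (x ^ 2) + x * ev q (x ^ 2)"
    by (simp add: algebra_simps power2_eq_square)
  then show ?case by blast
qed

text \<open>Write z (C + x D) = A + x B with A, B, C, D functions of x^2. Combining this with its
  image under \<open>s\<close> separates even and odd parts: z C = A and z D = B, where C and D are
  not both zero.\<close>

lemma even_rational_function:
  assumes s: "is_field_hom s" "\<And>a. s (e a) = e a" and x: "s x = - x" "x \<noteq> 0"
    and z: "z \<in> ratfun x" "s z = z" and two: "(2 :: 'f) \<noteq> 0"
  shows "z \<in> ratfun (x ^ 2)"
proof -
  note hs = field_hom_simps[OF s(1)] s(2)
  obtain p q where pq: "ev q x \<noteq> 0" "z = ev p x / ev q x" using ratfun_quotient z(1) .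
  obtain a b c d where abcd: "ev p x = ev a (x ^ 2) + x * ev b (x ^ 2)" "ev q x = ev c (x ^ 2) + x * ev d (x ^ 2)"
    using ev_even_odd by metis
  define A B C D where "A = ev a (x ^ 2)" and "B = ev b (x ^ 2)" and "C = ev c (x ^ 2)" and "D = ev d (x ^ 2)"
  note defs = this
  have mem: "A \<in> ratfun (x ^ 2)" "B \<in> ratfun (x ^ 2)" "C \<in> ratfun (x ^ 2)" "D \<in> ratfun (x ^ 2)"
    unfolding defs by (auto intro!: ev_in_subfield subfield_field_adjoin)
  have fixed: "s A = A" "s B = B" "s C = C" "s D = D"
    unfolding defs by (simp_all add: hom_ev[OF s] hs x)
  have 1: "z * (C + x * D) = A + x * B" using pq by (simp add: abcd defs)
  have 2: "z * (C - x * D) = A - x * B"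
  proof -
    have "s (z * (C + x * D)) = z * (C - x * D)" "s (A + x * B) = A - x * B"
      by (simp_all add: field_hom_add[OF s(1)] field_hom_mult[OF s(1)] fixed x z(2))
    then show ?thesis using 1 by simp
  qed
  have "2 * (z * C) = 2 * A" using arg_cong2[OF 1 2, of "(+)"] by (simp add: algebra_simps)
  then have zA: "z * C = A" using two by simp
  then have "x * (z * D) = x * B" using 1 by (simp add: algebra_simps)
  then have zB: "z * D = B" using x by simp
  have "C \<noteq> 0 \<or> D \<noteq> 0" using pq abcd defs by auto
  then have "z = A / C \<or> z = B / D" using zA zB by (auto simp: field_simps)
  then show ?thesis using mem subfield_divide[OF subfield_field_adjoin] by blast
qed

end

section \<open>A noncentral hyperelliptic involution\<close>

text \<open>The relation reads x'^2 m = x^2 + b with m = c x^2 - 1. Multiplying by m makes the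
  square of x' m a quartic in x.\<close>

lemma genus_le_one_edwards:
  fixes C :: "('k::field, 'f::field) curve"
  assumes emb: "is_field_hom (emb C)" and x: "x \<notin> range (emb C)"
    and rel: "emb C c * x ^ 2 * x' ^ 2 = x ^ 2 + x' ^ 2 + emb C b"
    and b: "b \<noteq> 0" and bc: "1 + b * c \<noteq> 0"
    and gen: "\<And>z. \<exists>p\<in>field_adjoin (range (emb C)) {x}. \<exists>q\<in>field_adjoin (range (emb C)) {x}. z = p + q * x'"
    and two: "(2 :: 'f) \<noteq> 0"
  shows "genus C \<le> 1"
proof -
  interpret const_field "emb C" by standard (rule emb)
  note sub = subfield_field_adjoin[of "range (emb C)"]
  define m where "m = emb C c * x ^ 2 - 1"
  have "m = ev [:- 1, 0, c:] x" by (simp add: m_def power2_eq_square algebra_simps)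
  moreover have "[:- 1, 0, c:] \<noteq> 0" by simp
  ultimately have m0: "m \<noteq> 0" using ev_eq_0_iff[OF x] by metis
  have mem: "m \<in> ratfun x"
    unfolding m_def by (intro subfield_diff[OF sub] subfield_mult[OF sub] subfield_power[OF sub] subfield_one[OF sub]) auto
  have "x' ^ 2 * m = x ^ 2 + emb C b" using rel by (simp add: m_def algebra_simps)
  then have "(x' * m) ^ 2 = (x ^ 2 + emb C b) * m" by (simp add: power2_eq_square ac_simps)
  also have "\<dots> = ev ([:b, 0, 1:] * [:- 1, 0, c:]) x"
    by (simp add: m_def power2_eq_square algebra_simps)
  finally have y: "(x' * m) ^ 2 = ev ([:b, 0, 1:] * [:- 1, 0, c:]) x" .
  show ?thesis
  proof (rule genus_le_one_biquadratic[OF emb x y b bc _ two])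
    fix z
    obtain p q where "p \<in> ratfun x" "q \<in> ratfun x" "z = p + q * x'" using gen by blast
    then have "z = p + (q / m) * (x' * m)" "p \<in> ratfun x" "q / m \<in> ratfun x"
      using m0 mem subfield_divide[OF sub] by auto
    then show "\<exists>p\<in>ratfun x. \<exists>q\<in>ratfun x. z = p + q * (x' * m)" by blast
  qed
qed

lemma genus_le_one_noncentral_involution:
  fixes C :: "('k::field, 'f::field) curve" and V \<iota> :: "'f \<Rightarrow> 'f"
  assumes emb: "is_field_hom (emb C)" and two: "(2 :: 'f) \<noteq> 0"
    and V: "is_field_hom V" "\<And>a. V (emb C a) = emb C a"
    and \<iota>: "is_field_hom \<iota>" "\<And>a. \<iota> (emb C a) = emb C a"
    and \<iota>\<iota>: "\<And>f. \<iota> (\<iota> f) = f" and V4: "\<And>f. V (V (V (V f))) = f"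
    and \<iota>V: "\<And>f. \<iota> (V f) = V (\<iota> (V (V f)))"
    and neq: "\<iota> \<noteq> id" "V \<circ> V \<noteq> id" "V \<circ> V \<noteq> \<iota>"
    and x0: "x0 \<notin> range (emb C)" and Fix: "{f. \<iota> f = f} = field_adjoin (range (emb C)) {x0}"
  shows "genus C \<le> 1"
proof -
  interpret const_field "emb C" by standard (rule emb)
  note sub = subfield_field_adjoin[of "range (emb C)"]
  note hV = field_hom_add[OF V(1)] field_hom_mult[OF V(1)] field_hom_uminus[OF V(1)]
    field_hom_diff[OF V(1)] field_hom_divide[OF V(1)] field_hom_power[OF V(1)] V(2)
  note h\<iota> = field_hom_add[OF \<iota>(1)] field_hom_mult[OF \<iota>(1)] field_hom_uminus[OF \<iota>(1)]
    field_hom_diff[OF \<iota>(1)] field_hom_divide[OF \<iota>(1)] field_hom_power[OF \<iota>(1)] \<iota>(2)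
  define s where "s = V \<circ> V"
  have s: "is_field_hom s" "\<And>a. s (emb C a) = emb C a"
    unfolding s_def using field_hom_comp[OF V(1) V(1)] V(2) by auto
  note hs = field_hom_add[OF s(1)] field_hom_mult[OF s(1)] field_hom_power[OF s(1)]
  have ss: "s (s f) = f" and Vs: "V (V f) = s f" for f by (simp_all add: s_def V4)
  have \<iota>s: "\<iota> (s f) = s (\<iota> f)" for f unfolding s_def by (simp add: \<iota>V V4)
  have no_neg: "f = 0" if "f = - f" for f :: 'f
  proof -
    have "2 * f = 0" using that by (simp add: eq_neg_iff_add_eq_0)
    then show ?thesis using two by simp
  qed
  have decomp: "\<exists>p\<in>{f. \<iota> f = f}. \<exists>q\<in>{f. \<iota> f = f}. z = p + q * y" if y: "\<iota> y = - y" "y \<noteq> 0" for y z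
  proof -
    have mem: "(z + \<iota> z) / 2 \<in> {f. \<iota> f = f}" "(z - \<iota> z) / (2 * y) \<in> {f. \<iota> f = f}"
      by (simp_all add: h\<iota> \<iota>\<iota> y field_hom_two[OF \<iota>(1)] add.commute minus_divide_left)
    have "(z - \<iota> z) / (2 * y) * y = (z - \<iota> z) / 2" using y by simp
    moreover have "(z + \<iota> z) / 2 + (z - \<iota> z) / 2 = (2 * z) / 2"
      by (simp flip: add_divide_distrib)
    ultimately have "z = (z + \<iota> z) / 2 + (z - \<iota> z) / (2 * y) * y" using two y by simp
    then show ?thesis using mem by blast
  qed
  obtain f0 where f0: "\<iota> f0 \<noteq> f0" using neq(1) by (metis eq_id_iff)
  define \<eta> where "\<eta> = f0 - \<iota> f0"
  have \<eta>: "\<iota> \<eta> = - \<eta>" "\<eta> \<noteq> 0" using f0 by (simp_all add: \<eta>_def h\<iota> \<iota>\<iota>)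
  have x0F: "\<iota> x0 = x0" using Fix gen_in_ratfun[of x0] by blast
  have sx0: "s x0 \<in> ratfun x0" unfolding Fix[symmetric] using x0F by (simp add: \<iota>s)
  have "s x0 \<noteq> x0"
  proof
    \<comment> \<open>Then \<open>s\<close> is the identity on the fixed field of
      \<open>\<iota>\<close>, over which \<open>kbar(C)\<close> is quadratic with generator
      \<open>\<eta>\<close>. So \<open>s\<close> is the identity or \<open>\<iota>\<close>, and both
      are excluded.\<close>
    assume sx: "s x0 = x0"
    have fixed: "s p = p" if p: "p \<in> ratfun x0" for p
    proof -
      obtain P Q where "p = ev P x0 / ev Q x0" using ratfun_quotient[OF p] by blast
      then show ?thesis by (simp add: field_hom_divide[OF s(1)] hom_ev[OF s] sx)
    qed
    then have fixed': "s p = p" if "\<iota> p = p" for p using Fix that by blast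
    have "\<eta> ^ 2 \<in> ratfun x0" unfolding Fix[symmetric] by (simp add: h\<iota> \<eta>)
    then have "(s \<eta>) ^ 2 = \<eta> ^ 2" using fixed hs by metis
    then consider "s \<eta> = \<eta>" | "s \<eta> = - \<eta>" using power2_eq_iff by blast
    then show False
    proof cases
      case 1
      have "s z = z" for z
      proof -
        obtain p q where "\<iota> p = p" "\<iota> q = q" "z = p + q * \<eta>" using decomp[OF \<eta>] by blast
        then show ?thesis using fixed' 1 by (simp add: hs)
      qed
      then show False using neq(2) unfolding s_def by (metis eq_id_iff)
    next
      case 2
      have "s z = \<iota> z" for z
      proof -
        obtain p q where "\<iota> p = p" "\<iota> q = q" "z = p + q * \<eta>" using decomp[OF \<eta>] by blast
        then show ?thesis using fixed' 2 \<eta> by (simp add: hs h\<iota>)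
      qed
      then show False using neq(3) unfolding s_def by blast
    qed
  qed
  then obtain x where xx0: "ratfun x = ratfun x0" and sx: "s x = - x"
    using diagonal_generator[OF s x0 sx0 ss _ two] by blast
  have Fx: "{f. \<iota> f = f} = ratfun x" using Fix xx0 by simp
  have x: "x \<notin> range (emb C)"
    using x0 gen_in_ratfun[of x0] unfolding xx0[symmetric] by (auto simp: ratfun_const)
  then have xn0: "x \<noteq> 0" by (metis e_simps(2) rangeI)
  have \<iota>x: "\<iota> x = x" using Fx gen_in_ratfun[of x] by blast
  define x' where "x' = V x"
  have Vx': "V x' = - x" by (simp add: x'_def Vs sx)
  \<comment> \<open>From \<iota> V = V \<iota> s and s x = -x. As an element negated by
    \<open>\<iota>\<close>, x' generates \<open>kbar(C)\<close> over the fixed field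
    kbar(x).\<close>
  have \<iota>x': "\<iota> x' = - x'" by (simp add: x'_def \<iota>V Vs sx h\<iota> \<iota>x hV)
  have x'0: "x' \<noteq> 0" using xn0 by (simp add: x'_def field_hom_eq_0_iff[OF V(1)])
  have sx': "s x' = - x'" by (simp add: s_def Vx' hV flip: x'_def)
  \<comment> \<open>Both hold because \<open>\<iota>\<close> fixes x and negates x'. They exclude
    the degenerate relations w' = w, w' = -w and w w' constant, which would make x'/x or x x'
    constant.\<close>
  have indep: "x' \<noteq> emb C a * x" "x * x' \<noteq> emb C a" for a
  proof -
    show "x' \<noteq> emb C a * x"
    proof
      assume "x' = emb C a * x"
      then have "\<iota> x' = x'" by (simp add: h\<iota> \<iota>x)
      then show False using \<iota>x' no_neg x'0 by metis
    qed
    show "x * x' \<noteq> emb C a"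
    proof
      assume *: "x * x' = emb C a"
      have "\<iota> (x * x') = - (x * x')" by (simp add: h\<iota> \<iota>x \<iota>x')
      then have "x * x' = - (x * x')" unfolding * by (simp add: \<iota>)
      then show False using no_neg[of "x * x'"] xn0 x'0 by simp
    qed
  qed
  define w where "w = x ^ 2"
  define w' where "w' = x' ^ 2"
  have Vw: "V w = w'" "V w' = w" by (simp_all add: w_def w'_def hV Vx' flip: x'_def)
  have wc: "w \<notin> range (emb C)"
  proof
    assume "w \<in> range (emb C)"
    then obtain a where "ev [:- a, 0, 1:] x = 0" by (auto simp: w_def power2_eq_square)
    then show False using ev_eq_0_iff[OF x] by (metis pCons_eq_0_iff zero_neq_one)
  qed
  \<comment> \<open>w' is fixed by \<open>\<iota>\<close> and by \<open>s\<close>, so it is an even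
    function of x. The opposite inclusion follows because V exchanges w and w'.\<close>
  have "w' \<in> ratfun w"
    unfolding w_def
  proof (rule even_rational_function[OF s sx xn0 _ _ two])
    show "w' \<in> ratfun x" unfolding Fx[symmetric] w'_def by (simp add: h\<iota> \<iota>x')
    show "s w' = w'" by (simp add: w'_def hs sx')
  qed
  moreover from hom_ratfun[OF V this] have "w \<in> ratfun w'" by (simp add: Vw)
  ultimately obtain a b c d where m: "w' * (emb C c * w + emb C d) = emb C a * w + emb C b"
    "emb C c * w + emb C d \<noteq> 0"
    using moebius_of_mutual_generators[OF wc] by blast
  \<comment> \<open>V exchanges w and w'; comparing the relation with its image makes the Moebius
    matrix traceless, so the relation becomes symmetric.\<close>
  have m': "w * (emb C c * w' + emb C d) = emb C a * w' + emb C b"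
    using arg_cong[OF m(1), of V] by (simp add: hV Vw)
  have "(w' - w) * (emb C d + emb C a)
      = (w' * (emb C c * w + emb C d) - (emb C a * w + emb C b)) - (w * (emb C c * w' + emb C d) - (emb C a * w' + emb C b))"
    by (simp add: algebra_simps)
  also have "\<dots> = 0" using m m' by simp
  finally have "(w' - w) * (emb C d + emb C a) = 0" .
  moreover have "w' \<noteq> w"
  proof
    assume "w' = w"
    then have "x' = x \<or> x' = - x" unfolding w_def w'_def using power2_eq_iff by blast
    then show False using indep(1)[of 1] indep(1)[of "- 1"] by auto
  qed
  ultimately have "emb C d = - emb C a" by (simp add: eq_neg_iff_add_eq_0)
  then have m: "emb C c * (w * w') = emb C a * (w + w') + emb C b" "emb C c * w - emb C a \<noteq> 0"
    using m by (simp_all add: algebra_simps)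
  have a: "a \<noteq> 0"
  proof
    assume "a = 0"
    then have c: "c \<noteq> 0" and "emb C c * (w * w') = emb C b" using m by auto
    then have "w * w' = emb C (b / c)" by (simp add: field_simps)
    moreover obtain r where "r ^ 2 = b / c" using nth_root_exists[of 2] by (metis zero_less_numeral)
    ultimately have "(x * x') ^ 2 = (emb C r) ^ 2"
      by (simp add: w_def w'_def power_mult_distrib flip: e_simps(11))
    then have "x * x' = emb C r \<or> x * x' = emb C (- r)" using power2_eq_iff by fastforce
    then show False using indep(2) by blast
  qed
  define b' c' where "b' = b / a" and "c' = c / a"
  have rel: "emb C c' * w * w' = w + w' + emb C b'"
    using m(1) a unfolding b'_def c'_def by (simp add: field_simps)
  \<comment> \<open>If 1 + b' c' vanished, the relation would factor as (w + b') (w' + b') =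
    0.\<close>
  have bc: "1 + b' * c' \<noteq> 0"
  proof
    assume *: "1 + b' * c' = 0"
    have "(w + emb C b') * (w' + emb C b') = w * w' + emb C b' * (w + w' + emb C b')"
      by (simp add: algebra_simps)
    also have "\<dots> = emb C (1 + b' * c') * (w * w')" unfolding rel[symmetric] by (simp add: algebra_simps)
    also have "\<dots> = 0" unfolding * by simp
    finally have "w = emb C (- b') \<or> w' = emb C (- b')" by (auto simp: eq_neg_iff_add_eq_0)
    then have "w = emb C (- b')" using Vw(2) V(2)[of "- b'"] by metis
    then show False using wc by blast
  qed
  have bc0: "b' \<noteq> 0 \<or> c' \<noteq> 0"
  proof (rule ccontr)
    assume "\<not> (b' \<noteq> 0 \<or> c' \<noteq> 0)"
    then have "w' = - w" using rel by (simp add: eq_neg_iff_add_eq_0 add.commute)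
    moreover obtain i :: "'k alg_closure" where i: "i ^ 2 = - 1"
      using nth_root_exists[of 2] by (metis zero_less_numeral)
    ultimately have "x' ^ 2 = (emb C i * x) ^ 2"
      by (simp add: w_def w'_def power_mult_distrib flip: e_simps(11))
    then have "x' = emb C i * x \<or> x' = emb C (- i) * x" using power2_eq_iff by fastforce
    then show False using indep(1) by blast
  qed
  have gen: "\<exists>p\<in>ratfun x. \<exists>q\<in>ratfun x. z = p + q * y" if "\<iota> y = - y" "y \<noteq> 0" for y z
    using decomp[OF that] unfolding Fx .
  show ?thesis
  proof (cases "b' = 0")
    case False
    show ?thesis
      by (rule genus_le_one_edwards[OF emb x _ False bc gen two, of x'])
        (use rel \<iota>x' x'0 in \<open>auto simp: w_def w'_def\<close>)
  next
    case True
    then have c: "c' \<noteq> 0" using bc0 by simp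
    \<comment> \<open>Inverting x and x' replaces the parameters (b', c') by (-c', -b'), which makes
      the constant term nonzero.\<close>
    define u u' where "u = inverse x" and "u' = inverse x'"
    have "u \<in> ratfun x" unfolding u_def using subfield_inverse[OF sub] by simp
    moreover have "x = inverse u" by (simp add: u_def)
    then have "x \<in> ratfun u" using subfield_inverse[OF sub] gen_in_ratfun by metis
    ultimately have ru: "ratfun u = ratfun x" using ratfun_subset by blast
    have u: "u \<notin> range (emb C)" unfolding u_def by (rule inverse_not_const[OF x])
    have "emb C c' * (w * w') = w + w'" using rel True by (simp add: mult.assoc)
    then have "emb C c' = (w + w') / (w * w')"
      using xn0 x'0 by (simp add: w_def w'_def field_simps)
    also have "\<dots> = u ^ 2 + u' ^ 2"
      using xn0 x'0 by (simp add: w_def w'_def u_def u'_def field_simps)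
    finally have "emb C 0 * u ^ 2 * u' ^ 2 = u ^ 2 + u' ^ 2 + emb C (- c')" by simp
    then show ?thesis
    proof (rule genus_le_one_edwards[OF emb u _ _ _ _ two])
      show "- c' \<noteq> 0" "1 + (- c') * 0 \<noteq> 0" using c by auto
      have "\<iota> u' = - u'" unfolding u'_def by (simp add: field_hom_inverse[OF \<iota>(1)] \<iota>x')
      then show "\<exists>p\<in>ratfun u. \<exists>q\<in>ratfun u. z = p + q * u'" for z
        unfolding ru using gen x'0 by (simp add: u'_def)
    qed
  qed
qed

section \<open>The Galois action on function fields\<close>

lemma Gal_hom: "\<sigma> \<in> Gal \<Longrightarrow> is_field_hom \<sigma>"
  and Gal_bij: "\<sigma> \<in> Gal \<Longrightarrow> bij \<sigma>"
  and Gal_to_ac: "\<sigma> \<in> Gal \<Longrightarrow> \<sigma> (to_ac c) = to_ac c"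
  by (auto simp: Gal_def)

lemma id_Gal: "id \<in> Gal"
  by (simp add: Gal_def field_hom_id)

lemma comp_Gal: "\<sigma> \<in> Gal \<Longrightarrow> \<tau> \<in> Gal \<Longrightarrow> \<sigma> \<circ> \<tau> \<in> Gal"
  by (auto simp: Gal_def field_hom_comp bij_comp)

lemma inv_Gal:
  assumes "\<sigma> \<in> Gal" shows "inv_into UNIV \<sigma> \<in> Gal"
  unfolding Gal_def
proof (intro CollectI conjI allI)
  show "is_field_hom (inv_into UNIV \<sigma>)" "bij (inv_into UNIV \<sigma>)"
    using field_hom_inv bij_imp_bij_inv Gal_hom Gal_bij assms by blast+
  show "inv_into UNIV \<sigma> (to_ac c) = to_ac c" for c
    by (rule inv_f_eq[OF bij_is_inj[OF Gal_bij[OF assms]] Gal_to_ac[OF assms]])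
qed

lemma Gal_inv_comp:
  assumes "\<sigma> \<in> Gal"
  shows "\<sigma> \<circ> inv_into UNIV \<sigma> = id" "inv_into UNIV \<sigma> \<circ> \<sigma> = id"
  using surj_iff[THEN iffD1, OF bij_is_surj[OF Gal_bij[OF assms]]]
    inj_iff[THEN iffD1, OF bij_is_inj[OF Gal_bij[OF assms]]] by simp_all

lemma curve_emb: "is_curve C \<Longrightarrow> is_field_hom (emb C)"
  and curve_kfun: "is_curve C \<Longrightarrow> is_subfield (kfun C)"
  and curve_span: "is_curve C \<Longrightarrow> module.span (\<lambda>a f. emb C a * f) (kfun C) = UNIV"
  by (auto simp: is_curve_def)

lemma vector_space_emb:
  assumes "is_field_hom h" shows "vector_space (\<lambda>a f. h a * (f :: 'f::field))"
  using field_hom_simps[OF assms] by unfold_locales (auto simp: algebra_simps)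

text \<open>k(C) spans \<open>kbar(C)\<close> over \<open>kbar\<close>. Uniqueness and
  multiplicativity of the Galois action reduce to k(C) in this way.\<close>

lemma semilinear_eqI:
  fixes C :: "('k::field, 'f::field) curve" and p q :: "'f \<Rightarrow> 'g::field"
  assumes C: "is_curve C"
    and p: "\<And>f g. p (f + g) = p f + p g" "\<And>a f. p (emb C a * f) = t a * p f"
    and q: "\<And>f g. q (f + g) = q f + q g" "\<And>a f. q (emb C a * f) = t a * q f"
    and eq: "\<And>f. f \<in> kfun C \<Longrightarrow> p f = q f"
  shows "p = q"
proof
  fix z
  interpret vector_space "\<lambda>a f. emb C a * f" by (rule vector_space_emb[OF curve_emb[OF C]])
  have "z \<in> span (kfun C)" using curve_span[OF C] by simp
  then show "p z = q z"
  proof (induction rule: span_induct_alt)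
    case base
    have "p 0 = 0" "q 0 = 0" by (metis p(1) q(1) add_0 add_cancel_right_right)+
    then show ?case by simp
  next
    case (step c x y)
    then show ?case by (simp add: p q eq)
  qed
qed

text \<open>The property inside the description operator of \<open>gal_fun\<close>, which gets its
  meaning from existence and uniqueness of such an \<open>s\<close>.\<close>

definition gal_lift where
  "gal_lift C \<sigma> s \<longleftrightarrow> is_field_hom s \<and> bij s \<and> (\<forall>a. s (emb C a) = emb C (\<sigma> a)) \<and> (\<forall>f\<in>kfun C. s f = f)"

lemma gal_lift_unique:
  assumes "is_curve C" "gal_lift C \<sigma> s" "gal_lift C \<sigma> t"
  shows "s = t"
  using assms(2,3) unfolding gal_lift_def
  by (intro semilinear_eqI[OF assms(1), of _ "\<lambda>a. emb C (\<sigma> a)"])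
     (auto simp: field_hom_add field_hom_mult)

text \<open>A basis of k(C) over k stays independent over \<open>kbar\<close> by geometric
  integrality, and spans because k(C) does. This is the tensor product decomposition of
  \<open>kbar(C)\<close> in coordinates.\<close>

lemma curve_basis:
  fixes C :: "('k::field, 'f::field) curve"
  assumes C: "is_curve C"
  obtains B where "B \<subseteq> kfun C" "\<not> module.dependent (\<lambda>a f. emb C a * f) B"
    "module.span (\<lambda>a f. emb C a * f) B = UNIV" "kfun C \<subseteq> module.span (\<lambda>c f. emb_k C c * f) B"
proof -
  interpret K: vector_space "\<lambda>a f. emb C a * f" by (rule vector_space_emb[OF curve_emb[OF C]])
  have "is_field_hom (emb_k C)"
    using curve_emb[OF C] by (auto simp: is_field_hom_def emb_k_def)
  then interpret k: vector_space "\<lambda>c f. emb_k C c * f" by (rule vector_space_emb)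
  obtain B where B: "B \<subseteq> kfun C" "k.independent B" "kfun C \<subseteq> k.span B"
    using k.maximal_independent_subset by blast
  have "K.independent B" using C B unfolding is_curve_def by blast
  have "x \<in> K.span B" if "x \<in> k.span B" for x
    using that
  proof (induction rule: k.span_induct_alt)
    case (step c x y)
    then show ?case unfolding emb_k_def by (simp add: K.span_add K.span_scale K.span_base)
  qed (rule K.span_zero)
  then have "K.span (kfun C) \<subseteq> K.span B" using B(3) K.span_minimal[OF _ K.subspace_span] by blast
  then have "K.span B = UNIV" using curve_span[OF C] by auto
  then show thesis using that B \<open>K.independent B\<close> by blast
qed

text \<open>The map fixes a k-basis of k(C) and acts by \<sigma> on coefficients; it is linear once
  \<open>kbar\<close> acts on the target through \<sigma>. Multiplicativity is extended from k(C) to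
  \<open>kbar(C)\<close> in one factor at a time.\<close>

lemma gal_semilinear_exists:
  fixes C :: "('k::field, 'f::field) curve"
  assumes C: "is_curve C" and \<sigma>: "\<sigma> \<in> Gal"
  obtains s where "is_field_hom s" "\<And>a. s (emb C a) = emb C (\<sigma> a)" "\<And>f. f \<in> kfun C \<Longrightarrow> s f = f"
proof -
  note e = curve_emb[OF C]
  have e\<sigma>: "is_field_hom (emb C \<circ> \<sigma>)" using field_hom_comp[OF e Gal_hom[OF \<sigma>]] .
  interpret K: vector_space "\<lambda>a f. emb C a * f" by (rule vector_space_emb[OF e])
  interpret K': vector_space "\<lambda>a f. (emb C \<circ> \<sigma>) a * f" by (rule vector_space_emb[OF e\<sigma>])
  interpret P: vector_space_pair "\<lambda>a f. emb C a * f" "\<lambda>a f. (emb C \<circ> \<sigma>) a * f" ..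
  have "is_field_hom (emb_k C)" using e by (auto simp: is_field_hom_def emb_k_def)
  then interpret k: vector_space "\<lambda>c f. emb_k C c * f" by (rule vector_space_emb)
  obtain B where B: "B \<subseteq> kfun C" "K.independent B" "K.span B = UNIV" "kfun C \<subseteq> k.span B"
    using curve_basis[OF C] by blast
  define s where "s = P.construct B id"
  have "Vector_Spaces.linear (\<lambda>a f. emb C a * f) (\<lambda>a f. (emb C \<circ> \<sigma>) a * f) s"
    unfolding s_def by (rule P.linear_construct[OF B(2)])
  then interpret s: Vector_Spaces.linear "\<lambda>a f. emb C a * f" "\<lambda>a f. (emb C \<circ> \<sigma>) a * f" s .
  have s_add: "s (f + g) = s f + s g" for f g by (rule s.add)
  have s_scale: "s (emb C a * f) = emb C (\<sigma> a) * s f" for a f using s.scale[of a f] by simp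
  have sB: "s b = b" if "b \<in> B" for b unfolding s_def using P.construct_basis[OF B(2) that] by simp
  have sk: "s f = f" if f: "f \<in> kfun C" for f
  proof -
    have "f \<in> k.span B" using B(4) f by blast
    then show ?thesis
    proof (induction rule: k.span_induct_alt)
      case (step c x y)
      then show ?case using s_scale[of "to_ac c" x] sB Gal_to_ac[OF \<sigma>] by (simp add: s_add emb_k_def)
    qed (rule s.zero)
  qed
  have s1: "s 1 = 1" using sk subfield_one[OF curve_kfun[OF C]] by blast
  have mult1: "s (f * g) = s f * g" if "g \<in> kfun C" for f g
  proof -
    have "(\<lambda>f. s (f * g)) = (\<lambda>f. s f * g)"
    proof (rule semilinear_eqI[OF C, of _ "\<lambda>a. emb C (\<sigma> a)"])
      show "s (f * g) = s f * g" if "f \<in> kfun C" for f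
        using sk subfield_mult[OF curve_kfun[OF C]] that \<open>g \<in> kfun C\<close> by simp
    qed (simp_all add: s_add s_scale distrib_right mult.assoc)
    then show ?thesis by meson
  qed
  have mult: "s (f * g) = s f * s g" for f g
  proof -
    have "(\<lambda>g. s (f * g)) = (\<lambda>g. s f * s g)"
    proof (rule semilinear_eqI[OF C, of _ "\<lambda>a. emb C (\<sigma> a)"])
      show "s (f * (emb C a * g)) = emb C (\<sigma> a) * s (f * g)" for a g
        using s_scale[of a "f * g"] by (simp add: mult.left_commute)
      show "s f * s (emb C a * g) = emb C (\<sigma> a) * (s f * s g)" for a g
        by (simp add: s_scale mult.left_commute)
    qed (simp_all add: s_add distrib_left mult1 sk)
    then show ?thesis by meson
  qed
  have "is_field_hom s" unfolding is_field_hom_def using s1 s_add mult by blast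
  moreover have "s (emb C a) = emb C (\<sigma> a)" for a using s_scale[of a 1] s1 by simp
  ultimately show thesis using that sk by blast
qed

lemma gal_lift_exists:
  fixes C :: "('k::field, 'f::field) curve"
  assumes C: "is_curve C" and \<sigma>: "\<sigma> \<in> Gal"
  shows "\<exists>s. gal_lift C \<sigma> s"
proof -
  obtain s where s: "is_field_hom s" "\<And>a. s (emb C a) = emb C (\<sigma> a)" "\<And>f. f \<in> kfun C \<Longrightarrow> s f = f"
    using gal_semilinear_exists[OF C \<sigma>] by blast
  define \<tau> where "\<tau> = inv_into UNIV \<sigma>"
  obtain t where t: "is_field_hom t" "\<And>a. t (emb C a) = emb C (\<tau> a)" "\<And>f. f \<in> kfun C \<Longrightarrow> t f = f"
    using gal_semilinear_exists[OF C inv_Gal[OF \<sigma>]] unfolding \<tau>_def by blast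
  have \<sigma>\<tau>: "\<sigma> (\<tau> a) = a" "\<tau> (\<sigma> a) = a" for a
    using Gal_inv_comp[OF \<sigma>] unfolding \<tau>_def by (metis comp_apply id_apply)+
  have "s \<circ> t = id"
    by (rule semilinear_eqI[OF C, of _ "emb C"])
      (simp_all add: s t \<sigma>\<tau> field_hom_add[OF s(1)] field_hom_add[OF t(1)] field_hom_mult[OF s(1)] field_hom_mult[OF t(1)])
  moreover have "t \<circ> s = id"
    by (rule semilinear_eqI[OF C, of _ "emb C"])
      (simp_all add: s t \<sigma>\<tau> field_hom_add[OF s(1)] field_hom_add[OF t(1)] field_hom_mult[OF s(1)] field_hom_mult[OF t(1)])
  ultimately have "bij s" using o_bij by blast
  then show ?thesis using s unfolding gal_lift_def by blast
qed

lemma gal_fun_lift: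
  fixes C :: "('k::field, 'f::field) curve"
  assumes C: "is_curve C" and \<sigma>: "\<sigma> \<in> Gal"
  shows "gal_lift C \<sigma> (gal_fun C \<sigma>)"
proof -
  have "\<exists>!s. gal_lift C \<sigma> s" using gal_lift_exists[OF C \<sigma>] gal_lift_unique[OF C] by blast
  from theI'[OF this] show ?thesis unfolding gal_fun_def gal_lift_def .
qed

lemma gal_fun_eqI: "is_curve C \<Longrightarrow> \<sigma> \<in> Gal \<Longrightarrow> gal_lift C \<sigma> s \<Longrightarrow> gal_fun C \<sigma> = s"
  using gal_fun_lift gal_lift_unique by blast

context
  fixes C :: "('k::field, 'f::field) curve"
  assumes C: "is_curve C"
begin

lemma gal_fun_hom: "\<sigma> \<in> Gal \<Longrightarrow> is_field_hom (gal_fun C \<sigma>)"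
  and gal_fun_bij: "\<sigma> \<in> Gal \<Longrightarrow> bij (gal_fun C \<sigma>)"
  and gal_fun_emb: "\<sigma> \<in> Gal \<Longrightarrow> gal_fun C \<sigma> (emb C a) = emb C (\<sigma> a)"
  and gal_fun_kfun: "\<sigma> \<in> Gal \<Longrightarrow> f \<in> kfun C \<Longrightarrow> gal_fun C \<sigma> f = f"
  using gal_fun_lift[OF C] by (auto simp: gal_lift_def)

lemma gal_fun_comp:
  assumes "\<sigma> \<in> Gal" "\<tau> \<in> Gal"
  shows "gal_fun C (\<sigma> \<circ> \<tau>) = gal_fun C \<sigma> \<circ> gal_fun C \<tau>"
  using assms
  by (intro gal_fun_eqI[OF C comp_Gal])
     (auto simp: gal_lift_def field_hom_comp gal_fun_hom gal_fun_bij bij_comp gal_fun_emb gal_fun_kfun)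

lemma gal_fun_id: "gal_fun C id = id"
  by (intro gal_fun_eqI[OF C id_Gal]) (auto simp: gal_lift_def field_hom_id)

text \<open>\<open>S\<close> consists of the coefficients of \<open>z\<close> in a basis of \<open>k(C)\<close> over \<open>k\<close>.\<close>

lemma gal_fun_coefficients:
  "\<exists>S. finite S \<and> (\<forall>\<sigma>\<in>Gal. \<forall>\<tau>\<in>Gal.
     gal_fun C \<sigma> z = gal_fun C \<tau> z \<longleftrightarrow> (\<forall>a\<in>S. \<sigma> a = \<tau> a))"
proof -
  note e = curve_emb[OF C]
  interpret K: vector_space "\<lambda>a f. emb C a * f" by (rule vector_space_emb[OF e])
  obtain B where B: "B \<subseteq> kfun C" "K.independent B" "K.span B = UNIV"
    by (rule curve_basis[OF C])
  obtain T r where T: "finite T" "T \<subseteq> B" and z: "z = (\<Sum>b\<in>T. emb C (r b) * b)"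
  proof -
    have "z \<in> K.span B" using B(3) by simp
    then show thesis using that unfolding K.span_explicit by blast
  qed
  have act: "gal_fun C \<sigma> z = (\<Sum>b\<in>T. emb C (\<sigma> (r b)) * b)" if \<sigma>: "\<sigma> \<in> Gal" for \<sigma>
  proof -
    have "gal_fun C \<sigma> (\<Sum>b\<in>J. emb C (r b) * b) = (\<Sum>b\<in>J. emb C (\<sigma> (r b)) * b)" if "finite J" "J \<subseteq> T" for J
      using that
    proof (induction J rule: finite_induct)
      case empty
      show ?case using field_hom_zero[OF gal_fun_hom[OF \<sigma>]] by simp
    next
      case (insert b J)
      then show ?case
        using gal_fun_kfun[OF \<sigma>, of b] gal_fun_emb[OF \<sigma>] T B(1)
        by (auto simp: field_hom_add[OF gal_fun_hom[OF \<sigma>]] field_hom_mult[OF gal_fun_hom[OF \<sigma>]])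
    qed
    then show ?thesis using T z by simp
  qed
  show ?thesis
  proof (intro exI[of _ "r ` T"] conjI ballI)
    fix \<sigma> \<tau> :: "'k alg_closure \<Rightarrow> 'k alg_closure"
    assume \<sigma>\<tau>: "\<sigma> \<in> Gal" "\<tau> \<in> Gal"
    have "gal_fun C \<sigma> z = gal_fun C \<tau> z \<longleftrightarrow> (\<Sum>b\<in>T. emb C (\<sigma> (r b) - \<tau> (r b)) * b) = 0"
      unfolding act[OF \<sigma>\<tau>(1)] act[OF \<sigma>\<tau>(2)]
      by (simp add: field_hom_diff[OF e] left_diff_distrib sum_subtractf)
    also have "\<dots> \<longleftrightarrow> (\<forall>b\<in>T. \<sigma> (r b) - \<tau> (r b) = 0)"
    proof
      assume "(\<Sum>b\<in>T. emb C (\<sigma> (r b) - \<tau> (r b)) * b) = 0"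
      then show "\<forall>b\<in>T. \<sigma> (r b) - \<tau> (r b) = 0"
        using K.independentD[OF B(2) T, of "\<lambda>b. \<sigma> (r b) - \<tau> (r b)"] by blast
    qed (simp add: field_hom_zero[OF e])
    finally show "gal_fun C \<sigma> z = gal_fun C \<tau> z \<longleftrightarrow> (\<forall>a\<in>r ` T. \<sigma> a = \<tau> a)" by simp
  qed (use T in simp)
qed

end

section \<open>The dihedral group of order eight\<close>

locale dihedral8 = group G for G (structure) +
  fixes U V
  assumes pres: "D8_presentation G U V"
begin

definition rot :: "nat \<Rightarrow> 'a" where "rot j = V [^] j"

definition mirror :: "nat \<Rightarrow> 'a" where "mirror j = U \<otimes> V [^] j"

lemma U_closed [simp]: "U \<in> carrier G" and V_closed [simp]: "V \<in> carrier G"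
  using pres by (auto simp: D8_presentation_def)

lemma UU: "U \<otimes> U = \<one>"
  using pres by (simp add: D8_presentation_def numeral_2_eq_2)

lemma V4: "V [^] (4::nat) = \<one>"
  using pres by (simp add: D8_presentation_def)

lemma VU: "V \<otimes> U = U \<otimes> V [^] (3::nat)"
  using pres by (simp add: D8_presentation_def)

lemma rot_closed [simp]: "rot j \<in> carrier G" and mirror_closed [simp]: "mirror j \<in> carrier G"
  by (auto simp: rot_def mirror_def)

lemma rot_mod: "rot j = rot (j mod 4)"
proof -
  have "rot j = V [^] (4 * (j div 4)) \<otimes> rot (j mod 4)" by (simp add: rot_def nat_pow_mult)
  also have "V [^] (4 * (j div 4)) = (V [^] (4::nat)) [^] (j div 4)"
    by (rule nat_pow_pow[OF V_closed, symmetric])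
  finally show ?thesis by (simp add: V4)
qed

lemma rot_rot [simp]: "rot i \<otimes> rot j = rot (i + j)"
  by (simp add: rot_def nat_pow_mult)

lemma mirror_eq: "mirror j = U \<otimes> rot j"
  by (simp add: mirror_def rot_def)

lemma mirror_rot [simp]: "mirror i \<otimes> rot j = mirror (i + j)"
  by (simp add: mirror_eq m_assoc)

text \<open>Exponents are natural numbers that matter modulo 4, so \<open>3 * j\<close> plays the
  role of -j here and below.\<close>

lemma rot_U: "rot j \<otimes> U = U \<otimes> rot (3 * j)"
proof (induction j)
  case 0
  show ?case by (simp add: rot_def)
next
  case (Suc j)
  have "rot (Suc j) \<otimes> U = rot j \<otimes> (V \<otimes> U)" by (simp add: rot_def m_assoc)
  also have "\<dots> = rot j \<otimes> U \<otimes> rot 3" by (simp add: VU rot_def m_assoc)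
  also have "\<dots> = U \<otimes> rot (3 * Suc j)" by (simp add: Suc m_assoc add.commute)
  finally show ?case .
qed

lemma rot_mirror [simp]: "rot i \<otimes> mirror j = mirror (3 * i + j)"
  by (simp add: mirror_eq rot_U flip: m_assoc) (simp add: m_assoc)

lemma mirror_mirror [simp]: "mirror i \<otimes> mirror j = rot (3 * i + j)"
  unfolding mirror_eq[of i] by (simp add: m_assoc) (simp add: mirror_eq UU flip: m_assoc)

lemma one_rot: "\<one> = rot 0" and V_rot: "V = rot 1" and U_mirror: "U = mirror 0"
  by (simp_all add: rot_def mirror_def)

lemma elements: "carrier G = rot ` {..<4} \<union> mirror ` {..<4}"
proof
  have R: "rot j \<in> rot ` {..<4}" "mirror j \<in> mirror ` {..<4}" for j
    using rot_mod[of j] by (auto simp: mirror_eq intro!: image_eqI[of _ _ "j mod 4"])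
  have "x \<in> rot ` {..<4} \<union> mirror ` {..<4}" if "x \<in> generate G {U, V}" for x
    using that
  proof (induction rule: generate.induct)
    case one
    show ?case unfolding one_rot using R by blast
  next
    case (incl h)
    then show ?case using R[of 0] R[of 1] V_rot U_mirror by auto
  next
    case (inv h)
    have "mirror 0 \<otimes> mirror 0 = \<one>" "rot 3 \<otimes> rot 1 = \<one>" using rot_mod[of 4] by (simp_all add: one_rot)
    then have "inv U = mirror 0" "inv V = rot 3"
      using U_mirror V_rot inv_equality by (metis U_closed V_closed rot_closed mirror_closed)+
    then show ?case using inv R by auto
  next
    case (eng h1 h2)
    then show ?case using R by auto
  qed
  then show "carrier G \<subseteq> rot ` {..<4} \<union> mirror ` {..<4}"
    using pres by (auto simp: D8_presentation_def)
qed auto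

lemma element_cases:
  assumes "x \<in> carrier G"
  obtains j where "j < 4" "x = rot j" | j where "j < 4" "x = mirror j"
  using assms elements by auto

text \<open>Counting: two families of four elements exhaust a group of order 8, so nothing can
  coincide.\<close>

lemma inj_elements: "inj_on rot {..<4}" "inj_on mirror {..<4}" "rot ` {..<4} \<inter> mirror ` {..<4} = {}"
proof -
  have "card (rot ` {..<4} \<union> mirror ` {..<4}) = 8"
    using pres elements by (simp add: D8_presentation_def)
  moreover have "card (rot ` {..<4} \<union> mirror ` {..<4}) + card (rot ` {..<4} \<inter> mirror ` {..<4})
      = card (rot ` {..<4}) + card (mirror ` {..<4})"
    using card_Un_Int[of "rot ` {..<4}" "mirror ` {..<4}"] by simp
  moreover have "card (rot ` {..<4}) \<le> 4" "card (mirror ` {..<4}) \<le> 4"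
    using card_image_le[of "{..<4::nat}" rot] card_image_le[of "{..<4::nat}" mirror] by auto
  ultimately have *: "card (rot ` {..<4}) = 4" "card (mirror ` {..<4}) = 4"
    "card (rot ` {..<4} \<inter> mirror ` {..<4}) = 0" by linarith+
  then show "inj_on rot {..<4}" "inj_on mirror {..<4}" "rot ` {..<4} \<inter> mirror ` {..<4} = {}"
    by (auto intro!: eq_card_imp_inj_on)
qed

lemma mirror_mod: "mirror j = mirror (j mod 4)"
  using rot_mod[of j] by (simp add: mirror_eq)

lemma rot_eq_iff: "rot i = rot j \<longleftrightarrow> i mod 4 = j mod 4"
  using inj_onD[OF inj_elements(1), of "i mod 4" "j mod 4"] rot_mod[of i] rot_mod[of j] by auto

lemma mirror_eq_iff: "mirror i = mirror j \<longleftrightarrow> i mod 4 = j mod 4"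
  using inj_onD[OF inj_elements(2), of "i mod 4" "j mod 4"] mirror_mod[of i] mirror_mod[of j] by auto

lemma rot_neq_mirror: "rot i \<noteq> mirror j"
  using inj_elements(3) rot_mod[of i] mirror_mod[of j]
  by (metis disjoint_iff image_eqI lessThan_iff mod_less_divisor zero_less_numeral)

lemma involution_cases:
  assumes "x \<in> carrier G" "x \<noteq> \<one>" "x \<otimes> x = \<one>"
  obtains "x = rot 2" | j where "x = mirror j"
  using assms(1)
proof (cases rule: element_cases)
  case (1 j)
  then have "j \<noteq> 0" "(j + j) mod 4 = 0" using assms by (auto simp: one_rot rot_eq_iff)
  then have "j = 2" using 1 by presburger
  then show ?thesis using 1 that by blast
qed (use that in blast)

lemma rot_1: "rot 1 = V" and mirror_0: "mirror 0 = U" and mirror_1: "mirror 1 = U \<otimes> V"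
  by (simp_all add: rot_def mirror_def)

text \<open>Mirrors square to 1 but the image of V does not, so V goes to a rotation of order 4. The
  rotations are then already images of rotations, and injectivity sends U to a mirror.\<close>

lemma automorphism_generators:
  assumes h: "h \<in> hom G G" "inj_on h (carrier G)"
  shows "\<exists>j. j \<in> {1, 3} \<and> h (rot 1) = rot j" "\<exists>i<4. h (mirror 0) = mirror i"
proof -
  have hm: "h (x \<otimes> y) = h x \<otimes> h y" if "x \<in> carrier G" "y \<in> carrier G" for x y
    using h(1) that by (simp add: hom_mult)
  have hc: "h x \<in> carrier G" if "x \<in> carrier G" for x using h(1) that by (rule hom_in_carrier)
  have h1: "h (rot 0) = rot 0" using hom_one[OF h(1) is_group is_group] by (simp add: one_rot)
  have "rot 2 \<noteq> rot 0" by (simp add: rot_eq_iff)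
  then have h2: "h (rot 2) \<noteq> rot 0" using inj_onD[OF h(2), of "rot 2" "rot 0"] h1 by auto
  have sq: "h (rot 2) = h (rot 1) \<otimes> h (rot 1)" using hm[of "rot 1" "rot 1"]
    by (simp only: rot_rot one_add_one rot_closed)
  have "\<exists>j<4. h (rot 1) = rot j"
  proof (cases rule: element_cases[OF hc[OF rot_closed[of 1]]])
    case (2 j)
    then have "h (rot 2) = rot (3 * j + j)" using sq by simp
    then have "h (rot 2) = rot 0" by (simp add: rot_eq_iff)
    then show ?thesis using h2 by blast
  qed blast
  then obtain j where j: "j < 4" "h (rot 1) = rot j" by blast
  have "h (rot 2) = rot (j + j)" using sq j by simp
  then have "(j + j) mod 4 \<noteq> 0" using h2 by (simp add: rot_eq_iff)
  moreover have "j \<in> {0, 1, 2, 3}" using j(1) by auto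
  ultimately have jj: "j \<in> {1, 3}" by auto
  then show "\<exists>j. j \<in> {1, 3} \<and> h (rot 1) = rot j" using j by blast
  have hr: "h (rot k) = rot (j * k)" for k
  proof (induction k)
    case (Suc k)
    have "h (rot (Suc k)) = h (rot k \<otimes> rot 1)" by simp
    also have "\<dots> = h (rot k) \<otimes> h (rot 1)" by (rule hm) auto
    also have "\<dots> = rot (j * Suc k)" unfolding Suc j by (simp add: add.commute)
    finally show ?case .
  qed (simp add: h1)
  show "\<exists>i<4. h (mirror 0) = mirror i"
  proof (cases rule: element_cases[OF hc[OF mirror_closed[of 0]]])
    case (1 i)
    have "i \<in> {0, 1, 2, 3}" using 1 by auto
    \<comment> \<open>The square of 1 or 3 is 1 modulo 4, so \<open>rot (j * i)\<close> is a
      preimage of \<open>rot i\<close>.\<close>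
    then have "j * (j * i) mod 4 = i mod 4" using jj by auto
    then have "h (rot (j * i)) = h (mirror 0)" using 1 hr by (simp add: rot_eq_iff)
    then have "rot (j * i) = mirror 0" using inj_onD[OF h(2)] by simp
    then show ?thesis using rot_neq_mirror by metis
  qed blast
qed

text \<open>Conjugation by a mirror turns V^3 back into V, and conjugation by V shifts the index of
  a mirror by 2, so only the parity of the index survives. The equations say that conjugating by
  \<open>b\<close> achieves this.\<close>

lemma automorphism_normal_form:
  assumes h: "h \<in> hom G G" "inj_on h (carrier G)"
  obtains b where "b \<in> carrier G" "b \<otimes> h (rot 1) = rot 1 \<otimes> b"
    "b \<otimes> h (mirror 0) = mirror 0 \<otimes> b \<or> b \<otimes> h (mirror 0) = mirror 1 \<otimes> b"
proof -
  obtain j i where ji: "j \<in> {1, 3}" "h (rot 1) = rot j" "i < 4" "h (mirror 0) = mirror i"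
    using automorphism_generators[OF h] by blast
  have i: "i = 0 \<or> i = 1 \<or> i = 2 \<or> i = 3" using ji(3) by auto
  show thesis
  proof (cases "j = 1")
    case True
    \<comment> \<open>Conjugation by \<open>rot k\<close> takes \<open>mirror i\<close> to
      \<open>mirror (i + 2 * k)\<close>.\<close>
    define k :: nat where "k = (if i < 2 then 0 else 1)"
    have "rot k \<otimes> mirror i = mirror 0 \<otimes> rot k \<or> rot k \<otimes> mirror i = mirror 1 \<otimes> rot k"
      using i by (auto simp: k_def mirror_eq_iff)
    moreover have "rot k \<otimes> h (rot 1) = rot 1 \<otimes> rot k"
      unfolding ji(2) True by simp
    ultimately show thesis
      by (intro that[of "rot k"]) (simp_all add: ji(4))
  next
    case False
    then have j: "j = 3" using ji by simp
    \<comment> \<open>Conjugation by \<open>mirror k\<close> takes index i to 2 k - i modulo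
      4.\<close>
    define k :: nat where "k = (if i = 0 \<or> i = 3 then 0 else 1)"
    have "mirror k \<otimes> mirror i = mirror 0 \<otimes> mirror k \<or> mirror k \<otimes> mirror i = mirror 1 \<otimes> mirror k"
      using i by (auto simp: k_def rot_eq_iff)
    moreover have "mirror k \<otimes> h (rot 1) = rot 1 \<otimes> mirror k"
      unfolding ji(2) j by (simp add: add.commute)
    ultimately show thesis
      by (intro that[of "mirror k"]) (simp_all add: ji(4))
  qed
qed

text \<open>Here \<open>h\<close> compares two actions: \<open>t\<close> is the action of a Galois element on the first group and
  conjugation by \<open>c\<close> measures the failure of \<open>h\<close> to be equivariant.\<close>

lemma equivariance_defect:
  assumes t: "t \<in> hom G G" "inj_on t (carrier G)" and h: "h \<in> hom G G" and c: "c \<in> carrier G"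
    and hV: "h (rot 1) = rot 1" and hU: "h (mirror 0) = mirror 0 \<or> h (mirror 0) = mirror 1"
    and eq: "\<And>a. a \<in> carrier G \<Longrightarrow> c \<otimes> h (t a) = t (h a) \<otimes> c"
  shows "h (mirror 0) = mirror 0 \<or> t (rot 1) = rot 1 \<Longrightarrow> c \<in> {rot 0, rot 2}"
    "h (mirror 0) \<noteq> mirror 0 \<Longrightarrow> t (rot 1) \<noteq> rot 1 \<Longrightarrow> c \<in> {rot 1, rot 3}"
proof -
  obtain j i where ji: "j \<in> {1, 3}" "t (rot 1) = rot j" "i < 4" "t (mirror 0) = mirror i"
    using automorphism_generators[OF t] by blast
  have hm: "h (x \<otimes> y) = h x \<otimes> h y" if "x \<in> carrier G" "y \<in> carrier G" for x y
    using h(1) that by (simp add: hom_mult)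
  have tm: "t (x \<otimes> y) = t x \<otimes> t y" if "x \<in> carrier G" "y \<in> carrier G" for x y
    using t(1) that by (simp add: hom_mult)
  have hr: "h (rot k) = rot k" for k
  proof (induction k)
    case 0
    show ?case using hom_one[OF h is_group is_group] by (simp add: one_rot)
  next
    case (Suc k)
    have "h (rot (Suc k)) = h (rot k \<otimes> rot 1)" by simp
    also have "\<dots> = h (rot k) \<otimes> h (rot 1)" by (rule hm) auto
    also have "\<dots> = rot (Suc k)" unfolding Suc hV by simp
    finally show ?case .
  qed
  obtain d where d: "d = 0 \<or> d = 1" "h (mirror 0) = mirror d" using hU by blast
  have hs: "h (mirror k) = mirror (d + k)" for k
    using hm[of "mirror 0" "rot k"] d(2) by (simp add: hr)
  \<comment> \<open>The element V of the group already shows that \<open>c\<close> commutes with an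
    element of order 4, so \<open>c\<close> is a rotation.\<close>
  have cj: "c \<otimes> rot j = rot j \<otimes> c" using eq[of "rot 1"] by (simp only: ji(2) hV hr rot_closed)
  have "\<exists>k<4. c = rot k" using c
  proof (cases rule: element_cases)
    case (2 k)
    then have "mirror (k + j) = mirror (3 * j + k)" using cj by simp
    then have "(k + j) mod 4 = (3 * j + k) mod 4" by (simp only: mirror_eq_iff)
    then have False using ji(1) by (elim insertE emptyE) (simp_all, presburger+)
    then show ?thesis ..
  qed blast
  then obtain k where k: "k < 4" "c = rot k" by blast
  have td: "t (mirror d) = mirror (i + d * j)"
  proof (cases "d = 0")
    case False
    then have "d = 1" using d by blast
    then show ?thesis using ji tm[of "mirror 0" "rot 1"] by simp
  qed (simp add: ji)
  have ht: "h (t (mirror 0)) = mirror (d + i)" unfolding ji(4) hs ..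
  have th: "t (h (mirror 0)) = mirror (i + d * j)" unfolding d(2) td ..
  have "c \<otimes> h (t (mirror 0)) = t (h (mirror 0)) \<otimes> c" by (rule eq) simp
  then have "rot k \<otimes> mirror (d + i) = mirror (i + d * j) \<otimes> rot k"
    by (simp only: k ht th)
  then have "mirror (3 * k + (d + i)) = mirror (i + d * j + k)" by simp
  \<comment> \<open>This is 2 k = d (j - 1) modulo 4: k is even unless d = 1 and j = 3, when it is
    odd.\<close>
  then have m: "(3 * k + (d + i)) mod 4 = (i + d * j + k) mod 4" by (simp only: mirror_eq_iff)
  have dU: "h (mirror 0) = mirror 0 \<longleftrightarrow> d = 0" using d by (auto simp: mirror_eq_iff)
  have jV: "t (rot 1) = rot 1 \<longleftrightarrow> j = 1" unfolding ji(2) using ji(1) by (auto simp: rot_eq_iff)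
  have k': "k = 0 \<or> k = 1 \<or> k = 2 \<or> k = 3" using k by auto
  have i': "i = 0 \<or> i = 1 \<or> i = 2 \<or> i = 3" using ji(3) by auto
  show "c \<in> {rot 0, rot 2}" if "h (mirror 0) = mirror 0 \<or> t (rot 1) = rot 1"
  proof -
    have "d = 0 \<or> j = 1" using that dU jV by blast
    then have "k = 0 \<or> k = 2" using m k' i' d(1) by auto
    then show ?thesis using k by auto
  qed
  show "c \<in> {rot 1, rot 3}" if "h (mirror 0) \<noteq> mirror 0" "t (rot 1) \<noteq> rot 1"
  proof -
    have "d = 1" "j = 3" using that dU jV d(1) ji(1) by auto
    then have "k = 1 \<or> k = 3" using m k' i' by auto
    then show ?thesis using k by auto
  qed
qed

end

section \<open>Isomorphisms and twists\<close>

lemma isoms_hom: "\<phi> \<in> isoms C C' \<Longrightarrow> is_field_hom \<phi>"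
  and isoms_bij: "\<phi> \<in> isoms C C' \<Longrightarrow> bij \<phi>"
  and isoms_emb: "\<phi> \<in> isoms C C' \<Longrightarrow> \<phi> (emb C' a) = emb C a"
  by (auto simp: isoms_def)

lemma isoms_comp: "\<phi> \<in> isoms C C' \<Longrightarrow> \<psi> \<in> isoms C' C'' \<Longrightarrow> \<phi> \<circ> \<psi> \<in> isoms C C''"
  by (auto simp: isoms_def field_hom_comp bij_comp)

lemma isoms_id: "id \<in> isoms C C"
  by (simp add: isoms_def field_hom_id)

lemma bij_inv_into_simps:
  assumes "bij f"
  shows "inv_into UNIV f (f x) = x" "f (inv_into UNIV f y) = y"
  by (rule inv_f_f[OF bij_is_inj[OF assms]], rule surj_f_inv_f[OF bij_is_surj[OF assms]])

lemma isoms_inv: "\<phi> \<in> isoms C C' \<Longrightarrow> inv_into UNIV \<phi> \<in> isoms C' C"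
  unfolding isoms_def
  by (auto simp: field_hom_inv bij_imp_bij_inv) (metis bij_inv_into_simps(1))

lemma Aut_carrier: "carrier (Aut C) = isoms C C"
  and Aut_mult: "x \<otimes>\<^bsub>Aut C\<^esub> y = y \<circ> x"
  and Aut_one: "\<one>\<^bsub>Aut C\<^esub> = id"
  by (simp_all add: Aut_def mor_comp_def)

lemma group_Aut: "group (Aut C)"
proof (rule groupI)
  fix x assume x: "x \<in> carrier (Aut C)"
  then have "inv_into UNIV x \<otimes>\<^bsub>Aut C\<^esub> x = \<one>\<^bsub>Aut C\<^esub>"
    using bij_inv_into_simps(2)[OF isoms_bij] by (auto simp: Aut_carrier Aut_mult Aut_one fun_eq_iff)
  then show "\<exists>y\<in>carrier (Aut C). y \<otimes>\<^bsub>Aut C\<^esub> x = \<one>\<^bsub>Aut C\<^esub>"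
    using isoms_inv x unfolding Aut_carrier by blast
qed (auto simp: Aut_carrier Aut_mult Aut_one isoms_comp isoms_id comp_assoc)

lemma gal_mor_apply:
  assumes "is_curve C'" "\<sigma> \<in> Gal"
  shows "gal_mor C C' \<sigma> \<phi> (gal_fun C' \<sigma> z) = gal_fun C \<sigma> (\<phi> z)"
  by (simp add: gal_mor_def bij_inv_into_simps[OF gal_fun_bij[OF assms]])

lemma gal_mor_isoms:
  fixes C :: "('k::field, 'f::field) curve" and C' :: "('k, 'g::field) curve"
  assumes C: "is_curve C" "is_curve C'" and \<sigma>: "\<sigma> \<in> Gal" and \<phi>: "\<phi> \<in> isoms C C'"
  shows "gal_mor C C' \<sigma> \<phi> \<in> isoms C C'"
proof -
  define s where "s = inv_into UNIV (gal_fun C' \<sigma>)"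
  have s: "is_field_hom s" "bij s"
    unfolding s_def
    by (rule field_hom_inv[OF gal_fun_hom[OF C(2) \<sigma>] gal_fun_bij[OF C(2) \<sigma>]],
        rule bij_imp_bij_inv[OF gal_fun_bij[OF C(2) \<sigma>]])
  have "gal_mor C C' \<sigma> \<phi> (emb C' a) = emb C a" for a
  proof -
    have "\<sigma> (inv_into UNIV \<sigma> a) = a" using bij_inv_into_simps(2)[OF Gal_bij[OF \<sigma>]] .
    then have "emb C' a = gal_fun C' \<sigma> (emb C' (inv_into UNIV \<sigma> a))"
      by (simp add: gal_fun_emb[OF C(2) \<sigma>])
    then have "gal_mor C C' \<sigma> \<phi> (emb C' a) = gal_fun C \<sigma> (\<phi> (emb C' (inv_into UNIV \<sigma> a)))"
      by (simp only: gal_mor_apply[OF C(2) \<sigma>])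
    then show ?thesis
      by (simp add: isoms_emb[OF \<phi>] gal_fun_emb[OF C(1) \<sigma>] bij_inv_into_simps(2)[OF Gal_bij[OF \<sigma>]])
  qed
  moreover have "is_field_hom (gal_mor C C' \<sigma> \<phi>)" "bij (gal_mor C C' \<sigma> \<phi>)"
    unfolding gal_mor_def s_def[symmetric]
    using s(1,2) gal_fun_hom[OF C(1) \<sigma>] gal_fun_bij[OF C(1) \<sigma>] isoms_hom[OF \<phi>] isoms_bij[OF \<phi>]
    by (auto intro!: field_hom_comp bij_comp)
  ultimately show ?thesis by (simp add: isoms_def)
qed

lemma gal_aut_hom:
  assumes C: "is_curve C" and \<sigma>: "\<sigma> \<in> Gal"
  shows "gal_aut C \<sigma> \<in> hom (Aut C) (Aut C)" "inj_on (gal_aut C \<sigma>) (carrier (Aut C))"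
proof -
  note b = gal_fun_bij[OF C \<sigma>]
  show "gal_aut C \<sigma> \<in> hom (Aut C) (Aut C)"
  proof (rule homI)
    show "gal_aut C \<sigma> x \<in> carrier (Aut C)" if "x \<in> carrier (Aut C)" for x
      using that gal_mor_isoms[OF C C \<sigma>] by (simp add: Aut_carrier)
    show "gal_aut C \<sigma> (x \<otimes>\<^bsub>Aut C\<^esub> y) = gal_aut C \<sigma> x \<otimes>\<^bsub>Aut C\<^esub> gal_aut C \<sigma> y" for x y
      by (auto simp: Aut_mult gal_mor_def bij_inv_into_simps[OF b])
  qed
  show "inj_on (gal_aut C \<sigma>) (carrier (Aut C))"
  proof (rule inj_onI)
    fix x y assume "gal_aut C \<sigma> x = gal_aut C \<sigma> y"
    then have "gal_fun C \<sigma> (x z) = gal_fun C \<sigma> (y z)" for z by (metis gal_mor_apply[OF C \<sigma>])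
    then show "x = y" using bij_is_inj[OF b] by (auto simp: inj_def)
  qed
qed

lemma isoms_eqI:
  fixes C :: "('k::field, 'f::field) curve"
  assumes C: "is_curve C" and "\<phi> \<in> isoms C C" "\<psi> \<in> isoms C C" "\<And>f. f \<in> kfun C \<Longrightarrow> \<phi> f = \<psi> f"
  shows "\<phi> = \<psi>"
  by (rule semilinear_eqI[OF C, of _ "emb C"])
     (use assms in \<open>auto simp: isoms_emb field_hom_add[OF isoms_hom] field_hom_mult[OF isoms_hom]\<close>)

text \<open>For f in k(C), every \<tau> that fixes V fixes V f and hence its coefficients in a basis
  of k(C). These coefficients lie in the field of definition, so \<sigma> fixes V f too.\<close>

lemma gal_aut_fixes_if_fixes_field:
  fixes C :: "('k::field, 'f::field) curve"
  assumes C: "is_curve C" and V: "V \<in> carrier (Aut C)" and \<sigma>: "\<sigma> \<in> Gal"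
    and fixed: "\<And>a. a \<in> field_of_definition (gal_aut C) (generate (Aut C) {V}) \<Longrightarrow> \<sigma> a = a"
  shows "gal_aut C \<sigma> V = V"
proof (rule isoms_eqI[OF C])
  show V': "V \<in> isoms C C" using V by (simp add: Aut_carrier)
  show "gal_aut C \<sigma> V \<in> isoms C C" using gal_mor_isoms[OF C C \<sigma> V'] .
  fix f assume f: "f \<in> kfun C"
  obtain S where S: "\<And>\<sigma> \<tau>. \<sigma> \<in> Gal \<Longrightarrow> \<tau> \<in> Gal \<Longrightarrow>
      gal_fun C \<sigma> (V f) = gal_fun C \<tau> (V f) \<longleftrightarrow> (\<forall>a\<in>S. \<sigma> a = \<tau> a)"
    using gal_fun_coefficients[OF C, of "V f"] by blast
  have "S \<subseteq> field_of_definition (gal_aut C) (generate (Aut C) {V})"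
    unfolding field_of_definition_def
  proof (intro subsetI CollectI ballI impI)
    fix a \<tau> assume a: "a \<in> S" and \<tau>: "\<tau> \<in> Gal"
      and "\<forall>a\<in>generate (Aut C) {V}. gal_aut C \<tau> a = a"
    then have "gal_aut C \<tau> V = V" by (simp add: generate.incl)
    then have "gal_fun C \<tau> (V f) = V f"
      using gal_mor_apply[OF C \<tau>, of C V f] gal_fun_kfun[OF C \<tau> f] by simp
    then have "gal_fun C \<tau> (V f) = gal_fun C id (V f)" by (simp add: gal_fun_id[OF C])
    then have "\<forall>a\<in>S. \<tau> a = id a" by (rule S[OF \<tau> id_Gal, THEN iffD1])
    then show "\<tau> a = a" using a by simp
  qed
  then have "\<forall>a\<in>S. \<sigma> a = id a" using fixed by auto
  then have "gal_fun C \<sigma> (V f) = gal_fun C id (V f)" by (rule S[OF \<sigma> id_Gal, THEN iffD2])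
  then show "gal_aut C \<sigma> V f = V f"
    using gal_mor_apply[OF C \<sigma>, of C V f] gal_fun_kfun[OF C \<sigma> f] by (simp add: gal_fun_id[OF C])
qed

section \<open>The twisting map of an isomorphism between two curves\<close>

locale twist =
  fixes C1 :: "('k::field, 'f::field) curve" and C2 :: "('k, 'g::field) curve" and \<psi> :: "'f \<Rightarrow> 'g"
  assumes C1: "is_curve C1" and C2: "is_curve C2" and \<psi>: "\<psi> \<in> isoms C2 C1"
begin

definition twist_map :: "('k alg_closure \<Rightarrow> 'k alg_closure) \<Rightarrow> 'f \<Rightarrow> 'f" where
  "twist_map \<sigma> = mor_comp (gal_mor C2 C1 \<sigma> \<psi>) (inv_into UNIV \<psi>)"

lemmas \<psi>_simps [simp] = bij_inv_into_simps[OF isoms_bij[OF \<psi>]]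

lemma twist_map_apply: "\<sigma> \<in> Gal \<Longrightarrow> twist_map \<sigma> (gal_fun C1 \<sigma> z) = inv_into UNIV \<psi> (gal_fun C2 \<sigma> (\<psi> z))"
  by (simp add: twist_map_def mor_comp_def gal_mor_apply[OF C1])

lemma gal_fun_surj: "\<sigma> \<in> Gal \<Longrightarrow> \<exists>y. z = gal_fun C1 \<sigma> y"
  using bij_is_surj[OF gal_fun_bij[OF C1]] by (metis surjD)

lemma twist_map_Aut: "\<sigma> \<in> Gal \<Longrightarrow> twist_map \<sigma> \<in> carrier (Aut C1)"
  unfolding Aut_carrier twist_map_def mor_comp_def
  by (rule isoms_comp[OF isoms_inv[OF \<psi>] gal_mor_isoms[OF C2 C1 _ \<psi>]])

text \<open>The factors come in the order opposite to that in \<open>cocycle\<close>; this is harmless below, where all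
  values lie in the cyclic group generated by \<open>V\<close>.\<close>

lemma twist_map_comp:
  assumes \<sigma>: "\<sigma> \<in> Gal" and \<tau>: "\<tau> \<in> Gal"
  shows "twist_map (\<sigma> \<circ> \<tau>) = gal_aut C1 \<sigma> (twist_map \<tau>) \<otimes>\<^bsub>Aut C1\<^esub> twist_map \<sigma>"
proof
  fix z
  obtain y where y: "z = gal_fun C1 \<sigma> (gal_fun C1 \<tau> y)" using gal_fun_surj \<sigma> \<tau> by metis
  have "z = gal_fun C1 (\<sigma> \<circ> \<tau>) y" by (simp add: y gal_fun_comp[OF C1 \<sigma> \<tau>])
  then have "twist_map (\<sigma> \<circ> \<tau>) z = inv_into UNIV \<psi> (gal_fun C2 \<sigma> (gal_fun C2 \<tau> (\<psi> y)))"
    using twist_map_apply[OF comp_Gal[OF \<sigma> \<tau>]] by (simp add: gal_fun_comp[OF C2 \<sigma> \<tau>])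
  also have "\<dots> = twist_map \<sigma> (gal_fun C1 \<sigma> (twist_map \<tau> (gal_fun C1 \<tau> y)))"
    by (simp add: twist_map_apply \<sigma> \<tau>)
  also have "\<dots> = (gal_aut C1 \<sigma> (twist_map \<tau>) \<otimes>\<^bsub>Aut C1\<^esub> twist_map \<sigma>) z"
    by (simp add: Aut_mult y gal_mor_apply[OF C1 \<sigma>])
  finally show "twist_map (\<sigma> \<circ> \<tau>) z = (gal_aut C1 \<sigma> (twist_map \<tau>) \<otimes>\<^bsub>Aut C1\<^esub> twist_map \<sigma>) z" .
qed

text \<open>A finite subset of \<open>k(C1)\<close> separates the finitely many automorphisms of \<open>C1\<close>.\<close>

lemma twist_map_continuous:
  assumes fin: "finite (carrier (Aut C1))"
  shows "krull_continuous twist_map"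
proof -
  define A where "A = carrier (Aut C1)"
  have "\<exists>f\<in>kfun C1. x f \<noteq> y f" if "x \<in> A" "y \<in> A" "x \<noteq> y" for x y
    using isoms_eqI[OF C1, of x y] that by (auto simp: A_def Aut_carrier)
  then obtain w where w: "\<And>x y. x \<in> A \<Longrightarrow> y \<in> A \<Longrightarrow> x \<noteq> y \<Longrightarrow> w x y \<in> kfun C1 \<and> x (w x y) \<noteq> y (w x y)"
    by metis
  have "\<exists>S. finite S \<and> (\<forall>\<sigma>\<in>Gal. \<forall>\<tau>\<in>Gal. (\<forall>a\<in>S. \<sigma> a = \<tau> a) \<longrightarrow> gal_fun C2 \<sigma> (\<psi> f) = gal_fun C2 \<tau> (\<psi> f))" for f
    using gal_fun_coefficients[OF C2, of "\<psi> f"] by blast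
  then obtain S where S: "\<And>f. finite (S f)"
    "\<And>f \<sigma> \<tau>. \<sigma> \<in> Gal \<Longrightarrow> \<tau> \<in> Gal \<Longrightarrow> \<forall>a\<in>S f. \<sigma> a = \<tau> a \<Longrightarrow> gal_fun C2 \<sigma> (\<psi> f) = gal_fun C2 \<tau> (\<psi> f)"
    by metis
  define T where "T = (\<Union>(x, y)\<in>A \<times> A. S (w x y))"
  have "finite T" unfolding T_def using fin S(1) by (auto simp: A_def)
  moreover have "twist_map \<sigma> = twist_map \<tau>" if \<sigma>\<tau>: "\<sigma> \<in> Gal" "\<tau> \<in> Gal" "\<forall>a\<in>T. \<sigma> a = \<tau> a" for \<sigma> \<tau>
  proof (rule ccontr)
    assume neq: "twist_map \<sigma> \<noteq> twist_map \<tau>"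
    define f where "f = w (twist_map \<sigma>) (twist_map \<tau>)"
    have mem: "twist_map \<sigma> \<in> A" "twist_map \<tau> \<in> A" using twist_map_Aut \<sigma>\<tau> by (auto simp: A_def)
    then have f: "f \<in> kfun C1" "twist_map \<sigma> f \<noteq> twist_map \<tau> f"
      using w neq unfolding f_def by blast+
    have "S f \<subseteq> T" using mem unfolding T_def f_def by blast
    then have "gal_fun C2 \<sigma> (\<psi> f) = gal_fun C2 \<tau> (\<psi> f)" using S(2) \<sigma>\<tau> by blast
    then have "twist_map \<sigma> (gal_fun C1 \<sigma> f) = twist_map \<tau> (gal_fun C1 \<tau> f)"
      by (simp add: twist_map_apply \<sigma>\<tau>)
    then show False using f gal_fun_kfun[OF C1] \<sigma>\<tau> by simp
  qed
  ultimately show ?thesis unfolding krull_continuous_def by blast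
qed

text \<open>At z = \<open>gal_fun C1 \<sigma> y\<close> both sides equal the image of
  \<open>gal_fun C2 \<sigma> (f a (\<psi> y))\<close> under the inverse of \<psi>. For h the
  conjugate of f by \<psi>, this is the relation assumed in
  \<open>equivariance_defect\<close>.\<close>

lemma twist_map_equivariance:
  assumes \<sigma>: "\<sigma> \<in> Gal" and f: "f (gal_aut C1 \<sigma> a) = gal_aut C2 \<sigma> (f a)"
  shows "twist_map \<sigma> \<otimes>\<^bsub>Aut C1\<^esub> (inv_into UNIV \<psi> \<circ> f (gal_aut C1 \<sigma> a) \<circ> \<psi>)
    = gal_aut C1 \<sigma> (inv_into UNIV \<psi> \<circ> f a \<circ> \<psi>) \<otimes>\<^bsub>Aut C1\<^esub> twist_map \<sigma>"
proof
  fix z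
  obtain y where y: "z = gal_fun C1 \<sigma> y" using gal_fun_surj \<sigma> by metis
  show "(twist_map \<sigma> \<otimes>\<^bsub>Aut C1\<^esub> (inv_into UNIV \<psi> \<circ> f (gal_aut C1 \<sigma> a) \<circ> \<psi>)) z
    = (gal_aut C1 \<sigma> (inv_into UNIV \<psi> \<circ> f a \<circ> \<psi>) \<otimes>\<^bsub>Aut C1\<^esub> twist_map \<sigma>) z"
    by (simp add: Aut_mult y twist_map_apply \<sigma> gal_mor_apply[OF C1 \<sigma>] f gal_mor_apply[OF C2 \<sigma>])
qed

end

text \<open>Conjugating the given group isomorphism by \<open>\<psi>\<close> gives an automorphism of \<open>Aut C1\<close>; composing
  \<open>\<psi>\<close> with an automorphism of \<open>C1\<close> changes it by an inner automorphism.\<close>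

lemma exists_normalised_isomorphism:
  fixes C1 :: "('k::field, 'f::field) curve" and C2 :: "('k, 'g::field) curve"
  assumes \<phi>: "\<phi> \<in> isoms C2 C1" and f: "f \<in> iso (Aut C1) (Aut C2)" and D8: "dihedral8 (Aut C1) U V"
  obtains \<psi> h where "\<psi> \<in> isoms C2 C1" "h \<in> hom (Aut C1) (Aut C1)"
    "h = (\<lambda>a. inv_into UNIV \<psi> \<circ> f a \<circ> \<psi>)" "h V = V" "h U = U \<or> h U = U \<otimes>\<^bsub>Aut C1\<^esub> V"
proof -
  interpret dihedral8 "Aut C1" U V by fact
  have fh: "f \<in> hom (Aut C1) (Aut C2)" and fi: "inj_on f (carrier (Aut C1))"
    using f by (auto simp: iso_def bij_betw_def)
  have conj_hom: "(\<lambda>a. inv_into UNIV \<psi> \<circ> f a \<circ> \<psi>) \<in> hom (Aut C1) (Aut C1)" if \<psi>: "\<psi> \<in> isoms C2 C1" for \<psi>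
  proof (rule homI)
    show "inv_into UNIV \<psi> \<circ> f x \<circ> \<psi> \<in> carrier (Aut C1)" if "x \<in> carrier (Aut C1)" for x
      using hom_in_carrier[OF fh that] isoms_comp[OF isoms_comp[OF isoms_inv[OF \<psi>]] \<psi>]
      by (simp add: Aut_carrier)
    show "inv_into UNIV \<psi> \<circ> f (x \<otimes>\<^bsub>Aut C1\<^esub> y) \<circ> \<psi>
        = (inv_into UNIV \<psi> \<circ> f x \<circ> \<psi>) \<otimes>\<^bsub>Aut C1\<^esub> (inv_into UNIV \<psi> \<circ> f y \<circ> \<psi>)"
      if "x \<in> carrier (Aut C1)" "y \<in> carrier (Aut C1)" for x y
      unfolding hom_mult[OF fh that] using bij_inv_into_simps[OF isoms_bij[OF \<psi>]]
      by (auto simp: Aut_mult)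
  qed
  define h where "h a = inv_into UNIV \<phi> \<circ> f a \<circ> \<phi>" for a
  have hh: "h \<in> hom (Aut C1) (Aut C1)" unfolding h_def[abs_def] by (rule conj_hom[OF \<phi>])
  have "inj_on h (carrier (Aut C1))"
  proof (rule inj_onI)
    fix x y assume xy: "x \<in> carrier (Aut C1)" "y \<in> carrier (Aut C1)" "h x = h y"
    have "f x = f y"
    proof
      fix z
      have "h x (inv_into UNIV \<phi> z) = h y (inv_into UNIV \<phi> z)" using xy by simp
      then have "\<phi> (h x (inv_into UNIV \<phi> z)) = \<phi> (h y (inv_into UNIV \<phi> z))" by simp
      then show "f x z = f y z" by (simp add: h_def bij_inv_into_simps[OF isoms_bij[OF \<phi>]])
    qed
    then show "x = y" using fi xy by (simp add: inj_on_def)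
  qed
  then obtain b where b: "b \<in> carrier (Aut C1)" "b \<otimes>\<^bsub>Aut C1\<^esub> h (rot 1) = rot 1 \<otimes>\<^bsub>Aut C1\<^esub> b"
    "b \<otimes>\<^bsub>Aut C1\<^esub> h (mirror 0) = mirror 0 \<otimes>\<^bsub>Aut C1\<^esub> b \<or> b \<otimes>\<^bsub>Aut C1\<^esub> h (mirror 0) = mirror 1 \<otimes>\<^bsub>Aut C1\<^esub> b"
    using automorphism_normal_form[OF hh] by blast
  define \<psi> where "\<psi> = \<phi> \<circ> b"
  define h' where "h' a = inv_into UNIV \<psi> \<circ> f a \<circ> \<psi>" for a
  have b': "b \<in> isoms C1 C1" using b(1) by (simp add: Aut_carrier)
  have \<psi>: "\<psi> \<in> isoms C2 C1" unfolding \<psi>_def by (rule isoms_comp[OF \<phi> b'])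
  have h': "h' a = c" if "b \<otimes>\<^bsub>Aut C1\<^esub> h a = c \<otimes>\<^bsub>Aut C1\<^esub> b" for a c
  proof
    fix z
    have "h a (b z) = b (c z)" using fun_cong[OF that, of z] by (simp add: Aut_mult)
    then have "\<phi> (h a (b z)) = \<psi> (c z)" by (simp add: \<psi>_def)
    then have "f a (\<psi> z) = \<psi> (c z)" by (simp add: h_def \<psi>_def bij_inv_into_simps[OF isoms_bij[OF \<phi>]])
    then show "h' a z = c z" by (simp add: h'_def bij_inv_into_simps[OF isoms_bij[OF \<psi>]])
  qed
  show thesis
  proof (rule that[OF \<psi>])
    show "h' \<in> hom (Aut C1) (Aut C1)" unfolding h'_def[abs_def] by (rule conj_hom[OF \<psi>])
    show "h' = (\<lambda>a. inv_into UNIV \<psi> \<circ> f a \<circ> \<psi>)" by (simp add: h'_def[abs_def])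
    show "h' V = V" using h'[OF b(2)] by (simp only: rot_1)
    show "h' U = U \<or> h' U = U \<otimes>\<^bsub>Aut C1\<^esub> V"
      using b(3) h'[of "mirror 0"] by (metis mirror_0 mirror_1)
  qed
qed

lemma char_two_neq_zero:
  assumes char: "CHAR('k::field) \<noteq> 2"
  shows "(2 :: 'k) \<noteq> 0"
proof
  assume "(2 :: 'k) = 0"
  then have "of_nat 2 = (0 :: 'k)" by simp
  then have "CHAR('k) dvd 2" by (simp only: of_nat_eq_0_iff_char_dvd)
  then have "CHAR('k) = 1" using char two_is_prime_nat prime_nat_iff by blast
  then show False using of_nat_CHAR[where 'a = 'k] by simp
qed

lemma hyperelliptic_involution_central:
  fixes C :: "('k::field, 'f::field) curve"
  assumes C: "is_curve C" and g: "genus C = 2" and char: "CHAR('k) \<noteq> 2"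
    and D8: "dihedral8 (Aut C) U V" and \<iota>: "hyperelliptic_involution C \<iota>"
  shows "\<iota> = dihedral8.rot (Aut C) V 2"
proof -
  interpret dihedral8 "Aut C" U V by fact
  have \<iota>c: "\<iota> \<in> carrier (Aut C)" "\<iota> \<noteq> \<one>\<^bsub>Aut C\<^esub>" "\<iota> \<otimes>\<^bsub>Aut C\<^esub> \<iota> = \<one>\<^bsub>Aut C\<^esub>"
    using \<iota> by (auto simp: hyperelliptic_involution_def)
  obtain x where x: "x \<notin> range (emb C)" "{f. \<iota> f = f} = field_adjoin (range (emb C)) {x}"
    using \<iota> unfolding hyperelliptic_involution_def by blast
  have "(2 :: 'k) \<noteq> 0" by (rule char_two_neq_zero[OF char])
  then have "to_ac (2 :: 'k) \<noteq> 0" using to_ac_eq_0_iff by blast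
  then have "emb C (to_ac (2 :: 'k)) \<noteq> 0" using field_hom_eq_0_iff[OF curve_emb[OF C]] by blast
  then have two: "(2 :: 'f) \<noteq> 0" by (simp add: field_hom_two[OF curve_emb[OF C]])
  show ?thesis
  proof (cases rule: involution_cases[OF \<iota>c])
    case (2 j)
    have Vc: "V \<in> isoms C C" and \<iota>c': "\<iota> \<in> isoms C C" using V_closed \<iota>c by (auto simp: Aut_carrier)
    have VV: "V \<circ> V = rot 2" by (simp add: rot_def numeral_2_eq_2 Aut_mult Aut_one)
    have V4': "V (V (V (V f))) = f" for f
      using fun_cong[OF V4, of f] by (simp add: numeral_eq_Suc Aut_mult Aut_one)
    \<comment> \<open>Conjugation by a mirror inverts V, so V \<iota> = V^2 \<iota> V in the group;
      as maps the factors appear in the opposite order.\<close>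
    have "rot 1 \<otimes>\<^bsub>Aut C\<^esub> \<iota> = rot 2 \<otimes>\<^bsub>Aut C\<^esub> \<iota> \<otimes>\<^bsub>Aut C\<^esub> rot 1"
      by (simp add: 2 mirror_eq_iff) presburger
    then have "\<iota> \<circ> V = V \<circ> (\<iota> \<circ> (V \<circ> V))" unfolding rot_1 VV[symmetric] by (simp add: Aut_mult)
    then have \<iota>V: "\<iota> (V f) = V (\<iota> (V (V f)))" for f by (metis comp_apply)
    have "genus C \<le> 1"
    proof (rule genus_le_one_noncentral_involution[OF curve_emb[OF C] two isoms_hom[OF Vc] isoms_emb[OF Vc]
          isoms_hom[OF \<iota>c'] isoms_emb[OF \<iota>c'] _ V4' \<iota>V _ _ _ x])
      show "\<iota> (\<iota> f) = f" for f using fun_cong[OF \<iota>c(3), of f] by (simp add: Aut_mult Aut_one)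
      show "\<iota> \<noteq> id" using \<iota>c(2) by (simp add: Aut_one)
      have "rot 2 \<noteq> rot 0" by (simp add: rot_eq_iff)
      then show "V \<circ> V \<noteq> id" by (simp only: VV one_rot[symmetric] Aut_one) simp
      show "V \<circ> V \<noteq> \<iota>" unfolding VV 2 by (rule rot_neq_mirror)
    qed
    then show ?thesis using g by simp
  qed
qed

section \<open>The cocycle of the second curve, split into a central part and
  \<open>\<Xi>\<close>\<close>

theorem theorem4p5:
  fixes C1 :: "('k::field, 'f::field) curve"
    and C2 :: "('k, 'g::field) curve"
    and U V \<iota> :: "'f \<Rightarrow> 'f"
    and v :: 'k and sqrt_v :: "'k alg_closure"
    and \<Xi> :: "('k alg_closure \<Rightarrow> 'k alg_closure) \<Rightarrow> 'f \<Rightarrow> 'f"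
  assumes "perfect TYPE('k)" and "CHAR('k) \<noteq> 2"
    and "is_curve C1" and "genus C1 = 2" and "Aut C1 \<cong> D8"
    and "is_curve C2" and "genus C2 = 2" and "Aut C2 \<cong> D8"
    and "isoms C1 C2 \<noteq> {}"
    and "Gk_isomorphic (Aut C1) (gal_aut C1) (Aut C2) (gal_aut C2)"
    and "D8_presentation (Aut C1) U V"
    and "v \<noteq> 0" and "sqrt_v ^ 2 = to_ac v"
    and "field_of_definition (gal_aut C1) (generate (Aut C1) {V}) =
           field_adjoin (range to_ac) {sqrt_v}"
    and "\<And>\<sigma>. \<sigma> \<in> Gal \<Longrightarrow> \<sigma> sqrt_v = sqrt_v \<Longrightarrow> \<Xi> \<sigma> = \<one>\<^bsub>Aut C1\<^esub>"
    and "\<And>\<sigma>. \<sigma> \<in> Gal \<Longrightarrow> \<sigma> sqrt_v = - sqrt_v \<Longrightarrow> \<Xi> \<sigma> = V"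
    and "hyperelliptic_involution C1 \<iota>"
  shows "\<exists>\<xi>. cocycle C1 \<xi> \<and> (\<forall>\<sigma>\<in>Gal. \<xi> \<sigma> \<in> {\<one>\<^bsub>Aut C1\<^esub>, \<iota>}) \<and>
    ((\<exists>(C' :: ('k, 'g) curve) \<phi>. is_twist C1 \<xi> C' \<phi> \<and> k_isomorphic C2 C') \<or>
     (\<exists>(C' :: ('k, 'g) curve) \<phi>. is_twist C1 (\<lambda>\<sigma>. \<xi> \<sigma> \<otimes>\<^bsub>Aut C1\<^esub> \<Xi> \<sigma>) C' \<phi> \<and> k_isomorphic C2 C'))"
proof -
  have C1: "is_curve C1" and C2: "is_curve C2" by fact+
  interpret dihedral8 "Aut C1" U V
    by (rule dihedral8.intro[OF group_Aut]) (unfold_locales, fact)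
  have \<iota>: "\<iota> = rot 2"
    using hyperelliptic_involution_central[OF C1 _ _ dihedral8_axioms] assms by blast
  obtain f where f: "f \<in> iso (Aut C1) (Aut C2)"
    and f_eq: "\<And>\<sigma> a. \<sigma> \<in> Gal \<Longrightarrow> a \<in> carrier (Aut C1) \<Longrightarrow> f (gal_aut C1 \<sigma> a) = gal_aut C2 \<sigma> (f a)"
    using assms(10) unfolding Gk_isomorphic_def by blast
  obtain \<phi> where "\<phi> \<in> isoms C2 C1" using assms(9) isoms_inv by blast
  then obtain \<psi> h where \<psi>: "\<psi> \<in> isoms C2 C1" and h: "h \<in> hom (Aut C1) (Aut C1)"
    and h_def: "h = (\<lambda>a. inv_into UNIV \<psi> \<circ> f a \<circ> \<psi>)"
    and hV: "h V = V" and hU: "h U = U \<or> h U = U \<otimes>\<^bsub>Aut C1\<^esub> V"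
    by (rule exists_normalised_isomorphism[OF _ f dihedral8_axioms])
  interpret twist C1 C2 \<psi> using C1 C2 \<psi> by (rule twist.intro)
  note gal = gal_aut_hom[OF C1]
  have gal_mult: "gal_aut C1 \<sigma> (x \<otimes>\<^bsub>Aut C1\<^esub> y) = gal_aut C1 \<sigma> x \<otimes>\<^bsub>Aut C1\<^esub> gal_aut C1 \<sigma> y"
    if "\<sigma> \<in> Gal" "x \<in> carrier (Aut C1)" "y \<in> carrier (Aut C1)" for \<sigma> x y
    using gal(1)[OF that(1)] that by (simp add: hom_mult)

  have sv: "sqrt_v \<noteq> 0" using assms(12,13) by auto
  have "(2 :: 'k) \<noteq> 0" using char_two_neq_zero[OF assms(2)] .
  then have two: "(2 :: 'k alg_closure) \<noteq> 0" using to_ac_eq_0_iff[of "2 :: 'k"] by simp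
  have sv_neq: "sqrt_v \<noteq> - sqrt_v"
  proof
    assume "sqrt_v = - sqrt_v"
    then have "2 * sqrt_v = 0" by (simp add: eq_neg_iff_add_eq_0)
    then show False using two sv by simp
  qed
  have sign: "\<sigma> sqrt_v = sqrt_v \<or> \<sigma> sqrt_v = - sqrt_v" if "\<sigma> \<in> Gal" for \<sigma>
  proof -
    have "(\<sigma> sqrt_v) ^ 2 = sqrt_v ^ 2"
      using field_hom_power[OF Gal_hom[OF that], of sqrt_v 2] Gal_to_ac[OF that, of v] assms(13) by simp
    then show ?thesis using power2_eq_iff by blast
  qed
  \<comment> \<open>One direction holds because \<open>sqrt_v\<close> lies in the field of
    definition, the other because \<sigma> fixes all of k(sqrt_v), which is that field.\<close>
  have fixV: "gal_aut C1 \<sigma> (rot 1) = rot 1 \<longleftrightarrow> \<sigma> sqrt_v = sqrt_v" if \<sigma>: "\<sigma> \<in> Gal" for \<sigma>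
  proof
    assume V: "gal_aut C1 \<sigma> (rot 1) = rot 1"
    have "gal_aut C1 \<sigma> a = a" if "a \<in> generate (Aut C1) {V}" for a
    proof -
      have "gal_aut C1 \<sigma> a = a \<and> a \<in> carrier (Aut C1)" using that
      proof (induction rule: generate.induct)
        case one
        show ?case using hom_one[OF gal(1)[OF \<sigma>] is_group is_group] by simp
      next
        case (incl a)
        then show ?case using V by (simp add: rot_1 del: One_nat_def)
      next
        case (inv a)
        have "gal_aut C1 \<sigma> V = V" using V by (simp only: rot_1)
        moreover have "gal_aut C1 \<sigma> (inv\<^bsub>Aut C1\<^esub> V) = inv\<^bsub>Aut C1\<^esub> (gal_aut C1 \<sigma> V)"
          using group_hom.hom_inv[of "Aut C1" "Aut C1" "gal_aut C1 \<sigma>" V] gal(1)[OF \<sigma>]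
          by (simp add: group_hom_def group_hom_axioms_def)
        ultimately show ?case using inv by simp
      next
        case (eng a b)
        then show ?case by (simp add: gal_mult[OF \<sigma>])
      qed
      then show ?thesis ..
    qed
    moreover have "sqrt_v \<in> field_of_definition (gal_aut C1) (generate (Aut C1) {V})"
      unfolding assms(14) using field_adjoin_contains(2)[of "{sqrt_v}"] by blast
    ultimately show "\<sigma> sqrt_v = sqrt_v" using \<sigma> unfolding field_of_definition_def by blast
  next
    assume s: "\<sigma> sqrt_v = sqrt_v"
    have "field_adjoin (range to_ac) {sqrt_v} \<subseteq> {a. \<sigma> a = a}"
    proof (rule field_adjoin_minimal)
      show "is_subfield {a. \<sigma> a = a}"
        unfolding is_subfield_def using field_hom_simps[OF Gal_hom[OF \<sigma>]] by simp
    qed (use s Gal_to_ac[OF \<sigma>] in auto)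
    then have "gal_aut C1 \<sigma> V = V"
      using gal_aut_fixes_if_fixes_field[OF C1 V_closed \<sigma>] unfolding assms(14) by blast
    then show "gal_aut C1 \<sigma> (rot 1) = rot 1" by (simp only: rot_1)
  qed
  have gal_rot: "gal_aut C1 \<sigma> (rot j) = (if \<sigma> sqrt_v = sqrt_v then rot j else rot (3 * j))" if \<sigma>: "\<sigma> \<in> Gal" for \<sigma> j
  proof -
    obtain k where k: "k \<in> {1, 3}" "gal_aut C1 \<sigma> (rot 1) = rot k"
      using automorphism_generators(1)[OF gal[OF \<sigma>]] by blast
    have "k = 1 \<longleftrightarrow> \<sigma> sqrt_v = sqrt_v"
      using k(1) unfolding fixV[OF \<sigma>, symmetric] k(2) by (auto simp: rot_eq_iff)
    moreover have "gal_aut C1 \<sigma> (rot j) = rot (k * j)"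
    proof (induction j)
      case 0
      show ?case using hom_one[OF gal(1)[OF \<sigma>] is_group is_group] by (simp add: one_rot)
    next
      case (Suc j)
      have "gal_aut C1 \<sigma> (rot (Suc j)) = gal_aut C1 \<sigma> (rot j \<otimes>\<^bsub>Aut C1\<^esub> rot 1)" by simp
      also have "\<dots> = gal_aut C1 \<sigma> (rot j) \<otimes>\<^bsub>Aut C1\<^esub> gal_aut C1 \<sigma> (rot 1)"
        by (rule gal_mult[OF \<sigma>]) auto
      also have "\<dots> = rot (k * Suc j)" unfolding Suc k by (simp add: add.commute)
      finally show ?case .
    qed
    ultimately show ?thesis using k(1) by auto
  qed

  have defect: "twist_map \<sigma> \<otimes>\<^bsub>Aut C1\<^esub> h (gal_aut C1 \<sigma> a) = gal_aut C1 \<sigma> (h a) \<otimes>\<^bsub>Aut C1\<^esub> twist_map \<sigma>"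
    if "\<sigma> \<in> Gal" "a \<in> carrier (Aut C1)" for \<sigma> a
    unfolding h_def by (rule twist_map_equivariance[OF that(1) f_eq[OF that]])
  have hV': "h (rot 1) = rot 1" using hV by (simp only: rot_1)
  have hU': "h (mirror 0) = mirror 0 \<or> h (mirror 0) = mirror 1" using hU by (simp only: mirror_0 mirror_1)
  note c_cases = equivariance_defect[OF gal h twist_map_Aut hV' hU' defect]
  have "finite (carrier (Aut C1))" using elements by simp
  from twist_map_continuous[OF this] obtain S where S: "finite S"
    "\<And>\<sigma> \<tau>. \<sigma> \<in> Gal \<Longrightarrow> \<tau> \<in> Gal \<Longrightarrow> \<forall>s\<in>S. \<sigma> s = \<tau> s \<Longrightarrow> twist_map \<sigma> = twist_map \<tau>"
    unfolding krull_continuous_def by blast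
  define q where "q \<sigma> \<longleftrightarrow> h (mirror 0) = mirror 0 \<or> \<sigma> sqrt_v = sqrt_v" for \<sigma>
  \<comment> \<open>Where the twisting value has order four, the factor V^3 = V^-1 strips off the V
    contributed by \<open>\<Xi>\<close> and leaves a central element.\<close>
  define \<xi> where "\<xi> \<sigma> = (if q \<sigma> then twist_map \<sigma> else twist_map \<sigma> \<otimes>\<^bsub>Aut C1\<^esub> rot 3)" for \<sigma>
  have c_rot: "\<exists>j. twist_map \<sigma> = rot j \<and> (if q \<sigma> then j \<in> {0, 2} else j \<in> {1, 3})" if \<sigma>: "\<sigma> \<in> Gal" for \<sigma>
    using c_cases[OF \<sigma> \<sigma> \<sigma> \<sigma>] fixV[OF \<sigma>] unfolding q_def by auto
  have \<xi>_val: "\<xi> \<sigma> \<in> {\<one>\<^bsub>Aut C1\<^esub>, \<iota>}" if \<sigma>: "\<sigma> \<in> Gal" for \<sigma>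
    using c_rot[OF \<sigma>] unfolding \<xi>_def \<iota> one_rot by (auto simp: rot_eq_iff split: if_splits)
  have \<xi>_Aut: "\<xi> \<sigma> \<in> carrier (Aut C1)" if "\<sigma> \<in> Gal" for \<sigma>
    using \<xi>_val[OF that] by (auto simp: \<iota>)
  have sign_comp: "(\<sigma> \<circ> \<tau>) sqrt_v = sqrt_v \<longleftrightarrow> (\<sigma> sqrt_v = sqrt_v \<longleftrightarrow> \<tau> sqrt_v = sqrt_v)"
    if "\<sigma> \<in> Gal" "\<tau> \<in> Gal" for \<sigma> \<tau>
    using sign[OF that(1)] sign[OF that(2)] sv_neq field_hom_uminus[OF Gal_hom[OF that(1)], of sqrt_v] by auto
  \<comment> \<open>Everything happens among rotations, on which \<sigma> acts by the sign of
    \<open>sqrt_v\<close>. The stripped factors are consistent: if \<sigma> and \<tau> both negate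
    \<open>sqrt_v\<close>, then V times its conjugate V^3 is 1, and \<sigma>\<tau> fixes
    \<open>sqrt_v\<close>.\<close>
  have \<xi>_comp: "\<xi> (\<sigma> \<circ> \<tau>) = \<xi> \<sigma> \<otimes>\<^bsub>Aut C1\<^esub> gal_aut C1 \<sigma> (\<xi> \<tau>)" if \<sigma>: "\<sigma> \<in> Gal" and \<tau>: "\<tau> \<in> Gal" for \<sigma> \<tau>
  proof -
    obtain i j where ij: "twist_map \<sigma> = rot i" "twist_map \<tau> = rot j"
      "if q \<sigma> then i \<in> {0, 2} else i \<in> {1, 3}" "if q \<tau> then j \<in> {0, 2} else j \<in> {1, 3}"
      using c_rot[OF \<sigma>] c_rot[OF \<tau>] by blast
    have "twist_map (\<sigma> \<circ> \<tau>) = rot ((if \<sigma> sqrt_v = sqrt_v then j else 3 * j) + i)"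
      unfolding twist_map_comp[OF \<sigma> \<tau>] ij(1,2) gal_rot[OF \<sigma>] by simp
    then show ?thesis
      using ij sign_comp[OF \<sigma> \<tau>] unfolding \<xi>_def q_def
      by (auto simp: gal_rot[OF \<sigma>] rot_eq_iff split: if_splits)
  qed
  have cocycle_\<xi>: "cocycle C1 \<xi>"
    unfolding cocycle_def
  proof (intro conjI ballI)
    show "krull_continuous \<xi>"
      unfolding krull_continuous_def
    \<comment> \<open>\<open>sqrt_v\<close> is added because the case distinction \<open>q\<close>
      depends on it.\<close>
    proof (intro exI[of _ "insert sqrt_v S"] conjI ballI impI)
      fix \<sigma> \<tau> :: "'k alg_closure \<Rightarrow> 'k alg_closure"
      assume "\<sigma> \<in> Gal" "\<tau> \<in> Gal" "\<forall>s\<in>insert sqrt_v S. \<sigma> s = \<tau> s"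
      then show "\<xi> \<sigma> = \<xi> \<tau>" using S(2)[of \<sigma> \<tau>] by (simp add: \<xi>_def q_def)
    qed (use S in simp)
  qed (use \<xi>_Aut \<xi>_comp in auto)
  have iso_refl: "k_isomorphic C2 C2"
    unfolding k_isomorphic_def using isoms_id by (intro bexI[of _ id]) auto
  \<comment> \<open>\<open>C2\<close> together with \<open>\<psi>\<close> is itself the twist by any
    cocycle that agrees with \<open>twist_map\<close> on the Galois group, so \<open>C'\<close> is
    taken to be \<open>C2\<close>.\<close>
  have twist: "is_twist C1 \<eta> C2 \<psi>" if "cocycle C1 \<eta>" "\<And>\<sigma>. \<sigma> \<in> Gal \<Longrightarrow> \<eta> \<sigma> = twist_map \<sigma>" for \<eta>
    unfolding is_twist_def using that C2 \<psi> by (simp add: twist_map_def)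
  show ?thesis
  proof (intro exI[of _ \<xi>] conjI ballI)
    show "(\<exists>(C' :: ('k, 'g) curve) \<phi>. is_twist C1 \<xi> C' \<phi> \<and> k_isomorphic C2 C') \<or>
      (\<exists>(C' :: ('k, 'g) curve) \<phi>. is_twist C1 (\<lambda>\<sigma>. \<xi> \<sigma> \<otimes>\<^bsub>Aut C1\<^esub> \<Xi> \<sigma>) C' \<phi> \<and> k_isomorphic C2 C')"
    proof (cases "h (mirror 0) = mirror 0")
      case True
      then have "is_twist C1 \<xi> C2 \<psi>" by (intro twist cocycle_\<xi>) (simp add: \<xi>_def q_def)
      then show ?thesis using iso_refl by blast
    next
      case False
      have \<eta>: "\<xi> \<sigma> \<otimes>\<^bsub>Aut C1\<^esub> \<Xi> \<sigma> = twist_map \<sigma>" if \<sigma>: "\<sigma> \<in> Gal" for \<sigma>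
      proof (cases "\<sigma> sqrt_v = sqrt_v")
        case True
        then show ?thesis using assms(15)[OF \<sigma>] twist_map_Aut[OF \<sigma>] by (simp add: \<xi>_def q_def)
      next
        case neg: False
        then have "\<Xi> \<sigma> = V" using assms(16)[OF \<sigma>] sign[OF \<sigma>] by blast
        then have "\<Xi> \<sigma> = rot 1" by (simp only: rot_1)
        moreover have "\<xi> \<sigma> = twist_map \<sigma> \<otimes>\<^bsub>Aut C1\<^esub> rot 3" using neg False by (simp add: \<xi>_def q_def)
        moreover obtain j where "twist_map \<sigma> = rot j" using c_rot[OF \<sigma>] by blast
        ultimately show ?thesis by (simp add: rot_eq_iff)
      qed
      have "cocycle C1 (\<lambda>\<sigma>. \<xi> \<sigma> \<otimes>\<^bsub>Aut C1\<^esub> \<Xi> \<sigma>)"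
        unfolding cocycle_def
      proof (intro conjI ballI)
        fix \<sigma> \<tau> :: "'k alg_closure \<Rightarrow> 'k alg_closure"
        assume \<sigma>\<tau>: "\<sigma> \<in> Gal" "\<tau> \<in> Gal"
        obtain i j where ij: "twist_map \<sigma> = rot i" "twist_map \<tau> = rot j"
          using c_rot[OF \<sigma>\<tau>(1)] c_rot[OF \<sigma>\<tau>(2)] by blast
        show "\<xi> (\<sigma> \<circ> \<tau>) \<otimes>\<^bsub>Aut C1\<^esub> \<Xi> (\<sigma> \<circ> \<tau>)
          = (\<xi> \<sigma> \<otimes>\<^bsub>Aut C1\<^esub> \<Xi> \<sigma>) \<otimes>\<^bsub>Aut C1\<^esub> gal_aut C1 \<sigma> (\<xi> \<tau> \<otimes>\<^bsub>Aut C1\<^esub> \<Xi> \<tau>)"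
          unfolding \<eta>[OF \<sigma>\<tau>(1)] \<eta>[OF \<sigma>\<tau>(2)] \<eta>[OF comp_Gal[OF \<sigma>\<tau>]] twist_map_comp[OF \<sigma>\<tau>] ij gal_rot[OF \<sigma>\<tau>(1)]
          by (simp add: add.commute)
      next
        show "krull_continuous (\<lambda>\<sigma>. \<xi> \<sigma> \<otimes>\<^bsub>Aut C1\<^esub> \<Xi> \<sigma>)"
          unfolding krull_continuous_def
        proof (intro exI[of _ S] conjI ballI impI)
          fix \<sigma> \<tau> :: "'k alg_closure \<Rightarrow> 'k alg_closure"
          assume \<sigma>\<tau>: "\<sigma> \<in> Gal" "\<tau> \<in> Gal" "\<forall>s\<in>S. \<sigma> s = \<tau> s"
          then show "\<xi> \<sigma> \<otimes>\<^bsub>Aut C1\<^esub> \<Xi> \<sigma> = \<xi> \<tau> \<otimes>\<^bsub>Aut C1\<^esub> \<Xi> \<tau>"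
            unfolding \<eta>[OF \<sigma>\<tau>(1)] \<eta>[OF \<sigma>\<tau>(2)] by (rule S(2))
        qed (use S in simp)
      qed (simp add: \<eta> twist_map_Aut)
      then have "is_twist C1 (\<lambda>\<sigma>. \<xi> \<sigma> \<otimes>\<^bsub>Aut C1\<^esub> \<Xi> \<sigma>) C2 \<psi>" by (intro twist \<eta>)
      then show ?thesis using iso_refl by blast
    qed
  qed (use cocycle_\<xi> \<xi>_val in auto)
qed

end
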